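(* Let $s\in(0,1)$ and $k\in\mathbb{N}$. Consider sequences of functions $u_m:\mathbb{R}^n\to\mathbb{R}$ and $f_m:B_1\to\mathbb{R}$ such that $u_m$ and $f_m$ are continuous in $B_1$ and $$(-\Delta)^s u_m\overset{k}{=}f_m\quad\text{in }B_1.$$ Assume that $u_m\to u$ in $L^1(B_1)$ and locally uniformly in $B_1$, and that $f_m\to f$ locally uniformly in $B_1$ as $m\to+\infty$, for some functions $u\in L^1(\mathbb{R}^n)$ and $f:B_1\to\mathbb{R}$. Suppose also that $$\sup_{m\in\mathbb{N}}\int_{\mathbb{R}^n}\frac{|u_m(y)|}{1+|y|^{n+2s+k}}\,dy<+\infty$$ and that $$\lim_{m\to+\infty}\int_{\mathbb{R}^n}\frac{u_m(y)\,\varphi(y)}{1+|y|^{n+2s+k}}\,dy=\int_{\mathbb{R}^n}\frac{u(y)\,\varphi(y)}{1+|y|^{n+2s+k}}\,dy$$ for any $\varphi\in L^\infty(\mathbb{R}^n)$. Then $(-\Delta)^s u\overset{k}{=}f$ in $B_1$.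
   Context: $\mathbb{N}=\{0,1,2,\dots\}$; $B_r$ is the open ball of radius $r$ centered at the origin of $\mathbb{R}^n$; polynomials of negative degree are set to be zero. For $s\in(0,1)$, $(-\Delta)^s u(x):=\lim_{\varepsilon\to0}\int_{\mathbb{R}^n\setminus B_\varepsilon(x)}\frac{u(x)-u(y)}{|x-y|^{n+2s}}\,dy$. Viscosity sense (standard): for an open set $\Omega$, $w:\mathbb{R}^n\to\mathbb{R}$ continuous in $\Omega$ with $\int_{\mathbb{R}^n}\frac{|w(y)|}{1+|y|^{n+2s}}dy<+\infty$, and $g$ continuous in $\Omega$, one says $(-\Delta)^s w=g$ in $\Omega$ in the viscosity sense if, whenever $x_0\in\Omega$, $N\subset\Omega$ is a neighborhood of $x_0$, $\varphi\in C^2(N)$, $\varphi(x_0)=w(x_0)$ and $\varphi\ge w$ in $N$ (resp. $\varphi\le w$ in $N$), the function equal to $\varphi$ in $N$ and to $w$ outside $N$ has $(-\Delta)^s$ at $x_0$ that is $\le g(x_0)$ (resp. $\ge g(x_0)$). Let $\chi_R$ be the function equal to $1$ in $B_R$ and $0$ elsewhere. For $k\in\mathbb{N}$, $f:B_1\to\mathbb{R}$ and $u:\mathbb{R}^n\to\mathbb{R}$ continuous in $B_1$ with $\int_{\mathbb{R}^n}\frac{|u(y)|}{1+|y|^{n+2s+k}}dy<+\infty$, one writes $(-\Delta)^s u\overset{k}{=}f$ in $B_1$ if there exist polynomials $P_R$ of degree at most $k-1$ and functions $f_R:B_1\to\mathbb{R}$ (for all sufficiently large $R$) such that $(-\Delta)^s(\chi_R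 u)=f_R+P_R$ in $B_1$ in the viscosity sense and $\lim_{R\to+\infty}f_R(x)=f(x)$ for every $x\in B_1$. *)

theory Defs
  imports "HOL-Analysis.Analysis"
begin

text \<open>Functions on the unit ball are total functions of which only the values on \<open>ball 0 1\<close>
  are ever used.\<close>

text \<open>Since the weight is positive and continuous, this says that \<open>w\<close> is Lebesgue measurable
  and that \<open>\<bar>w y\<bar> / (1 + norm y powr a)\<close> has finite integral.\<close>

definition weighted_L1 :: "real \<Rightarrow> (real^'n \<Rightarrow> real) \<Rightarrow> bool" where
  "weighted_L1 a w \<longleftrightarrow> integrable lebesgue (\<lambda>y. w y / (1 + norm y powr a))"

definition L_infty :: "(real^'n \<Rightarrow> real) \<Rightarrow> bool" where
  "L_infty \<phi> \<longleftrightarrow>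
     \<phi> \<in> borel_measurable lebesgue \<and> (\<exists>C. AE y in lebesgue. \<bar>\<phi> y\<bar> \<le> C)"

definition locally_uniform_limit ::
  "(real^'n) set \<Rightarrow> (nat \<Rightarrow> real^'n \<Rightarrow> real) \<Rightarrow> (real^'n \<Rightarrow> real) \<Rightarrow> bool" where
  "locally_uniform_limit \<Omega> F g \<longleftrightarrow>
     (\<forall>K. compact K \<and> K \<subseteq> \<Omega> \<longrightarrow> uniform_limit K F g sequentially)"

text \<open>The pointwise fractional Laplacian, without normalising constant, as a relation: \<open>L\<close> is its
  value for \<open>u\<close> at \<open>x\<close>. The relation avoids the junk value \<open>0\<close> that the library gives to
  the integral of a non-integrable function.\<close>

definition has_frac_laplacian ::
  "real \<Rightarrow> (real^'n \<Rightarrow> real) \<Rightarrow> real^'n \<Rightarrow> real \<Rightarrow> bool" where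
  "has_frac_laplacian s u x L \<longleftrightarrow>
     (\<forall>\<epsilon>>0. set_integrable lebesgue (- ball x \<epsilon>)
        (\<lambda>y. (u x - u y) / norm (x - y) powr (real CARD('n) + 2 * s))) \<and>
     ((\<lambda>\<epsilon>. set_lebesgue_integral lebesgue (- ball x \<epsilon>)
        (\<lambda>y. (u x - u y) / norm (x - y) powr (real CARD('n) + 2 * s))) \<longlongrightarrow> L) (at_right 0)"

text \<open>Twice continuously differentiable on an open set, with gradient \<open>G\<close> and Hessian \<open>H\<close>.\<close>

definition C2_on :: "(real^'n) set \<Rightarrow> (real^'n \<Rightarrow> real) \<Rightarrow> bool" where
  "C2_on N \<phi> \<longleftrightarrow>
     (\<exists>(G :: real^'n \<Rightarrow> real^'n) (H :: real^'n \<Rightarrow> real^'n^'n).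
        (\<forall>x\<in>N. (\<phi> has_derivative (\<lambda>h. G x \<bullet> h)) (at x)) \<and>
        (\<forall>x\<in>N. (G has_derivative (\<lambda>h. H x *v h)) (at x)) \<and>
        continuous_on N H)"

text \<open>\<open>(-\<Delta>)\<^sup>s w = g\<close> in \<open>\<Omega>\<close> in the viscosity sense; neighbourhoods are open.

  A function that is \<open>C\<^sup>2\<close> in the open set \<open>N\<close> may blow up at the boundary of \<open>N\<close> so fast that
  the glued function \<open>v\<close> is not integrable. If \<open>\<phi> \<ge> w\<close> in \<open>N\<close>, the fractional Laplacian
  of \<open>v\<close> at \<open>x0\<close> is then \<open>-\<infinity>\<close>, and if \<open>\<phi> \<le> w\<close> it is \<open>+\<infinity>\<close>, so that the
  required inequality holds trivially. The condition that \<open>v\<close> has finite weighted integral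
  only leaves out these cases; without it the existence of a real value \<open>L\<close> would fail.\<close>

definition frac_laplacian_viscosity ::
  "real \<Rightarrow> (real^'n) set \<Rightarrow> (real^'n \<Rightarrow> real) \<Rightarrow> (real^'n \<Rightarrow> real) \<Rightarrow> bool" where
  "frac_laplacian_viscosity s \<Omega> w g \<longleftrightarrow>
     continuous_on \<Omega> w \<and> continuous_on \<Omega> g \<and> weighted_L1 (real CARD('n) + 2 * s) w \<and>
     (\<forall>x0\<in>\<Omega>. \<forall>N \<phi> v.
        open N \<and> x0 \<in> N \<and> N \<subseteq> \<Omega> \<and> C2_on N \<phi> \<and> \<phi> x0 = w x0 \<and>
        v = (\<lambda>y. if y \<in> N then \<phi> y else w y) \<and> weighted_L1 (real CARD('n) + 2 * s) v \<longrightarrow>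
          ((\<forall>y\<in>N. \<phi> y \<ge> w y) \<longrightarrow> (\<exists>L. has_frac_laplacian s v x0 L \<and> L \<le> g x0)) \<and>
          ((\<forall>y\<in>N. \<phi> y \<le> w y) \<longrightarrow> (\<exists>L. has_frac_laplacian s v x0 L \<and> L \<ge> g x0)))"

text \<open>Real polynomials in the coordinates, of degree at most \<open>k - 1\<close>: the sum runs over the
  multi-indices \<open>\<alpha>\<close> of order less than \<open>k\<close>. For \<open>k = 0\<close> it is empty, so only the zero
  polynomial remains.\<close>

lemma finite_multi_indices: "finite {\<alpha> :: 'n::finite \<Rightarrow> nat. (\<Sum>i\<in>UNIV. \<alpha> i) < k}"
proof (rule finite_subset)
  show "{\<alpha> :: 'n \<Rightarrow> nat. (\<Sum>i\<in>UNIV. \<alpha> i) < k} \<subseteq> (\<Pi>\<^sub>E i\<in>UNIV. {..<k})"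
  proof
    fix \<alpha> :: "'n \<Rightarrow> nat" assume "\<alpha> \<in> {\<alpha>. (\<Sum>i\<in>UNIV. \<alpha> i) < k}"
    moreover have "\<alpha> i \<le> (\<Sum>i\<in>UNIV. \<alpha> i)" for i
      by (rule member_le_sum) simp_all
    ultimately have "\<alpha> i < k" for i
      by (metis le_less_trans mem_Collect_eq)
    then show "\<alpha> \<in> (\<Pi>\<^sub>E i\<in>UNIV. {..<k})"
      by (simp add: PiE_UNIV_domain)
  qed
  show "finite (\<Pi>\<^sub>E i\<in>(UNIV :: 'n set). {..<k})"
    by (intro finite_PiE) auto
qed

definition polynomial_degree_less :: "nat \<Rightarrow> (real^'n \<Rightarrow> real) \<Rightarrow> bool" where
  "polynomial_degree_less k P \<longleftrightarrow>
     (\<exists>c :: ('n \<Rightarrow> nat) \<Rightarrow> real.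
        P = (\<lambda>x. \<Sum>\<alpha> | (\<Sum>i\<in>UNIV. \<alpha> i) < k. c \<alpha> * (\<Prod>i\<in>UNIV. (x $ i) ^ \<alpha> i)))"

text \<open>The relation \<open>(-\<Delta>)\<^sup>s u = f\<close> in the unit ball up to polynomials of degree at most
  \<open>k - 1\<close>. Here \<open>F R\<close> and \<open>P R\<close> are the \<open>f\<^sub>R\<close> and \<open>P\<^sub>R\<close> of the informal notation,
  \<open>R\<close> being a real parameter.\<close>

definition frac_laplacian_mod_poly ::
  "real \<Rightarrow> nat \<Rightarrow> (real^'n \<Rightarrow> real) \<Rightarrow> (real^'n \<Rightarrow> real) \<Rightarrow> bool" where
  "frac_laplacian_mod_poly s k u f \<longleftrightarrow>
     continuous_on (ball 0 1) u \<and> weighted_L1 (real CARD('n) + 2 * s + real k) u \<and>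
     (\<exists>(P :: real \<Rightarrow> real^'n \<Rightarrow> real) (F :: real \<Rightarrow> real^'n \<Rightarrow> real).
        (\<forall>\<^sub>F R in at_top.
           polynomial_degree_less k (P R) \<and>
           frac_laplacian_viscosity s (ball 0 1)
             (\<lambda>x. indicat_real (ball 0 R) x * u x) (\<lambda>x. F R x + P R x)) \<and>
        (\<forall>x\<in>ball 0 1. ((\<lambda>R. F R x) \<longlongrightarrow> f x) at_top))"

end

theory Submission
  imports Defs
begin

text \<open>Write \<open>\<chi>\<^sub>R\<close> for the indicator function of the ball of radius \<open>R\<close>. Outside the ball of radius
  \<open>4\<close> the kernel \<open>norm (x - y) powr (- n - 2 * s)\<close> is expanded in \<open>x\<close> up to degree \<open>k - 1\<close>, with a
  remainder \<open>\<kappa> x y\<close> that decays like \<open>norm y powr (- n - 2 * s - k)\<close>. This reduces the equation for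
  \<open>u\<close> modulo polynomials to the single viscosity equation with left-hand side \<open>\<chi>\<^sub>4 u\<close> and right-hand
  side \<open>f + H u + P\<close>, where \<open>H u\<close> is the integral of \<open>u\<close> against \<open>\<kappa>\<close> and \<open>P\<close> is a polynomial of degree
  at most \<open>k - 1\<close>. The reduction needs no uniqueness of the right-hand side: the right-hand sides obtained
  from different \<open>R\<close> all satisfy the inequalities given by the same test functions for \<open>\<chi>\<^sub>4 u\<close>, and
  the points that admit such test functions are dense, which bounds the polynomial parts.

  For the sequence, the equation for \<open>\<chi>\<^sub>4 u\<^sub>m\<close> with polynomial \<open>P\<^sub>m\<close> is divided by \<open>M\<^sub>m\<close>, one plus
  the sum of the \<open>\<bar>P\<^sub>m\<bar>\<close> over a set of interpolation nodes. Along a subsequence \<open>1 / M\<^sub>m\<close> converges to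
  some \<open>\<theta> \<ge> 0\<close> and \<open>P\<^sub>m / M\<^sub>m\<close> to a polynomial \<open>Q\<close>. Stability of viscosity solutions gives the equation for
  \<open>\<theta> \<chi>\<^sub>4 u\<close> with right-hand side \<open>\<theta> (f + H u) + Q\<close>. If \<open>\<theta>\<close> were \<open>0\<close>, the zero function would solve
  the equation with the right-hand side \<open>Q\<close>, which is nonzero by the normalisation; so one can divide by \<open>\<theta>\<close>.\<close>

section \<open>Integrability of radial powers\<close>

text \<open>The obstacle is a double lack of control. The right-hand sides are known only up to
  polynomials that depend on R and on m with no bound in either, and f_R converges merely pointwise
  with no rate uniform in m, so a joint limit in R and m is out of reach. Fixing the radius removes
  R: all that is left of the tail of u_m is its integral against \<kappa>, which passes to the limit
  because \<kappa> decays exactly like the weight in the hypotheses. The radius 4 comes from the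
  expansion. In |x - y|^2 = |y|^2 (1 + t) with |x| < 1 and |y| at least 4 one has |t| at most 9/16,
  inside the disc of convergence of the binomial series of (1 + t)^(-a/2), where a = n + 2s. The two
  limits differ in kind. As R grows, the function at radius 4 stays the same, so one test function
  serves all R and pointwise convergence suffices. As m grows, the function changes and the touching
  points move; this is why Lipschitz bounds in x accompany every decay estimate.\<close>

lemma borel_measurable_lebesgue_borel:
  "f \<in> borel_measurable borel \<Longrightarrow> f \<in> borel_measurable lebesgue"
  by (simp add: measurable_completion)

text \<open>Only translations and point reflections occur: \<open>c = 1\<close> gives
  \<open>x + z\<close> and \<open>c = -1\<close> gives \<open>x - z\<close>, the two substitutions
  behind second differences.\<close>

lemma
  fixes x :: "'a::euclidean_space" and c :: real
  assumes c: "\<bar>c\<bar> = 1"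
  shows distr_lebesgue_isometry: "distr lebesgue lebesgue (\<lambda>z. x + c *\<^sub>R z) = lebesgue"
    and measurable_lebesgue_isometry: "(\<lambda>z. x + c *\<^sub>R z) \<in> lebesgue \<rightarrow>\<^sub>M lebesgue"
proof -
  have T: "(\<lambda>z. x + (\<Sum>j\<in>Basis. (c * (z \<bullet> j)) *\<^sub>R j)) = (\<lambda>z. x + c *\<^sub>R z)"
    unfolding scaleR_scaleR[symmetric] scaleR_sum_right[symmetric] euclidean_representation ..
  have "c \<noteq> 0" using c by auto
  then show "(\<lambda>z. x + c *\<^sub>R z) \<in> lebesgue \<rightarrow>\<^sub>M lebesgue"
    using lebesgue_affine_measurable[of "\<lambda>_. c" x] by (simp add: T)
  have "lebesgue = density (distr lebesgue lebesgue (\<lambda>z. x + c *\<^sub>R z)) (\<lambda>_. 1)"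
    using lebesgue_affine_euclidean[of "\<lambda>_. c" x] \<open>c \<noteq> 0\<close> c by (simp add: T)
  then show "distr lebesgue lebesgue (\<lambda>z. x + c *\<^sub>R z) = lebesgue"
    by (simp add: density_1)
qed

lemma
  fixes x :: "'a::euclidean_space" and c :: real and f :: "'a \<Rightarrow> real"
  assumes c: "\<bar>c\<bar> = 1"
  shows integrable_lebesgue_isometry:
      "integrable lebesgue f \<Longrightarrow> integrable lebesgue (\<lambda>z. f (x + c *\<^sub>R z))"
    and integral_lebesgue_isometry:
      "f \<in> borel_measurable lebesgue \<Longrightarrow> (LINT z|lebesgue. f (x + c *\<^sub>R z)) = integral\<^sup>L lebesgue f"
    and borel_measurable_lebesgue_isometry:
      "f \<in> borel_measurable lebesgue \<Longrightarrow> (\<lambda>z. f (x + c *\<^sub>R z)) \<in> borel_measurable lebesgue"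
proof -
  note T = measurable_lebesgue_isometry[OF c, of x] and D = distr_lebesgue_isometry[OF c, of x]
  show "integrable lebesgue (\<lambda>z. f (x + c *\<^sub>R z))" if "integrable lebesgue f"
    using integrable_distr[OF T, of f] that by (simp add: D)
  show "(LINT z|lebesgue. f (x + c *\<^sub>R z)) = integral\<^sup>L lebesgue f"
    if "f \<in> borel_measurable lebesgue"
    using integral_distr[OF T that] by (simp add: D)
  show "(\<lambda>z. f (x + c *\<^sub>R z)) \<in> borel_measurable lebesgue" if "f \<in> borel_measurable lebesgue"
    using measurable_compose[OF T that] .
qed

text \<open>A comparison that replaces polar coordinates: \<open>f\<close> lies below the sum of the
  constants \<open>c j\<close> on the balls of radius \<open>\<rho> j\<close>, whose volumes are
  multiples of \<open>\<rho> j ^ CARD('n)\<close>. Full balls instead of shells cost only a constant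
  for geometric radii.\<close>

lemma integrable_shells:
  fixes f :: "real^'n \<Rightarrow> real"
  assumes f: "f \<in> borel_measurable lebesgue" "\<And>z. 0 \<le> f z"
    and bound: "\<And>z. f z \<noteq> 0 \<Longrightarrow> \<exists>j::nat. norm z < \<rho> j \<and> f z \<le> c j"
    and nonneg: "\<And>j. 0 \<le> c j" "\<And>j. 0 \<le> \<rho> j"
    and summable: "summable (\<lambda>j. c j * \<rho> j ^ CARD('n))"
  shows "integrable lebesgue f"
proof -
  let ?V = "unit_ball_vol (real CARD('n))"
  let ?g = "\<lambda>j z. ennreal (c j) * indicator (ball (0::real^'n) (\<rho> j)) z"
  have "(\<integral>\<^sup>+ z. ennreal (f z) \<partial>lebesgue) \<le> (\<integral>\<^sup>+ z. (\<Sum>j. ?g j z) \<partial>lebesgue)"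
  proof (rule nn_integral_mono)
    fix z :: "real^'n"
    show "ennreal (f z) \<le> (\<Sum>j. ?g j z)"
    proof (cases "f z = 0")
      case False
      then obtain j where j: "norm z < \<rho> j" "f z \<le> c j" using bound by blast
      then have "ennreal (f z) \<le> (\<Sum>i\<in>{j}. ?g i z)" by (simp add: ennreal_leI)
      also have "\<dots> \<le> (\<Sum>j. ?g j z)" by (rule sum_le_suminf) auto
      finally show ?thesis .
    qed simp
  qed
  also have "\<dots> = (\<Sum>j. \<integral>\<^sup>+ z. ?g j z \<partial>lebesgue)"
    by (rule nn_integral_suminf) (intro borel_measurable_times_ennreal borel_measurable_indicator, auto)
  also have "\<dots> = (\<Sum>j. ennreal (?V * (c j * \<rho> j ^ CARD('n))))"
  proof (rule arg_cong[where f = suminf], rule ext)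
    fix j
    have "(\<integral>\<^sup>+ z. ?g j z \<partial>lebesgue) = ennreal (c j) * emeasure lebesgue (ball (0::real^'n) (\<rho> j))"
      by (rule nn_integral_cmult_indicator) auto
    then show "(\<integral>\<^sup>+ z. ?g j z \<partial>lebesgue) = ennreal (?V * (c j * \<rho> j ^ CARD('n)))"
      using nonneg by (simp add: emeasure_ball ennreal_mult'[symmetric] mult_ac)
  qed
  also have "\<dots> = ennreal (\<Sum>j. ?V * (c j * \<rho> j ^ CARD('n)))"
    using nonneg by (intro suminf_ennreal2 summable_mult summable) auto
  also have "\<dots> < \<infinity>" by simp
  finally show ?thesis
    using f by (intro integrableI_bounded) auto
qed

lemma dyadic_shell:
  fixes t r :: real
  assumes "0 < r" "r \<le> t"
  shows "\<exists>j::nat. r * 2 ^ j \<le> t \<and> t < r * 2 ^ Suc j"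
proof -
  obtain n where "t / r < 2 ^ n" using real_arch_pow[of 2 "t / r"] by auto
  then have ex: "\<exists>n. t < r * 2 ^ n" using assms by (auto simp: field_simps)
  define m where "m = (LEAST n. t < r * 2 ^ n)"
  have m: "t < r * 2 ^ m" unfolding m_def by (rule LeastI_ex[OF ex])
  have "m \<noteq> 0" using m assms by (intro notI) auto
  then obtain j where j: "m = Suc j" by (cases m) auto
  have "\<not> t < r * 2 ^ j" using not_less_Least[of j "\<lambda>n. t < r * 2 ^ n"] j m_def by simp
  then have "r * 2 ^ j \<le> t" by simp
  then show ?thesis using m j by blast
qed

lemma dyadic_shell':
  fixes t r :: real
  assumes "0 < t" "t < r"
  shows "\<exists>j::nat. r / 2 ^ Suc j \<le> t \<and> t < r / 2 ^ j"
proof -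
  obtain n where "r / t < 2 ^ n" using real_arch_pow[of 2 "r / t"] by auto
  then have ex: "\<exists>n. r / 2 ^ n \<le> t" using assms by (intro exI[of _ n]) (auto simp: field_simps)
  define m where "m = (LEAST n. r / 2 ^ n \<le> t)"
  have m: "r / 2 ^ m \<le> t" unfolding m_def by (rule LeastI_ex[OF ex])
  have "m \<noteq> 0" using m assms by (intro notI) auto
  then obtain j where j: "m = Suc j" by (cases m) auto
  have "\<not> r / 2 ^ j \<le> t" using not_less_Least[of j "\<lambda>n. r / 2 ^ n \<le> t"] j m_def by simp
  then have "t < r / 2 ^ j" by simp
  then show ?thesis using m j by blast
qed

text \<open>On dyadic shells the integrand shrinks like 2^(-a j) while the volume grows like 2^(n
  j), so the series is geometric with ratio 2^(n - a) < 1.\<close>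

lemma integrable_norm_powr_far:
  fixes a r :: real
  assumes a: "real CARD('n) < a" and r: "0 < r"
  shows "integrable lebesgue (\<lambda>z::real^'n. indicat_real (- ball 0 r) z / norm z powr a)"
proof (rule integrable_shells[where \<rho> = "\<lambda>j. r * 2 ^ Suc j" and c = "\<lambda>j. (r * 2 ^ j) powr (- a)"])
  show "(\<lambda>z::real^'n. indicat_real (- ball 0 r) z / norm z powr a) \<in> borel_measurable lebesgue"
    by (rule borel_measurable_lebesgue_borel) measurable
  fix z :: "real^'n" assume "indicat_real (- ball 0 r) z / norm z powr a \<noteq> 0"
  then have z: "r \<le> norm z" by (auto simp: indicator_def split: if_splits)
  then obtain j :: nat where j: "r * 2 ^ j \<le> norm z" "norm z < r * 2 ^ Suc j"
    using dyadic_shell[OF r] by blast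
  have "indicat_real (- ball 0 r) z / norm z powr a = norm z powr (- a)"
    using z by (simp add: powr_minus divide_inverse)
  also have "\<dots> \<le> (r * 2 ^ j) powr (- a)"
    using j r a by (intro powr_mono2') auto
  finally show "\<exists>j. norm z < r * 2 ^ Suc j \<and> indicat_real (- ball 0 r) z / norm z powr a \<le> (r * 2 ^ j) powr - a"
    using j by blast
next
  define q :: real where "q = 2 powr (real CARD('n) - a)"
  have q: "0 \<le> q" "q < 1" using a by (auto simp: q_def powr_less_one)
  have "(r * 2 ^ j) powr (- a) * (r * 2 ^ Suc j) ^ CARD('n) = (r powr (- a) * (r * 2) ^ CARD('n)) * q ^ j" for j :: nat
  proof -
    have "(r * 2 ^ j) powr (- a) = r powr (- a) * (2 powr (- a)) ^ j"
      using r by (simp add: powr_mult powr_realpow[symmetric] powr_powr mult_ac)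
    moreover have "(r * 2 ^ Suc j) ^ CARD('n) = (r * 2) ^ CARD('n) * (2 ^ CARD('n)) ^ j"
      by (simp add: power_mult_distrib power_mult[symmetric] mult_ac)
    moreover have "q = 2 powr (- a) * 2 ^ CARD('n)"
      by (simp add: q_def powr_diff powr_minus powr_realpow divide_inverse)
    ultimately show ?thesis by (simp add: power_mult_distrib mult_ac)
  qed
  then show "summable (\<lambda>j. (r * 2 ^ j) powr (- a) * (r * 2 ^ Suc j) ^ CARD('n))"
    using q by (simp add: summable_mult summable_geometric)
qed (use r in auto)

text \<open>The factor \<open>norm z ^ 2\<close> is the gain from a second difference of a C^2
  function. It pushes the admissible exponents up to n + 2, which for a = n + 2s is the condition s
  < 1; the ratio over shrinking shells is 2^(a - 2 - n).\<close>

lemma integrable_norm_powr_near: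
  fixes a r :: real
  assumes a: "0 \<le> a" "a < real CARD('n) + 2" and r: "0 < r"
  shows "integrable lebesgue (\<lambda>z::real^'n. indicat_real (ball 0 r) z * norm z ^ 2 / norm z powr a)"
proof (rule integrable_shells[where \<rho> = "\<lambda>j. r / 2 ^ j"
      and c = "\<lambda>j. (r / 2 ^ Suc j) powr (- a) * (r / 2 ^ j) ^ 2"])
  show "(\<lambda>z::real^'n. indicat_real (ball 0 r) z * norm z ^ 2 / norm z powr a) \<in> borel_measurable lebesgue"
    by (intro borel_measurable_lebesgue_borel borel_measurable_divide borel_measurable_times
        borel_measurable_indicator borel_measurable_power powr_real_measurable
        borel_measurable_norm measurable_ident measurable_const) auto
  fix z :: "real^'n" assume "indicat_real (ball 0 r) z * norm z ^ 2 / norm z powr a \<noteq> 0"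
  then have z: "norm z < r" "0 < norm z" by (auto simp: indicator_def split: if_splits)
  then obtain j :: nat where j: "r / 2 ^ Suc j \<le> norm z" "norm z < r / 2 ^ j"
    using dyadic_shell' by blast
  have "indicat_real (ball 0 r) z * norm z ^ 2 / norm z powr a = norm z powr (- a) * norm z ^ 2"
    using z by (simp add: powr_minus divide_inverse)
  also have "\<dots> \<le> (r / 2 ^ Suc j) powr (- a) * (r / 2 ^ j) ^ 2"
  proof (intro mult_mono powr_mono2' power_mono)
    show "0 < r / 2 ^ Suc j" using r by simp
  qed (use j a z in \<open>auto simp del: power_Suc\<close>)
  finally show "\<exists>j. norm z < r / 2 ^ j \<and> indicat_real (ball 0 r) z * norm z ^ 2 / norm z powr a
      \<le> (r / 2 ^ Suc j) powr (- a) * (r / 2 ^ j) ^ 2"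
    using j by blast
next
  define q :: real where "q = 2 powr (a - 2 - real CARD('n))"
  have q: "0 \<le> q" "q < 1" using a by (auto simp: q_def powr_less_one)
  have "(r / 2 ^ Suc j) powr (- a) * (r / 2 ^ j) ^ 2 * (r / 2 ^ j) ^ CARD('n)
      = ((r / 2) powr (- a) * r ^ 2 * r ^ CARD('n)) * q ^ j" for j :: nat
  proof -
    have "(r / 2 ^ Suc j) powr (- a) = (r / 2) powr (- a) * (2 ^ j) powr a"
      using r by (simp add: powr_mult powr_divide powr_minus divide_simps)
    moreover have "(2 ^ j) powr a = (2 powr a) ^ j"
      by (simp add: powr_realpow[symmetric] powr_powr mult_ac)
    moreover have "(r / 2 ^ j) ^ 2 = r ^ 2 * (1/4) ^ j"
      by (simp add: power_divide power_mult[symmetric] mult.commute[of j 2])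
         (simp add: power_mult divide_simps)
    moreover have "(r / 2 ^ j) ^ CARD('n) = r ^ CARD('n) * ((1 / 2) ^ CARD('n)) ^ j"
      by (simp add: power_divide power_mult[symmetric] mult_ac)
    moreover have "q = 2 powr a * (1/4) * (1 / 2) ^ CARD('n)"
    proof -
      have "q = 2 powr a / 2 powr 2 / 2 powr real CARD('n)" by (simp only: q_def powr_diff)
      then show ?thesis by (simp add: powr_realpow power_one_over)
    qed
    ultimately show ?thesis by (simp only: power_mult_distrib mult_ac)
  qed
  then show "summable (\<lambda>j. (r / 2 ^ Suc j) powr (- a) * (r / 2 ^ j) ^ 2 * (r / 2 ^ j) ^ CARD('n))"
    using q by (simp add: summable_mult summable_geometric)
qed (use r in auto)

section \<open>Interpolation in spaces of polynomials\<close>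

text \<open>The span consists of functions, not of coefficient families, so the generators may well
  be dependent on the set where they are compared. The index set is a parameter because
  interpolation is proved by induction over it.\<close>

definition coeff_space :: "('i \<Rightarrow> 'a \<Rightarrow> real) \<Rightarrow> 'i set \<Rightarrow> ('a \<Rightarrow> real) set" where
  "coeff_space e I = range (\<lambda>c x. \<Sum>i\<in>I. c i * e i x)"

lemma coeff_spaceI: "(\<lambda>x. \<Sum>i\<in>I. c i * e i x) \<in> coeff_space e I"
  by (auto simp: coeff_space_def)

lemma coeff_space_lincomb:
  assumes "p \<in> coeff_space e I" "q \<in> coeff_space e I"
  shows "(\<lambda>x. a * p x + b * q x) \<in> coeff_space e I"
proof -
  obtain c d where "p = (\<lambda>x. \<Sum>i\<in>I. c i * e i x)" "q = (\<lambda>x. \<Sum>i\<in>I. d i * e i x)"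
    using assms by (auto simp: coeff_space_def)
  then have "(\<lambda>x. a * p x + b * q x) = (\<lambda>x. \<Sum>i\<in>I. (a * c i + b * d i) * e i x)"
    by (simp add: sum_distrib_left sum.distrib algebra_simps)
  then show ?thesis by (simp add: coeff_spaceI)
qed

lemma coeff_space_zero: "(\<lambda>x. 0) \<in> coeff_space e I"
  using coeff_spaceI[of "\<lambda>_. 0"] by simp

lemma coeff_space_sum:
  assumes "\<And>j. j \<in> J \<Longrightarrow> p j \<in> coeff_space e I"
  shows "(\<lambda>x. \<Sum>j\<in>J. d j * p j x) \<in> coeff_space e I"
  using assms
proof (induction J rule: infinite_finite_induct)
  case (insert j J)
  then have "(\<lambda>x. d j * p j x + 1 * (\<Sum>j\<in>J. d j * p j x)) \<in> coeff_space e I"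
    by (intro coeff_space_lincomb) auto
  then show ?case using insert by simp
qed (auto simp: coeff_space_zero)

text \<open>Lagrange interpolation: adding a generator to the space either does not enlarge it on
  \<open>S\<close>, or provides a function that vanishes at all nodes chosen so far and is nonzero at some
  point of \<open>S\<close>, which becomes a new node.\<close>

lemma interpolation_nodes:
  fixes e :: "'i \<Rightarrow> 'a \<Rightarrow> real"
  assumes "finite I"
  shows "\<exists>X l. finite X \<and> X \<subseteq> S \<and> (\<forall>x\<in>X. l x \<in> coeff_space e I) \<and>
           (\<forall>x\<in>X. \<forall>y\<in>X. l x y = (if x = y then 1 else 0)) \<and>
           (\<forall>p\<in>coeff_space e I. \<forall>y\<in>S. p y = (\<Sum>x\<in>X. p x * l x y))"
  using assms
proof (induction I rule: finite_induct)
  case empty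
  have "\<forall>p\<in>coeff_space e {}. \<forall>y\<in>S. p y = 0" by (auto simp: coeff_space_def)
  then show ?case by (intro exI[of _ "{}"]) auto
next
  case (insert i I)
  then obtain X l where IH: "finite X \<and> X \<subseteq> S \<and> (\<forall>x\<in>X. l x \<in> coeff_space e I) \<and>
           (\<forall>x\<in>X. \<forall>y\<in>X. l x y = (if x = y then 1 else 0)) \<and>
           (\<forall>p\<in>coeff_space e I. \<forall>y\<in>S. p y = (\<Sum>x\<in>X. p x * l x y))"
    by (elim exE)
  then have X: "finite X" "X \<subseteq> S" "\<And>x. x \<in> X \<Longrightarrow> l x \<in> coeff_space e I"
    and delta: "\<And>x y. x \<in> X \<Longrightarrow> y \<in> X \<Longrightarrow> l x y = (if x = y then 1 else 0)"
    and rep: "\<And>p y. p \<in> coeff_space e I \<Longrightarrow> y \<in> S \<Longrightarrow> p y = (\<Sum>x\<in>X. p x * l x y)"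
    by simp_all
  have mono: "p \<in> coeff_space e (insert i I)" if p: "p \<in> coeff_space e I" for p
  proof -
    obtain c where "p = (\<lambda>x. \<Sum>i\<in>I. c i * e i x)" using p by (auto simp: coeff_space_def)
    then have "p = (\<lambda>x. \<Sum>j\<in>insert i I. (if j = i then 0 else c j) * e j x)"
      using insert(1,2) by (auto simp: fun_eq_iff intro!: sum.cong)
    also have "\<dots> \<in> coeff_space e (insert i I)" by (rule coeff_spaceI)
    finally show ?thesis .
  qed
  have ei: "e i \<in> coeff_space e (insert i I)"
  proof -
    have "e i = (\<lambda>x. \<Sum>j\<in>insert i I. (if j = i then 1 else 0) * e j x)"
      using insert(1,2) by (auto simp: fun_eq_iff intro!: sum.neutral)
    also have "\<dots> \<in> coeff_space e (insert i I)" by (rule coeff_spaceI)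
    finally show ?thesis .
  qed
  have split: "\<exists>q\<in>coeff_space e I. \<exists>c. \<forall>y. p y = q y + c * e i y"
    if p: "p \<in> coeff_space e (insert i I)" for p
  proof -
    obtain c where "p = (\<lambda>x. \<Sum>j\<in>insert i I. c j * e j x)" using p by (auto simp: coeff_space_def)
    then have "p y = (\<Sum>j\<in>I. c j * e j y) + c i * e i y" for y
      using insert(1,2) by simp
    then show ?thesis 
      by (intro bexI[OF _ coeff_spaceI[where I = I and c = c and e = e]] exI[of _ "c i"]) simp
  qed
  define r where "r y = e i y - (\<Sum>x\<in>X. e i x * l x y)" for y
  have L: "(\<lambda>y. \<Sum>x\<in>X. d x * l x y) \<in> coeff_space e I" for d
    using X(3) by (rule coeff_space_sum)
  have r: "r \<in> coeff_space e (insert i I)"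
    using coeff_space_lincomb[OF ei mono[OF L[of "e i"]], of 1 "-1"] by (simp add: r_def[abs_def])
  show ?case
  proof (cases "\<forall>y\<in>S. r y = 0")
    case True
    have "p y = (\<Sum>x\<in>X. p x * l x y)" if p: "p \<in> coeff_space e (insert i I)" and y: "y \<in> S" for p y
    proof -
      obtain q c where q: "q \<in> coeff_space e I" "\<And>y. p y = q y + c * e i y"
        using split[OF p] by blast
      have "e i y = (\<Sum>x\<in>X. e i x * l x y)" using True y by (simp add: r_def)
      then show ?thesis
        using rep[OF q(1) y] by (simp add: q(2) sum.distrib sum_distrib_left algebra_simps)
    qed
    then show ?thesis using X mono delta by (intro exI[of _ X] exI[of _ l]) auto
  next
    case False
    then obtain z where z: "z \<in> S" "r z \<noteq> 0" by blast
    have rX: "r x = 0" if "x \<in> X" for x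
    proof -
      have "(\<Sum>x'\<in>X. e i x' * l x' x) = (\<Sum>x'\<in>X. if x' = x then e i x' else 0)"
        using that by (intro sum.cong) (auto simp: delta)
      then show ?thesis using that X(1) by (simp add: r_def)
    qed
    then have zX: "z \<notin> X" using z by auto
    \<comment> \<open>The Lagrange basis is updated: the error \<open>r\<close>, normalised at
      \<open>z\<close>, serves the new node, and each old basis function is corrected by a multiple
      of it so as to vanish at \<open>z\<close>. The values at the old nodes are unchanged because
      \<open>r\<close> vanishes there.\<close>
    define l' where "l' x y = (if x = z then r y / r z else l x y - l x z * (r y / r z))" for x y
    have "l' x \<in> coeff_space e (insert i I)" if "x \<in> insert z X" for x
    proof (cases "x = z")
      case True
      then show ?thesis
        using coeff_space_lincomb[OF r coeff_space_zero, of "1 / r z" 0] by (simp add: l'_def[abs_def])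
    next
      case False
      then have "l x \<in> coeff_space e (insert i I)" using that X(3) mono by auto
      from coeff_space_lincomb[OF this r, of 1 "- l x z / r z"] False
      show ?thesis by (simp add: l'_def[abs_def])
    qed
    moreover have "l' x y = (if x = y then 1 else 0)" if "x \<in> insert z X" "y \<in> insert z X" for x y
      using that zX z(2) rX delta by (auto simp: l'_def)
    moreover have "p y = (\<Sum>x\<in>insert z X. p x * l' x y)"
      if p: "p \<in> coeff_space e (insert i I)" and y: "y \<in> S" for p y
    proof -
      obtain q c where q: "q \<in> coeff_space e I" "\<And>y. p y = q y + c * e i y"
        using split[OF p] by blast
      \<comment> \<open>Replacing \<open>e i\<close> by its interpolant splits \<open>p\<close> into
        \<open>q'\<close>, which lies in the old space and agrees with \<open>p\<close> at the old
        nodes, and the multiple \<open>c * r\<close> of the error.\<close>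
      define q' where "q' y = q y + c * (\<Sum>x\<in>X. e i x * l x y)" for y
      have q': "q' \<in> coeff_space e I"
        using coeff_space_lincomb[OF q(1) L[of "e i"], of 1 c] by (simp add: q'_def[abs_def])
      have p_eq: "p y = q' y + c * r y" for y
        by (simp add: q q'_def r_def algebra_simps)
      have "(\<Sum>x\<in>X. p x * l' x y) = (\<Sum>x\<in>X. q' x * (l x y - l x z * (r y / r z)))"
        using zX by (intro sum.cong) (auto simp: l'_def p_eq rX)
      also have "\<dots> = q' y - q' z * (r y / r z)"
      proof -
        have "(\<Sum>x\<in>X. q' x * (l x y - l x z * d)) = (\<Sum>x\<in>X. q' x * l x y) - (\<Sum>x\<in>X. q' x * l x z) * d" for d
          by (simp add: sum_distrib_left sum_subtractf algebra_simps)
        then show ?thesis by (simp only: rep[OF q' y, symmetric] rep[OF q' z(1), symmetric])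
      qed
      finally show ?thesis
        using X(1) zX z(2) by (simp add: l'_def p_eq field_simps)
    qed
    ultimately show ?thesis using X z by (intro exI[of _ "insert z X"] exI[of _ l']) auto
  qed
qed

section \<open>Polynomials of bounded degree\<close>

definition monomial :: "('n \<Rightarrow> nat) \<Rightarrow> real^'n \<Rightarrow> real" where
  "monomial \<alpha> x = (\<Prod>i\<in>UNIV. (x $ i) ^ \<alpha> i)"

lemma polynomial_degree_less_iff:
  "polynomial_degree_less k P \<longleftrightarrow> P \<in> coeff_space monomial {\<alpha>. (\<Sum>i\<in>UNIV. \<alpha> i) < k}"
  by (simp add: polynomial_degree_less_def coeff_space_def monomial_def[abs_def] image_def)

lemma continuous_on_polynomial_degree_less:
  assumes "polynomial_degree_less k P"
  shows "continuous_on S P"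
proof -
  obtain c where "P = (\<lambda>x. \<Sum>\<alpha> | (\<Sum>i\<in>UNIV. \<alpha> i) < k. c \<alpha> * (\<Prod>i\<in>UNIV. (x $ i) ^ \<alpha> i))"
    using assms unfolding polynomial_degree_less_def by blast
  then show ?thesis
    by (auto intro!: continuous_intros)
qed

text \<open>The values at the finitely many nodes act as coordinates: bounding or passing to the
  limit in them controls the polynomial on all of \<open>S\<close>, without any estimate of its
  coefficients.\<close>

lemma polynomial_interpolation:
  fixes S :: "(real^'n) set"
  shows "\<exists>X (l :: real^'n \<Rightarrow> real^'n \<Rightarrow> real). finite X \<and> X \<subseteq> S \<and> (\<forall>x\<in>X. polynomial_degree_less k (l x)) \<and>
           (\<forall>P. polynomial_degree_less k P \<longrightarrow> (\<forall>y\<in>S. P y = (\<Sum>x\<in>X. P x * l x y)))"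
proof -
  obtain X and l :: "real^'n \<Rightarrow> real^'n \<Rightarrow> real"
    where H: "finite X \<and> X \<subseteq> S \<and> (\<forall>x\<in>X. polynomial_degree_less k (l x)) \<and>
           (\<forall>x\<in>X. \<forall>y\<in>X. l x y = (if x = y then 1 else 0)) \<and>
           (\<forall>P. polynomial_degree_less k P \<longrightarrow> (\<forall>y\<in>S. P y = (\<Sum>x\<in>X. P x * l x y)))"
    using interpolation_nodes[OF finite_multi_indices[of k],
        where e = "monomial :: _ \<Rightarrow> real^'n \<Rightarrow> real" and S = S]
    unfolding polynomial_degree_less_iff Ball_def[of "coeff_space _ _"] by (elim exE)
  show ?thesis by (intro exI[of _ X] exI[of _ l]) (use H in blast)
qed

lemma polynomial_degree_less_lincomb:
  "polynomial_degree_less k P \<Longrightarrow> polynomial_degree_less k Q \<Longrightarrow>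
    polynomial_degree_less k (\<lambda>x. a * P x + b * Q x)"
  unfolding polynomial_degree_less_iff by (rule coeff_space_lincomb)

lemma polynomial_degree_less_sum:
  "(\<And>j. j \<in> J \<Longrightarrow> polynomial_degree_less k (p j)) \<Longrightarrow>
    polynomial_degree_less k (\<lambda>x. \<Sum>j\<in>J. d j * p j x)"
  unfolding polynomial_degree_less_iff by (rule coeff_space_sum)

lemma polynomial_degree_less_zero: "polynomial_degree_less k (\<lambda>x. 0)"
  unfolding polynomial_degree_less_iff by (rule coeff_space_zero)

lemma polynomial_degree_less_monomial:
  assumes "(\<Sum>i\<in>UNIV. \<alpha> i) < k"
  shows "polynomial_degree_less k (\<lambda>x. c * monomial \<alpha> x)"
proof -
  have "(\<Sum>\<beta> | (\<Sum>i\<in>UNIV. \<beta> i) < k. (if \<beta> = \<alpha> then c else 0) * monomial \<beta> x)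
      = c * monomial \<alpha> x" for x
  proof -
    have "(\<Sum>\<beta> | (\<Sum>i\<in>UNIV. \<beta> i) < k. (if \<beta> = \<alpha> then c else 0) * monomial \<beta> x)
        = (\<Sum>\<beta> | (\<Sum>i\<in>UNIV. \<beta> i) < k. if \<beta> = \<alpha> then c * monomial \<beta> x else 0)"
      by (rule sum.cong) auto
    also have "\<dots> = c * monomial \<alpha> x"
      using assms by (subst sum.delta[OF finite_multi_indices]) auto
    finally show ?thesis .
  qed
  then show ?thesis
    unfolding polynomial_degree_less_iff coeff_space_def
    by (intro image_eqI[where x = "\<lambda>\<beta>. if \<beta> = \<alpha> then c else 0"] ext) simp_all
qed

text \<open>Bolzano-Weierstrass once per index, each time along the subsequence extracted so
  far.\<close>

lemma bounded_family_convergent_subsequence: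
  fixes f :: "nat \<Rightarrow> 'i \<Rightarrow> real"
  assumes "finite I" "\<And>m i. i \<in> I \<Longrightarrow> \<bar>f m i\<bar> \<le> B"
  shows "\<exists>(r :: nat \<Rightarrow> nat) L. strict_mono r \<and> (\<forall>i\<in>I. (\<lambda>m. f (r m) i) \<longlonglongrightarrow> L i)"
  using assms
proof (induction I rule: finite_induct)
  case empty
  then show ?case by (intro exI[of _ id]) (auto simp: strict_mono_def)
next
  case (insert j I)
  then obtain r :: "nat \<Rightarrow> nat" and L where r: "strict_mono r" "\<And>i. i \<in> I \<Longrightarrow> (\<lambda>m. f (r m) i) \<longlonglongrightarrow> L i"
    using insert.IH insert.prems by (elim exE conjE meta_impE) (auto intro: that)
  have "f (r m) j \<in> {-B..B}" for m using insert.prems[of j "r m"] by (auto simp: abs_le_iff)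
  then obtain q :: "nat \<Rightarrow> nat" and l where q: "strict_mono q" "((\<lambda>m. f (r m) j) \<circ> q) \<longlonglongrightarrow> l"
    using compact_Icc[of "-B" B] unfolding compact_def by meson
  have "(\<lambda>m. f ((r \<circ> q) m) i) \<longlonglongrightarrow> (L(j := l)) i" if "i \<in> insert j I" for i
    using LIMSEQ_subseq_LIMSEQ[OF r(2) q(1)] q(2) that by (auto simp: o_def)
  then show ?case using strict_mono_o[OF r(1) q(1)] by blast
qed

section \<open>Pointwise fractional Laplacian\<close>

lemma powr_minus_lipschitz:
  fixes a \<rho> p q :: real
  assumes a: "0 \<le> a" and \<rho>: "0 < \<rho>" "\<rho> \<le> p" "\<rho> \<le> q"
  shows "\<bar>1 / p powr a - 1 / q powr a\<bar> \<le> a * \<rho> powr (- a - 1) * \<bar>p - q\<bar>"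
proof -
  have "norm (p powr (- a) - q powr (- a)) \<le> a * \<rho> powr (- a - 1) * norm (p - q)"
  proof (rule field_differentiable_bound[where S = "{\<rho>..}" and f' = "\<lambda>t. - a * t powr (- a - 1)"])
    show "((\<lambda>t. t powr - a) has_field_derivative - a * t powr (- a - 1)) (at t within {\<rho>..})"
      if "t \<in> {\<rho>..}" for t
      using that \<rho> by (auto intro!: derivative_eq_intros)
    show "norm (- a * t powr (- a - 1)) \<le> a * \<rho> powr (- a - 1)" if "t \<in> {\<rho>..}" for t
      using that \<rho> a by (auto simp: abs_mult intro!: mult_left_mono powr_mono2')
  qed (use \<rho> in auto)
  then show ?thesis by (simp add: powr_minus divide_inverse)
qed

text \<open>Away from the singularity, \<open>norm y \<le> (b / r + 1) * norm (x - y)\<close> by the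
  triangle inequality, so the kernel is dominated by the integration weight, uniformly for
  \<open>x\<close> in a bounded set.\<close>

lemma kernel_bound:
  fixes a b r :: real
  assumes a: "0 < a" and b: "0 \<le> b" and r: "0 < r"
  obtains C where "0 < C"
    "\<And>x y :: 'a::real_normed_vector. norm x \<le> b \<Longrightarrow> r \<le> norm (x - y) \<Longrightarrow>
        1 / norm (x - y) powr a \<le> C / (1 + norm y powr a)"
proof
  let ?C = "1 / r powr a + (b / r + 1) powr a"
  show C: "0 < ?C" using r b by (intro add_pos_nonneg) auto
  fix x y :: 'a assume x: "norm x \<le> b" and y: "r \<le> norm (x - y)"
  have n: "0 < norm (x - y) powr a" using r y by auto
  have "1 \<le> norm (x - y) powr a / r powr a"
    using r y a by (simp add: powr_mono2)
  moreover have "norm y powr a \<le> ((b / r + 1) * norm (x - y)) powr a"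
  proof (rule powr_mono2)
    have "norm y \<le> norm x + norm (x - y)"
      by (metis add.commute diff_add_cancel norm_minus_commute norm_triangle_ineq)
    also have "\<dots> \<le> b + norm (x - y)" using x by simp
    also have "b = b / r * r" using r by simp
    also have "b / r * r + norm (x - y) \<le> b / r * norm (x - y) + norm (x - y)"
      using y b r by (intro add_mono mult_left_mono) auto
    finally show "norm y \<le> (b / r + 1) * norm (x - y)" by (simp add: algebra_simps)
  qed (use a in auto)
  ultimately have "1 + norm y powr a \<le> norm (x - y) powr a / r powr a + ((b / r + 1) * norm (x - y)) powr a"
    by (rule add_mono)
  also have "((b / r + 1) * norm (x - y)) powr a = (b / r + 1) powr a * norm (x - y) powr a"
    by (rule powr_mult)
  finally have "1 + norm y powr a \<le> ?C * norm (x - y) powr a"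
    by (simp only: distrib_right times_divide_eq_left mult_1)
  moreover have "0 < 1 + norm y powr a" by (simp add: add_pos_nonneg)
  ultimately show "1 / norm (x - y) powr a \<le> ?C / (1 + norm y powr a)"
    using n by (simp add: field_simps)
qed

text \<open>Differentiating the power costs one factor of the inverse distance, which is at most
  \<open>2 / r\<close> here; what remains is the kernel at \<open>x0\<close> up to the factor
  \<open>2 powr a\<close>, hence again bounded by the weight.\<close>

lemma kernel_lipschitz:
  fixes a r :: real and x0 :: "'a::real_normed_vector"
  assumes a: "0 < a" and r: "0 < r"
  obtains C where "0 \<le> C"
    "\<And>x x' y. dist x x0 < r / 2 \<Longrightarrow> dist x' x0 < r / 2 \<Longrightarrow> r \<le> dist y x0 \<Longrightarrow>
        \<bar>1 / norm (x - y) powr a - 1 / norm (x' - y) powr a\<bar> \<le> C * norm (x - x') / (1 + norm y powr a)"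
proof -
  obtain C where C: "0 < C" "\<And>y. r \<le> norm (x0 - y) \<Longrightarrow> 1 / norm (x0 - y) powr a \<le> C / (1 + norm y powr a)"
    using kernel_bound[OF a norm_ge_zero r, of x0] by (metis (no_types) order_refl)
  let ?C = "a * (2 / r) * 2 powr a * C"
  show thesis
  proof (rule that[of ?C])
    show "0 \<le> ?C" using a r C by simp
    fix x x' y assume x: "dist x x0 < r / 2" "dist x' x0 < r / 2" and y: "r \<le> dist y x0"
    \<comment> \<open>Half the distance from \<open>x0\<close> to \<open>y\<close>: since
      \<open>x\<close> and \<open>x'\<close> stay within \<open>r / 2\<close> of \<open>x0\<close>
      and \<open>y\<close> does not come closer than \<open>r\<close>, both distances to
      \<open>y\<close> are at least \<open>\<rho>\<close>.\<close>
    define \<rho> where "\<rho> = norm (x0 - y) / 2"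
    have y': "r \<le> norm (x0 - y)" using y by (simp add: dist_norm norm_minus_commute)
    have \<rho>: "0 < \<rho>" "r / 2 \<le> \<rho>" using y' r by (auto simp: \<rho>_def)
    have "\<rho> \<le> norm (x - y)" "\<rho> \<le> norm (x' - y)"
      using x y dist_triangle[of y x0 x] dist_triangle[of y x0 x']
      by (auto simp: \<rho>_def dist_norm norm_minus_commute)
    then have "\<bar>1 / norm (x - y) powr a - 1 / norm (x' - y) powr a\<bar>
        \<le> a * \<rho> powr (- a - 1) * \<bar>norm (x - y) - norm (x' - y)\<bar>"
      using a \<rho> by (intro powr_minus_lipschitz) auto
    also have "\<dots> \<le> a * \<rho> powr (- a - 1) * norm (x - x')"
      using a norm_triangle_ineq3[of "x - y" "x' - y"] by (intro mult_left_mono) auto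
    also have "\<rho> powr (- a - 1) = 1 / \<rho> * (2 powr a * (1 / norm (x0 - y) powr a))"
      using \<rho>(1) by (simp add: powr_diff powr_minus \<rho>_def powr_divide divide_simps)
    also have "\<dots> \<le> 2 / r * (2 powr a * (C / (1 + norm y powr a)))"
    proof (intro mult_mono mult_nonneg_nonneg)
      show "1 / \<rho> \<le> 2 / r" using \<rho> r by (simp add: field_simps)
      show "1 / norm (x0 - y) powr a \<le> C / (1 + norm y powr a)" using C y' by blast
    qed (use r in auto)
    finally show "\<bar>1 / norm (x - y) powr a - 1 / norm (x' - y) powr a\<bar> \<le> ?C * norm (x - x') / (1 + norm y powr a)"
      using a by (simp add: mult_left_mono mult_right_mono mult_ac)
  qed
qed

section \<open>The weighted space and integrals against kernels\<close>

lemma weight_pos: "0 < 1 + norm (y::'a::real_normed_vector) powr a"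
  by (simp add: add_pos_nonneg)

lemma weight_measurable: "(\<lambda>y::real^'n. 1 + norm y powr a) \<in> borel_measurable lebesgue"
  by (rule borel_measurable_lebesgue_borel) measurable

lemma kernel_measurable:
  "(\<lambda>y::real^'n. 1 / norm (x - y) powr a) \<in> borel_measurable lebesgue"
  by (rule borel_measurable_lebesgue_borel) measurable

lemma weighted_L1_measurable:
  assumes "weighted_L1 a w"
  shows "w \<in> borel_measurable lebesgue"
proof -
  have "(\<lambda>y. (w y / (1 + norm y powr a)) * (1 + norm y powr a)) \<in> borel_measurable lebesgue"
    using assms unfolding weighted_L1_def
    by (intro borel_measurable_times weight_measurable) auto
  moreover have "(w y / (1 + norm y powr a)) * (1 + norm y powr a) = w y" for y
    using weight_pos[of y a] by simp
  ultimately show ?thesis by simp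
qed

lemma weighted_L1_lincomb:
  assumes "weighted_L1 a u" "weighted_L1 a v"
  shows "weighted_L1 a (\<lambda>y. c * u y + d * v y)"
proof -
  have "integrable lebesgue (\<lambda>y. c * (u y / (1 + norm y powr a)) + d * (v y / (1 + norm y powr a)))"
    using assms unfolding weighted_L1_def by (intro Bochner_Integration.integrable_add integrable_mult_right)
  then show ?thesis by (simp add: weighted_L1_def add_divide_distrib)
qed

lemma weighted_L1_bound:
  assumes v: "weighted_L1 a v" and u: "u \<in> borel_measurable lebesgue"
    and le: "\<And>y. \<bar>u y\<bar> \<le> C * \<bar>v y\<bar>"
  shows "weighted_L1 a u"
proof -
  have "integrable lebesgue (\<lambda>y. C * (v y / (1 + norm y powr a)))"
    using v unfolding weighted_L1_def by (rule integrable_mult_right)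
  then show ?thesis unfolding weighted_L1_def
  proof (rule Bochner_Integration.integrable_bound)
    show "(\<lambda>y. u y / (1 + norm y powr a)) \<in> borel_measurable lebesgue"
      using u weight_measurable by (rule borel_measurable_divide)
    have "\<bar>u y\<bar> / (1 + norm y powr a) \<le> (\<bar>C\<bar> * \<bar>v y\<bar>) / (1 + norm y powr a)" for y
      using weight_pos[of y a] order_trans[OF le[of y] mult_right_mono[OF abs_ge_self[of C] abs_ge_zero[of "v y"]]]
      by (intro divide_right_mono) auto
    then show "AE y in lebesgue. norm (u y / (1 + norm y powr a)) \<le> norm (C * (v y / (1 + norm y powr a)))"
      using weight_pos[of _ a] by (intro AE_I2) (simp add: abs_mult less_imp_le abs_of_pos)
  qed
qed

lemma weighted_L1_indicator:
  fixes u :: "real^'n \<Rightarrow> real"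
  assumes u: "weighted_L1 a u" and A: "A \<in> sets lebesgue"
  shows "weighted_L1 a (\<lambda>y. indicat_real A y * u y)"
  by (rule weighted_L1_bound[OF u, where C = 1])
     (intro borel_measurable_times borel_measurable_indicator A weighted_L1_measurable[OF u], auto simp: indicator_def)

lemma weighted_L1_abs_integrable:
  assumes "weighted_L1 b u"
  shows "integrable lebesgue (\<lambda>y. \<bar>u y\<bar> / (1 + norm y powr b))"
proof -
  have "integrable lebesgue (\<lambda>y. \<bar>u y / (1 + norm y powr b)\<bar>)"
    using assms unfolding weighted_L1_def by (rule integrable_abs)
  then show ?thesis using weight_pos[of _ b] by (simp add: abs_of_pos)
qed

text \<open>The common source of all estimates for the dependence of a kernel integral on
  \<open>x\<close>. The kernels are compared only where \<open>u\<close> is nonzero, so for a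
  function vanishing near the singularity far-field bounds are enough.\<close>

lemma integral_diff_le_weighted:
  fixes u K K' :: "real^'n \<Rightarrow> real"
  assumes u: "weighted_L1 b u"
    and int: "integrable lebesgue (\<lambda>y. K y * u y)" "integrable lebesgue (\<lambda>y. K' y * u y)"
    and le: "\<And>y. u y \<noteq> 0 \<Longrightarrow> \<bar>K y - K' y\<bar> \<le> D / (1 + norm y powr b)"
  shows "\<bar>(LINT y|lebesgue. K y * u y) - (LINT y|lebesgue. K' y * u y)\<bar>
    \<le> D * (LINT y|lebesgue. \<bar>u y\<bar> / (1 + norm y powr b))"
proof -
  have "\<bar>(LINT y|lebesgue. K y * u y) - (LINT y|lebesgue. K' y * u y)\<bar>
      = \<bar>(LINT y|lebesgue. K y * u y - K' y * u y)\<bar>"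
    by (simp only: Bochner_Integration.integral_diff[OF int])
  also have "\<dots> \<le> (LINT y|lebesgue. \<bar>K y * u y - K' y * u y\<bar>)"
    by (rule integral_abs_bound)
  also have "\<dots> \<le> (LINT y|lebesgue. D * (\<bar>u y\<bar> / (1 + norm y powr b)))"
  proof (rule integral_mono)
    show "\<bar>K y * u y - K' y * u y\<bar> \<le> D * (\<bar>u y\<bar> / (1 + norm y powr b))" for y
    proof (cases "u y = 0")
      case False
      then show ?thesis
        using mult_right_mono[OF le abs_ge_zero[of "u y"], of y]
        by (simp add: left_diff_distrib[symmetric] abs_mult)
    qed simp
  qed (intro integrable_abs Bochner_Integration.integrable_diff int integrable_mult_right
      weighted_L1_abs_integrable u)+
  also have "\<dots> = D * (LINT y|lebesgue. \<bar>u y\<bar> / (1 + norm y powr b))"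
    by (rule integral_mult_right_zero)
  finally show ?thesis .
qed

lemma integrable_kernel_outside:
  fixes w :: "real^'n \<Rightarrow> real"
  assumes a: "0 < a" and w: "weighted_L1 a w" and \<epsilon>: "0 < \<epsilon>"
  shows "integrable lebesgue (\<lambda>y. indicat_real (- ball x \<epsilon>) y * (w y / norm (x - y) powr a))"
proof -
  obtain C where C: "0 < C" "\<And>y. \<epsilon> \<le> norm (x - y) \<Longrightarrow> 1 / norm (x - y) powr a \<le> C / (1 + norm y powr a)"
    using kernel_bound[OF a norm_ge_zero \<epsilon>, of x] by (metis order_refl)
  have "integrable lebesgue (\<lambda>y. C * (w y / (1 + norm y powr a)))"
    using w unfolding weighted_L1_def by (rule integrable_mult_right)
  then show ?thesis
  proof (rule Bochner_Integration.integrable_bound)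
    have "(\<lambda>y. indicat_real (- ball x \<epsilon>) y * (w y * (1 / norm (x - y) powr a))) \<in> borel_measurable lebesgue"
      by (intro borel_measurable_times borel_measurable_indicator weighted_L1_measurable[OF w] kernel_measurable) auto
    then show "(\<lambda>y. indicat_real (- ball x \<epsilon>) y * (w y / norm (x - y) powr a)) \<in> borel_measurable lebesgue"
      by simp
    have "indicat_real (- ball x \<epsilon>) y * (\<bar>w y\<bar> * (1 / norm (x - y) powr a)) \<le> \<bar>w y\<bar> * (C / (1 + norm y powr a))" for y
      using C weight_pos[of y a]
      by (cases "\<epsilon> \<le> norm (x - y)") (auto simp: dist_norm intro!: mult_left_mono simp del: times_divide_eq_right)
    then show "AE y in lebesgue. norm (indicat_real (- ball x \<epsilon>) y * (w y / norm (x - y) powr a))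
        \<le> norm (C * (w y / (1 + norm y powr a)))"
      using C(1) weight_pos[of _ a] by (intro AE_I2) (simp add: abs_mult less_imp_le abs_of_pos mult_ac)
  qed
qed

lemma integrable_kernel_const_outside:
  assumes a: "real CARD('n) < a" and \<epsilon>: "0 < \<epsilon>"
  shows "integrable lebesgue (\<lambda>y::real^'n. indicat_real (- ball x \<epsilon>) y * (c / norm (x - y) powr a))"
proof -
  have "integrable lebesgue (\<lambda>y::real^'n. indicat_real (- ball 0 \<epsilon>) (x + (-1) *\<^sub>R y) / norm (x + (-1) *\<^sub>R y) powr a)"
    by (rule integrable_lebesgue_isometry[OF _ integrable_norm_powr_far[OF a \<epsilon>]]) simp
  then have "integrable lebesgue (\<lambda>y::real^'n. indicat_real (- ball 0 \<epsilon>) (x - y) / norm (x - y) powr a)"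
    by simp
  then have "integrable lebesgue (\<lambda>y::real^'n. c * (indicat_real (- ball 0 \<epsilon>) (x - y) / norm (x - y) powr a))"
    by (rule integrable_mult_right)
  moreover have "indicat_real (- ball 0 \<epsilon>) (x - y) = indicat_real (- ball x \<epsilon>) y" for y
    by (auto simp: indicator_def dist_norm norm_minus_commute)
  ultimately show ?thesis by (simp add: mult_ac)
qed

text \<open>Constants and \<open>w\<close> are both integrable against the kernel off a ball. So the
  integrability clause of \<open>has_frac_laplacian\<close> holds for every
  \<open>weighted_L1\<close> function, and only the limit in \<open>\<epsilon>\<close> depends on
  regularity at \<open>x\<close>.\<close>

lemma frac_laplacian_set_integrable:
  fixes w :: "real^'n \<Rightarrow> real"
  assumes a: "real CARD('n) < a" and w: "weighted_L1 a w" and \<epsilon>: "0 < \<epsilon>"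
  shows "set_integrable lebesgue (- ball x \<epsilon>) (\<lambda>y. (w x - w y) / norm (x - y) powr a)"
proof -
  have "0 < a" using a by (smt (verit) of_nat_0_le_iff)
  then have "integrable lebesgue (\<lambda>y. indicat_real (- ball x \<epsilon>) y * (w x / norm (x - y) powr a) -
     indicat_real (- ball x \<epsilon>) y * (w y / norm (x - y) powr a))"
    by (intro Bochner_Integration.integrable_diff integrable_kernel_const_outside[OF a \<epsilon>] integrable_kernel_outside w \<epsilon>)
  then show ?thesis by (simp add: set_integrable_def diff_divide_distrib right_diff_distrib)
qed

section \<open>Linearity and locality of the pointwise operator\<close>

lemma has_frac_laplacian_unique:
  assumes "has_frac_laplacian s u x L" "has_frac_laplacian s u x M"
  shows "L = M"
  using assms unfolding has_frac_laplacian_def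
  by (meson tendsto_unique trivial_limit_at_right_real)

lemma has_frac_laplacian_lincomb:
  fixes u v :: "real^'n \<Rightarrow> real"
  assumes "has_frac_laplacian s u x L" "has_frac_laplacian s v x M"
  shows "has_frac_laplacian s (\<lambda>y. c * u y + d * v y) x (c * L + d * M)"
proof -
  let ?K = "\<lambda>y. norm (x - y) powr (real CARD('n) + 2 * s)"
  have eq: "(\<lambda>y. ((c * u x + d * v x) - (c * u y + d * v y)) / ?K y)
      = (\<lambda>y. c * ((u x - u y) / ?K y) + d * ((v x - v y) / ?K y))"
    by (auto simp: fun_eq_iff add_divide_distrib[symmetric] algebra_simps)
  have U: "set_integrable lebesgue (- ball x \<epsilon>) (\<lambda>y. (u x - u y) / ?K y)"
    and V: "set_integrable lebesgue (- ball x \<epsilon>) (\<lambda>y. (v x - v y) / ?K y)" if "0 < \<epsilon>" for \<epsilon>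
    using assms that unfolding has_frac_laplacian_def by blast+
  have int: "set_integrable lebesgue (- ball x \<epsilon>) (\<lambda>y. c * ((u x - u y) / ?K y))"
     "set_integrable lebesgue (- ball x \<epsilon>) (\<lambda>y. d * ((v x - v y) / ?K y))" if "0 < \<epsilon>" for \<epsilon>
    by (rule set_integrable_mult_right, rule U[OF that]) (rule set_integrable_mult_right, rule V[OF that])
  have "((\<lambda>\<epsilon>. c * set_lebesgue_integral lebesgue (- ball x \<epsilon>) (\<lambda>y. (u x - u y) / ?K y)
        + d * set_lebesgue_integral lebesgue (- ball x \<epsilon>) (\<lambda>y. (v x - v y) / ?K y)) \<longlongrightarrow> c * L + d * M) (at_right 0)"
    using assms unfolding has_frac_laplacian_def by (intro tendsto_intros) auto
  then have "((\<lambda>\<epsilon>. set_lebesgue_integral lebesgue (- ball x \<epsilon>)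
      (\<lambda>y. c * ((u x - u y) / ?K y) + d * ((v x - v y) / ?K y))) \<longlongrightarrow> c * L + d * M) (at_right 0)"
  proof (rule Lim_transform_eventually)
    show "\<forall>\<^sub>F \<epsilon> in at_right 0. c * set_lebesgue_integral lebesgue (- ball x \<epsilon>) (\<lambda>y. (u x - u y) / ?K y)
        + d * set_lebesgue_integral lebesgue (- ball x \<epsilon>) (\<lambda>y. (v x - v y) / ?K y)
      = set_lebesgue_integral lebesgue (- ball x \<epsilon>) (\<lambda>y. c * ((u x - u y) / ?K y) + d * ((v x - v y) / ?K y))"
      using eventually_at_right_less[of "0::real"]
      by (rule eventually_mono) (simp only: set_integral_add(2)[OF int] set_integral_mult_right)
  qed
  then show ?thesis
    unfolding has_frac_laplacian_def eq using set_integral_add(1)[OF int] by blast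
qed

text \<open>If \<open>q\<close> vanishes near \<open>x\<close>, the integrals over the complements
  of small balls no longer depend on the radius, so the limit is the full integral with the sign
  coming from \<open>q x - q y\<close>.\<close>

lemma has_frac_laplacian_far:
  fixes q :: "real^'n \<Rightarrow> real"
  assumes a: "a = real CARD('n) + 2 * s" and s: "0 < s" and \<rho>: "0 < \<rho>"
    and q: "weighted_L1 a q" and zero: "\<And>y. y \<in> ball x \<rho> \<Longrightarrow> q y = 0"
  shows "integrable lebesgue (\<lambda>y. q y / norm (x - y) powr a)" (is ?I)
    and "has_frac_laplacian s q x (- (LINT y|lebesgue. q y / norm (x - y) powr a))" (is ?H)
proof -
  have n: "real CARD('n) < a" and a0: "0 < a" using s a by (auto intro: add_nonneg_pos)
  have eq: "indicat_real (- ball x \<epsilon>) y * (q y / norm (x - y) powr a) = q y / norm (x - y) powr a"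
    if "\<epsilon> \<le> \<rho>" for \<epsilon> y
    using zero[of y] that by (auto simp: indicator_def)
  show ?I using integrable_kernel_outside[OF a0 q \<rho>, of x] by (simp only: eq[OF order_refl])
  have x: "q x = 0" using zero \<rho> by simp
  have "\<forall>\<^sub>F \<epsilon> in at_right 0. \<epsilon> < \<rho>"
    using \<rho> by (simp add: eventually_at_right_field) blast
  then have "\<forall>\<^sub>F \<epsilon> in at_right 0. - (LINT y|lebesgue. q y / norm (x - y) powr a) =
      set_lebesgue_integral lebesgue (- ball x \<epsilon>) (\<lambda>y. (q x - q y) / norm (x - y) powr a)"
    by (rule eventually_mono) (simp add: set_lebesgue_integral_def x eq del: times_divide_eq_right)
  then have "((\<lambda>\<epsilon>. set_lebesgue_integral lebesgue (- ball x \<epsilon>) (\<lambda>y. (q x - q y) / norm (x - y) powr a))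
    \<longlongrightarrow> - (LINT y|lebesgue. q y / norm (x - y) powr a)) (at_right 0)"
    by (rule Lim_transform_eventually[OF tendsto_const])
  then show ?H
    unfolding has_frac_laplacian_def a[symmetric] using frac_laplacian_set_integrable[OF n q] by blast
qed

text \<open>The sign is that of the fractional Laplacian, opposite to the usual centred difference.
  Symmetrisation cancels the gradient term, so that for C^2 functions the principal value becomes an
  absolutely convergent integral.\<close>

definition second_diff :: "('a::real_vector \<Rightarrow> real) \<Rightarrow> 'a \<Rightarrow> 'a \<Rightarrow> real" where
  "second_diff u x z = 2 * u x - u (x + z) - u (x - z)"

lemma second_diff_measurable:
  fixes u :: "real^'n \<Rightarrow> real"
  assumes u: "u \<in> borel_measurable lebesgue"
  shows "second_diff u x \<in> borel_measurable lebesgue"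
  using borel_measurable_lebesgue_isometry[OF _ u, of 1 x] borel_measurable_lebesgue_isometry[OF _ u, of "-1" x]
  by (auto simp: second_diff_def[abs_def] intro!: borel_measurable_diff)

text \<open>Near the origin \<open>M\<close> is the quadratic bound on second differences, far away
  it is the sup bound on the function, whose second differences are then at most
  \<open>4 * M\<close>. One shared constant lets the majorant serve a whole sequence.\<close>

definition second_diff_majorant :: "real \<Rightarrow> real \<Rightarrow> real \<Rightarrow> real^'n \<Rightarrow> real" where
  "second_diff_majorant a \<rho> M z = M * (indicat_real (ball 0 \<rho>) z * norm z ^ 2 / norm z powr a)
     + 4 * M * (indicat_real (- ball 0 \<rho>) z / norm z powr a)"

lemma integrable_second_diff_majorant:
  assumes "real CARD('n) < a" "a < real CARD('n) + 2" "0 < \<rho>"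
  shows "integrable lebesgue (second_diff_majorant a \<rho> M :: real^'n \<Rightarrow> real)"
proof -
  have "0 \<le> a" using assms(1) by (smt (verit) of_nat_0_le_iff)
  then show ?thesis
    unfolding second_diff_majorant_def[abs_def]
    by (intro Bochner_Integration.integrable_add integrable_mult_right
        integrable_norm_powr_far integrable_norm_powr_near assms)
qed

lemma second_diff_majorant:
  fixes u :: "real^'n \<Rightarrow> real"
  assumes bdd: "\<And>y. \<bar>u y\<bar> \<le> M" and sd: "\<And>z. norm z < \<rho> \<Longrightarrow> \<bar>second_diff u x z\<bar> \<le> M * norm z ^ 2"
  shows "\<bar>second_diff u x z\<bar> / norm z powr a \<le> second_diff_majorant a \<rho> M z"
proof (cases "norm z < \<rho>")
  case True
  then show ?thesis using sd[of z] by (simp add: second_diff_majorant_def divide_right_mono)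
next
  case False
  have "\<bar>second_diff u x z\<bar> \<le> 4 * M"
    using bdd[of x] bdd[of "x + z"] bdd[of "x - z"] by (simp add: second_diff_def abs_le_iff)
  then show ?thesis using False by (simp add: second_diff_majorant_def divide_right_mono)
qed

text \<open>The complement of the ball is symmetric about \<open>x\<close>, so substituting
  \<open>x + z\<close> and \<open>x - z\<close> gives the same integral twice; averaging produces
  the second difference and the factor one half, and the cut-off is removed by dominated
  convergence.\<close>

lemma has_frac_laplacian_second_diff:
  fixes u :: "real^'n \<Rightarrow> real"
  assumes a: "a = real CARD('n) + 2 * s" and s: "0 < s" "s < 1" and \<rho>: "0 < \<rho>"
    and u: "weighted_L1 a u" and bdd: "\<And>y. \<bar>u y\<bar> \<le> M"
    and sd: "\<And>z. norm z < \<rho> \<Longrightarrow> \<bar>second_diff u x z\<bar> \<le> M * norm z ^ 2"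
  shows "has_frac_laplacian s u x (1 / 2 * (LINT z|lebesgue. second_diff u x z / norm z powr a))"
proof -
  have n: "real CARD('n) < a" "a < real CARD('n) + 2" using s a by auto
  note um = weighted_L1_measurable[OF u]
  let ?D = "\<lambda>z. second_diff u x z / norm z powr a"
  have Dm: "?D \<in> borel_measurable lebesgue"
    using borel_measurable_times[OF second_diff_measurable[OF um, of x] kernel_measurable[of 0 a]] by simp
  have eq: "set_lebesgue_integral lebesgue (- ball x \<epsilon>) (\<lambda>y. (u x - u y) / norm (x - y) powr a)
      = 1 / 2 * (LINT z|lebesgue. indicat_real (- ball 0 \<epsilon>) z * ?D z)" if \<epsilon>: "0 < \<epsilon>" for \<epsilon>
  proof -
    define I where "I y = indicat_real (- ball x \<epsilon>) y * ((u x - u y) / norm (x - y) powr a)" for y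
    have I: "integrable lebesgue I"
      using frac_laplacian_set_integrable[OF n(1) u \<epsilon>, of x] by (simp add: set_integrable_def I_def[abs_def])
    have I1: "integrable lebesgue (\<lambda>z. I (x + z))" "(LINT z|lebesgue. I (x + z)) = integral\<^sup>L lebesgue I"
      using integrable_lebesgue_isometry[of 1 I x] integral_lebesgue_isometry[of 1 I x] I by auto
    have I2: "integrable lebesgue (\<lambda>z. I (x - z))" "(LINT z|lebesgue. I (x - z)) = integral\<^sup>L lebesgue I"
      using integrable_lebesgue_isometry[of "-1" I x] integral_lebesgue_isometry[of "-1" I x] I by auto
    have "I (x + z) + I (x - z) = indicat_real (- ball 0 \<epsilon>) z * ?D z" for z
      by (auto simp: I_def indicator_def dist_norm second_diff_def diff_divide_distrib add_divide_distrib)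
    then have "(LINT z|lebesgue. indicat_real (- ball 0 \<epsilon>) z * ?D z)
        = (LINT z|lebesgue. I (x + z) + I (x - z))" by simp
    also have "\<dots> = 2 * integral\<^sup>L lebesgue I"
      using I1 I2 by (subst Bochner_Integration.integral_add) auto
    finally show ?thesis by (simp add: set_lebesgue_integral_def I_def[abs_def])
  qed
  have "((\<lambda>\<epsilon>. (LINT z|lebesgue. indicat_real (- ball 0 \<epsilon>) z * ?D z))
     \<longlongrightarrow> integral\<^sup>L lebesgue ?D) (at_right 0)"
  proof (rule tendsto_at_right_sequentially[of 0 1])
    fix S :: "nat \<Rightarrow> real" assume S: "\<And>n. 0 < S n" "S \<longlonglongrightarrow> 0"
    show "(\<lambda>n. (LINT z|lebesgue. indicat_real (- ball 0 (S n)) z * ?D z)) \<longlonglongrightarrow> integral\<^sup>L lebesgue ?D"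
    proof (rule integral_dominated_convergence)
      show "integrable lebesgue (second_diff_majorant a \<rho> M :: real^'n \<Rightarrow> real)"
        using n \<rho> by (rule integrable_second_diff_majorant)
      show "AE z in lebesgue. (\<lambda>n. indicat_real (- ball 0 (S n)) z * ?D z) \<longlonglongrightarrow> ?D z"
      proof (rule AE_I2)
        fix z :: "real^'n"
        show "(\<lambda>n. indicat_real (- ball 0 (S n)) z * ?D z) \<longlonglongrightarrow> ?D z"
        proof (cases "z = 0")
          case False
          then have "\<forall>\<^sub>F n in sequentially. S n < norm z"
            using S(2) by (intro order_tendstoD) auto
          then have "\<forall>\<^sub>F n in sequentially. ?D z = indicat_real (- ball 0 (S n)) z * ?D z"
            by (rule eventually_mono) simp
          then show ?thesis by (rule Lim_transform_eventually[OF tendsto_const])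
        qed simp
      qed
      fix n
      show "(\<lambda>z. indicat_real (- ball 0 (S n)) z * ?D z) \<in> borel_measurable lebesgue"
        by (intro borel_measurable_times borel_measurable_indicator Dm) auto
      have "norm (indicat_real (- ball 0 (S n)) z * ?D z) \<le> second_diff_majorant a \<rho> M z" for z
      proof -
        have "norm (indicat_real (- ball 0 (S n)) z * ?D z) \<le> \<bar>second_diff u x z\<bar> / norm z powr a"
          by (auto simp: indicator_def)
        also have "\<dots> \<le> second_diff_majorant a \<rho> M z" by (rule second_diff_majorant[OF bdd sd])
        finally show ?thesis .
      qed
      then show "AE z in lebesgue. norm (indicat_real (- ball 0 (S n)) z * ?D z) \<le> second_diff_majorant a \<rho> M z"
        by simp
    qed (rule Dm)
  qed simp
  then have "((\<lambda>\<epsilon>. 1 / 2 * (LINT z|lebesgue. indicat_real (- ball 0 \<epsilon>) z * ?D z))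
     \<longlongrightarrow> 1 / 2 * integral\<^sup>L lebesgue ?D) (at_right 0)"
    by (intro tendsto_intros)
  then have "((\<lambda>\<epsilon>. set_lebesgue_integral lebesgue (- ball x \<epsilon>) (\<lambda>y. (u x - u y) / norm (x - y) powr a))
     \<longlongrightarrow> 1 / 2 * integral\<^sup>L lebesgue ?D) (at_right 0)"
    by (rule Lim_transform_eventually)
       (use eventually_at_right_less[of "0::real"] in \<open>rule eventually_mono, simp add: eq\<close>)
  then show ?thesis
    unfolding has_frac_laplacian_def a[symmetric] using frac_laplacian_set_integrable[OF n(1) u] by blast
qed

section \<open>Viscosity solutions\<close>

lemma C2_on_subset: "C2_on N \<phi> \<Longrightarrow> M \<subseteq> N \<Longrightarrow> C2_on M \<phi>"
  unfolding C2_on_def by (meson continuous_on_subset subsetD)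

lemma C2_on_scale:
  fixes \<phi> :: "real^'n \<Rightarrow> real"
  assumes "C2_on N \<phi>"
  shows "C2_on N (\<lambda>x. c * \<phi> x)"
proof -
  obtain G :: "real^'n \<Rightarrow> real^'n" and H :: "real^'n \<Rightarrow> real^'n^'n"
    where G: "\<And>x. x \<in> N \<Longrightarrow> (\<phi> has_derivative (\<lambda>h. G x \<bullet> h)) (at x)"
    and H: "\<And>x. x \<in> N \<Longrightarrow> (G has_derivative (\<lambda>h. H x *v h)) (at x)" "continuous_on N H"
    using assms unfolding C2_on_def by blast
  show ?thesis unfolding C2_on_def
  proof (intro exI[of _ "\<lambda>x. c *\<^sub>R G x"] exI[of _ "\<lambda>x. c *\<^sub>R H x"] conjI ballI)
    fix x assume x: "x \<in> N"
    show "((\<lambda>x. c * \<phi> x) has_derivative (\<lambda>h. (c *\<^sub>R G x) \<bullet> h)) (at x)"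
      using has_derivative_mult_right[OF G[OF x], of c] by simp
    show "((\<lambda>x. c *\<^sub>R G x) has_derivative (\<lambda>h. (c *\<^sub>R H x) *v h)) (at x)"
      using has_derivative_scaleR_right[OF H(1)[OF x], of c] by (simp add: scaleR_matrix_vector_assoc)
  qed (intro continuous_intros H(2))
qed

lemma C2_on_add_quadratic:
  fixes \<phi> :: "real^'n \<Rightarrow> real"
  assumes "C2_on N \<phi>"
  shows "C2_on N (\<lambda>x. \<phi> x + \<eta> * ((x - x0) \<bullet> (x - x0)) + c)"
proof -
  obtain G :: "real^'n \<Rightarrow> real^'n" and H :: "real^'n \<Rightarrow> real^'n^'n"
    where G: "\<And>x. x \<in> N \<Longrightarrow> (\<phi> has_derivative (\<lambda>h. G x \<bullet> h)) (at x)"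
    and H: "\<And>x. x \<in> N \<Longrightarrow> (G has_derivative (\<lambda>h. H x *v h)) (at x)" "continuous_on N H"
    using assms unfolding C2_on_def by blast
  show ?thesis unfolding C2_on_def
  proof (intro exI[of _ "\<lambda>x. G x + (2 * \<eta>) *\<^sub>R (x - x0)"] exI[of _ "\<lambda>x. H x + (2 * \<eta>) *\<^sub>R mat 1"] conjI ballI)
    fix x assume x: "x \<in> N"
    have "((\<lambda>x. \<phi> x + \<eta> * ((x - x0) \<bullet> (x - x0)) + c) has_derivative
        (\<lambda>h. G x \<bullet> h + \<eta> * ((x - x0) \<bullet> (h - 0) + (h - 0) \<bullet> (x - x0)) + 0)) (at x)"
      by (intro derivative_intros G x)
    then show "((\<lambda>x. \<phi> x + \<eta> * ((x - x0) \<bullet> (x - x0)) + c) has_derivative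
        (\<lambda>h. (G x + (2 * \<eta>) *\<^sub>R (x - x0)) \<bullet> h)) (at x)"
      by (simp add: inner_add_left inner_commute algebra_simps)
    have "((\<lambda>x. G x + (2 * \<eta>) *\<^sub>R (x - x0)) has_derivative
        (\<lambda>h. H x *v h + (2 * \<eta>) *\<^sub>R (h - 0))) (at x)"
      by (intro derivative_intros H(1) x)
    moreover have "(H x + (2 * \<eta>) *\<^sub>R mat 1) *v h = H x *v h + (2 * \<eta>) *\<^sub>R (h - 0)" for h
      by (simp add: matrix_vector_mult_add_rdistrib scaleR_matrix_vector_assoc[symmetric])
    ultimately show "((\<lambda>x. G x + (2 * \<eta>) *\<^sub>R (x - x0)) has_derivative
        (\<lambda>h. (H x + (2 * \<eta>) *\<^sub>R mat 1) *v h)) (at x)" by simp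
  qed (intro continuous_intros H(2))
qed

lemma C2_on_continuous:
  assumes "C2_on N \<phi>"
  shows "continuous_on N \<phi>"
  using assms unfolding C2_on_def
  by (blast intro: continuous_at_imp_continuous_on has_derivative_continuous)

text \<open>A bound \<open>B\<close> on the Hessian over the closed ball makes the gradient
  \<open>B\<close>-Lipschitz there. Keeping both \<open>x - x0\<close> and \<open>z\<close> below
  half the radius keeps the whole segment between \<open>x - z\<close> and \<open>x + z\<close> in
  that ball, so the bound is uniform in \<open>x\<close>.\<close>

lemma C2_on_second_diff_bound:
  fixes \<phi> :: "real^'n \<Rightarrow> real"
  assumes \<phi>: "C2_on N \<phi>" and N: "cball x0 r \<subseteq> N" and r: "0 < r"
  obtains M where "0 \<le> M"
    "\<And>x z. dist x x0 < r / 2 \<Longrightarrow> norm z < r / 2 \<Longrightarrow> \<bar>second_diff \<phi> x z\<bar> \<le> M * norm z ^ 2"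
proof -
  obtain G :: "real^'n \<Rightarrow> real^'n" and H :: "real^'n \<Rightarrow> real^'n^'n"
    where G: "\<And>x. x \<in> N \<Longrightarrow> (\<phi> has_derivative (\<lambda>h. G x \<bullet> h)) (at x)"
    and H: "\<And>x. x \<in> N \<Longrightarrow> (G has_derivative (\<lambda>h. H x *v h)) (at x)" "continuous_on N H"
    using \<phi> unfolding C2_on_def by blast
  have "compact ((\<lambda>x. \<Sum>i\<in>UNIV. \<Sum>j\<in>UNIV. \<bar>H x $ i $ j\<bar>) ` cball x0 r)"
    by (intro compact_continuous_image continuous_intros continuous_on_subset[OF H(2) N] compact_cball)
  from compact_imp_bounded[OF this]
  obtain B where "\<forall>v\<in>(\<lambda>x. \<Sum>i\<in>UNIV. \<Sum>j\<in>UNIV. \<bar>H x $ i $ j\<bar>) ` cball x0 r. norm v \<le> B"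
    unfolding bounded_iff by blast
  then have B: "norm (\<Sum>i\<in>UNIV. \<Sum>j\<in>UNIV. \<bar>H x $ i $ j\<bar>) \<le> B" if "x \<in> cball x0 r" for x
    using that by blast
  have lip: "norm (G x - G y) \<le> B * norm (x - y)" if "x \<in> cball x0 r" "y \<in> cball x0 r" for x y
  proof (rule differentiable_bound[of "cball x0 r" G "\<lambda>x h. H x *v h"])
    show "(G has_derivative (\<lambda>h. H x *v h)) (at x within cball x0 r)" if "x \<in> cball x0 r" for x
      using H(1) N that by (meson has_derivative_at_withinI subsetD)
    show "onorm (\<lambda>h. H x *v h) \<le> B" if "x \<in> cball x0 r" for x
      using order_trans[OF onorm_le_matrix_component_sum[of "H x"]] B[OF that] by simp
  qed (use that in auto)
  have B0: "0 \<le> B" using order_trans[OF norm_ge_zero B[of x0]] r by simp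
  show thesis
  proof (rule that[of "2 * B"])
    fix x z :: "real^'n" assume x: "dist x x0 < r / 2" and z: "norm z < r / 2"
    have mem: "x + t *\<^sub>R z \<in> cball x0 r" if "\<bar>t\<bar> \<le> 1" for t
    proof -
      have "norm (t *\<^sub>R z) \<le> norm z" using that by (simp add: mult_left_le_one_le)
      then have "norm (x + t *\<^sub>R z - x0) \<le> dist x x0 + norm z"
        using norm_triangle_ineq[of "x - x0" "t *\<^sub>R z"] by (simp add: dist_norm algebra_simps)
      then show ?thesis using x z by (simp add: dist_norm norm_minus_commute)
    qed
    \<comment> \<open>By symmetry the derivative of \<open>g\<close> is a difference of gradients at
      points \<open>2 * t * norm z\<close> apart; the Lipschitz bound supplies the second factor
      \<open>norm z\<close>.\<close>
    define g where "g t = \<phi> (x + t *\<^sub>R z) + \<phi> (x + (- t) *\<^sub>R z)" for t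
    have dg: "DERIV g t :> (G (x + t *\<^sub>R z) - G (x + (- t) *\<^sub>R z)) \<bullet> z" if t: "0 \<le> t" "t \<le> 1" for t
    proof -
      have 1: "((\<lambda>t. \<phi> (x + t *\<^sub>R z)) has_derivative (\<lambda>h. G (x + t *\<^sub>R z) \<bullet> (0 + h *\<^sub>R z))) (at t)"
        using mem[of t] N t by (intro has_derivative_compose[OF _ G] derivative_intros) auto
      have 2: "((\<lambda>t. \<phi> (x + (- t) *\<^sub>R z)) has_derivative (\<lambda>h. G (x + (- t) *\<^sub>R z) \<bullet> (0 + (- h) *\<^sub>R z))) (at t)"
        using mem[of "- t"] N t by (intro has_derivative_compose[OF _ G] derivative_intros) auto
      from has_derivative_add[OF 1 2] show ?thesis
        unfolding g_def[abs_def] has_field_derivative_def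
        by (rule has_derivative_eq_rhs) (auto simp: fun_eq_iff inner_diff_left algebra_simps)
    qed
    obtain t where t: "0 < t" "t < 1" "g 1 - g 0 = (1 - 0) * ((G (x + t *\<^sub>R z) - G (x + (- t) *\<^sub>R z)) \<bullet> z)"
      using MVT2[of 0 1 g "\<lambda>t. (G (x + t *\<^sub>R z) - G (x + (- t) *\<^sub>R z)) \<bullet> z"] dg by auto
    have "\<bar>second_diff \<phi> x z\<bar> = \<bar>g 1 - g 0\<bar>" by (simp add: second_diff_def g_def)
    also have "\<dots> \<le> norm (G (x + t *\<^sub>R z) - G (x + (- t) *\<^sub>R z)) * norm z"
      using Cauchy_Schwarz_ineq2 by (simp add: t(3))
    also have "\<dots> \<le> (B * norm ((x + t *\<^sub>R z) - (x + (- t) *\<^sub>R z))) * norm z"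
      using mem[of t] mem[of "- t"] t by (intro mult_right_mono lip) auto
    also have "(x + t *\<^sub>R z) - (x + (- t) *\<^sub>R z) = (2 * t) *\<^sub>R z"
      by (simp add: algebra_simps scaleR_2[symmetric])
    also have "(B * norm ((2 * t) *\<^sub>R z)) * norm z = (2 * B * norm z ^ 2) * t"
      using t by (simp add: power2_eq_square)
    also have "\<dots> \<le> (2 * B * norm z ^ 2) * 1"
      using t B0 by (intro mult_left_mono) auto
    finally show "\<bar>second_diff \<phi> x z\<bar> \<le> 2 * B * norm z ^ 2" by simp
  qed (use B0 in simp)
qed

text \<open>The half of the viscosity condition that concerns test functions touching from above;
  the other half is the same condition for \<open>- w\<close> and \<open>- g\<close>.\<close>

definition frac_subsolution ::
  "real \<Rightarrow> (real^'n) set \<Rightarrow> (real^'n \<Rightarrow> real) \<Rightarrow> (real^'n \<Rightarrow> real) \<Rightarrow> bool" where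
  "frac_subsolution s \<Omega> w g \<longleftrightarrow>
     (\<forall>x0\<in>\<Omega>. \<forall>N \<phi>. open N \<and> x0 \<in> N \<and> N \<subseteq> \<Omega> \<and> C2_on N \<phi> \<and> \<phi> x0 = w x0 \<and>
        weighted_L1 (real CARD('n) + 2 * s) (\<lambda>y. if y \<in> N then \<phi> y else w y) \<and> (\<forall>y\<in>N. w y \<le> \<phi> y) \<longrightarrow>
        (\<exists>L. has_frac_laplacian s (\<lambda>y. if y \<in> N then \<phi> y else w y) x0 L \<and> L \<le> g x0))"

lemma frac_subsolutionD:
  fixes w :: "real^'n \<Rightarrow> real"
  assumes "frac_subsolution s \<Omega> w g" "x0 \<in> \<Omega>" "open N" "x0 \<in> N" "N \<subseteq> \<Omega>" "C2_on N \<phi>" "\<phi> x0 = w x0"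
    "weighted_L1 (real CARD('n) + 2 * s) (\<lambda>y. if y \<in> N then \<phi> y else w y)" "\<And>y. y \<in> N \<Longrightarrow> w y \<le> \<phi> y"
  shows "\<exists>L. has_frac_laplacian s (\<lambda>y. if y \<in> N then \<phi> y else w y) x0 L \<and> L \<le> g x0"
  using assms unfolding frac_subsolution_def by blast

lemma has_frac_laplacian_scale:
  "has_frac_laplacian s v x L \<Longrightarrow> has_frac_laplacian s (\<lambda>y. c * v y) x (c * L)"
  using has_frac_laplacian_lincomb[of s v x L v L c 0] by simp

lemma weighted_L1_scale: "weighted_L1 a v \<Longrightarrow> weighted_L1 a (\<lambda>y. c * v y)"
  using weighted_L1_lincomb[of a v v c 0] by simp

text \<open>Negation turns touching from below into touching from above. From here on each argument
  is carried out for \<open>frac_subsolution\<close> only and applied twice, to \<open>w, g\<close>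
  and to \<open>- w, - g\<close>.\<close>

lemma frac_laplacian_viscosity_iff:
  fixes w :: "real^'n \<Rightarrow> real"
  shows "frac_laplacian_viscosity s \<Omega> w g \<longleftrightarrow>
    continuous_on \<Omega> w \<and> continuous_on \<Omega> g \<and> weighted_L1 (real CARD('n) + 2 * s) w \<and>
    frac_subsolution s \<Omega> w g \<and> frac_subsolution s \<Omega> (\<lambda>x. - w x) (\<lambda>x. - g x)"
proof -
  let ?a = "real CARD('n) + 2 * s"
  have neg: "(\<exists>L. has_frac_laplacian s (\<lambda>y. - v y) x0 L \<and> L \<le> - g x0) \<longleftrightarrow>
      (\<exists>L. has_frac_laplacian s v x0 L \<and> L \<ge> g x0)" for v x0
  proof
    assume "\<exists>L. has_frac_laplacian s (\<lambda>y. - v y) x0 L \<and> L \<le> - g x0"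
    then obtain L where L: "has_frac_laplacian s (\<lambda>y. - v y) x0 L" "L \<le> - g x0" by blast
    from has_frac_laplacian_scale[OF L(1), of "-1"] L(2)
    show "\<exists>L. has_frac_laplacian s v x0 L \<and> L \<ge> g x0" by (intro exI[of _ "- L"]) simp
  next
    assume "\<exists>L. has_frac_laplacian s v x0 L \<and> L \<ge> g x0"
    then obtain L where L: "has_frac_laplacian s v x0 L" "L \<ge> g x0" by blast
    from has_frac_laplacian_scale[OF L(1), of "-1"] L(2)
    show "\<exists>L. has_frac_laplacian s (\<lambda>y. - v y) x0 L \<and> L \<le> - g x0" by (intro exI[of _ "- L"]) simp
  qed
  have wneg: "weighted_L1 ?a (\<lambda>y. - v y) \<longleftrightarrow> weighted_L1 ?a v" for v :: "real^'n \<Rightarrow> real"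
    using weighted_L1_scale[of ?a v "-1"] weighted_L1_scale[of ?a "\<lambda>y. - v y" "-1"] by auto
  have Cneg: "C2_on N (\<lambda>y. - \<phi> y) \<longleftrightarrow> C2_on N \<phi>" for N and \<phi> :: "real^'n \<Rightarrow> real"
    using C2_on_scale[of N \<phi> "-1"] C2_on_scale[of N "\<lambda>y. - \<phi> y" "-1"] by auto
  have glue: "(\<lambda>y. if y \<in> N then - \<phi> y else - w y) = (\<lambda>y. - (if y \<in> N then \<phi> y else w y))" for N \<phi>
    by auto
  have sub: "frac_subsolution s \<Omega> (\<lambda>x. - w x) (\<lambda>x. - g x) \<longleftrightarrow>
     (\<forall>x0\<in>\<Omega>. \<forall>N \<phi>. open N \<and> x0 \<in> N \<and> N \<subseteq> \<Omega> \<and> C2_on N \<phi> \<and> \<phi> x0 = w x0 \<and>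
        weighted_L1 ?a (\<lambda>y. if y \<in> N then \<phi> y else w y) \<and> (\<forall>y\<in>N. \<phi> y \<le> w y) \<longrightarrow>
        (\<exists>L. has_frac_laplacian s (\<lambda>y. if y \<in> N then \<phi> y else w y) x0 L \<and> L \<ge> g x0))" (is "?L \<longleftrightarrow> ?R")
  proof
    assume L: ?L
    show ?R
    proof (intro ballI allI impI, elim conjE)
      fix x0 N \<phi> assume *: "x0 \<in> \<Omega>" "open N" "x0 \<in> N" "N \<subseteq> \<Omega>" "C2_on N \<phi>" "\<phi> x0 = w x0"
        "weighted_L1 ?a (\<lambda>y. if y \<in> N then \<phi> y else w y)" "\<forall>y\<in>N. \<phi> y \<le> w y"
      show "\<exists>L. has_frac_laplacian s (\<lambda>y. if y \<in> N then \<phi> y else w y) x0 L \<and> L \<ge> g x0"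
        using frac_subsolutionD[OF L *(1-4), of "\<lambda>y. - \<phi> y"] *
        unfolding glue neg wneg Cneg by simp
    qed
  next
    assume R: ?R
    show ?L unfolding frac_subsolution_def
    proof (intro ballI allI impI, elim conjE)
      fix x0 N \<phi> assume *: "x0 \<in> \<Omega>" "open N" "x0 \<in> N" "N \<subseteq> \<Omega>" "C2_on N \<phi>" "\<phi> x0 = - w x0"
        "weighted_L1 ?a (\<lambda>y. if y \<in> N then \<phi> y else - w y)" "\<forall>y\<in>N. - w y \<le> \<phi> y"
      have eq: "(\<lambda>y. if y \<in> N then \<phi> y else - w y) = (\<lambda>y. - (if y \<in> N then - \<phi> y else w y))" by auto
      have "\<forall>y\<in>N. - \<phi> y \<le> w y" using *(8) by force
      then show "\<exists>L. has_frac_laplacian s (\<lambda>y. if y \<in> N then \<phi> y else - w y) x0 L \<and> L \<le> - g x0"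
        using R[rule_format, OF *(1), of N "\<lambda>y. - \<phi> y"] *
        unfolding eq neg wneg Cneg by simp
    qed
  qed
  show ?thesis unfolding sub unfolding frac_laplacian_viscosity_def frac_subsolution_def by blast
qed

section \<open>Scaling and far perturbations of viscosity solutions\<close>

lemma frac_subsolution_scale:
  fixes w :: "real^'n \<Rightarrow> real"
  assumes sub: "frac_subsolution s \<Omega> w g" and c: "0 < c"
  shows "frac_subsolution s \<Omega> (\<lambda>x. c * w x) (\<lambda>x. c * g x)"
  unfolding frac_subsolution_def
proof (intro ballI allI impI, elim conjE)
  let ?a = "real CARD('n) + 2 * s"
  fix x0 N \<phi> assume *: "x0 \<in> \<Omega>" "open N" "x0 \<in> N" "N \<subseteq> \<Omega>" "C2_on N \<phi>" "\<phi> x0 = c * w x0"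
    "weighted_L1 ?a (\<lambda>y. if y \<in> N then \<phi> y else c * w y)" "\<forall>y\<in>N. c * w y \<le> \<phi> y"
  have eq: "(\<lambda>y. if y \<in> N then (1 / c) * \<phi> y else w y) = (\<lambda>y. (1 / c) * (if y \<in> N then \<phi> y else c * w y))"
    using c by auto
  have "\<exists>L. has_frac_laplacian s (\<lambda>y. if y \<in> N then (1 / c) * \<phi> y else w y) x0 L \<and> L \<le> g x0"
  proof (rule frac_subsolutionD[OF sub *(1-4)])
    show "C2_on N (\<lambda>y. 1 / c * \<phi> y)" by (rule C2_on_scale[OF *(5)])
    show "weighted_L1 ?a (\<lambda>y. if y \<in> N then (1 / c) * \<phi> y else w y)"
      unfolding eq by (rule weighted_L1_scale[OF *(7)])
  qed (use * c in \<open>auto simp: field_simps\<close>)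
  then obtain L where L: "has_frac_laplacian s (\<lambda>y. (1 / c) * (if y \<in> N then \<phi> y else c * w y)) x0 L" "L \<le> g x0"
    unfolding eq by blast
  have "has_frac_laplacian s (\<lambda>y. if y \<in> N then \<phi> y else c * w y) x0 (c * L)"
    using has_frac_laplacian_scale[OF L(1), of c] c by simp
  then show "\<exists>L. has_frac_laplacian s (\<lambda>y. if y \<in> N then \<phi> y else c * w y) x0 L \<and> L \<le> c * g x0"
    using L(2) c by (intro exI[of _ "c * L"]) simp
qed

lemma frac_laplacian_viscosity_scale:
  fixes w :: "real^'n \<Rightarrow> real"
  assumes "frac_laplacian_viscosity s \<Omega> w g" "0 < c"
  shows "frac_laplacian_viscosity s \<Omega> (\<lambda>x. c * w x) (\<lambda>x. c * g x)"
  using assms frac_subsolution_scale[of s \<Omega> w g c]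
    frac_subsolution_scale[of s \<Omega> "\<lambda>x. - w x" "\<lambda>x. - g x" c]
  unfolding frac_laplacian_viscosity_iff by (auto intro!: continuous_intros weighted_L1_scale)

text \<open>On \<open>N\<close> the function \<open>q\<close> is zero, so \<open>w\<close> and
  \<open>w + q\<close> have the same test functions there. The two glued functions differ exactly by
  \<open>q\<close>, whose fractional Laplacian is given by
  \<open>has_frac_laplacian_far\<close>.\<close>

lemma frac_subsolution_far:
  fixes w q :: "real^'n \<Rightarrow> real"
  assumes a: "a = real CARD('n) + 2 * s" and s: "0 < s"
    and sub: "frac_subsolution s (ball 0 1) w g"
    and q: "weighted_L1 a q" "\<And>y. y \<in> ball 0 4 \<Longrightarrow> q y = 0"
  shows "frac_subsolution s (ball 0 1) (\<lambda>x. w x + q x)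
    (\<lambda>x. g x - (LINT y|lebesgue. q y / norm (x - y) powr a))"
  unfolding frac_subsolution_def
proof (intro ballI allI impI, elim conjE)
  fix x0 N \<phi> assume *: "x0 \<in> ball 0 1" "open N" "x0 \<in> N" "N \<subseteq> ball 0 1" "C2_on N \<phi>" "\<phi> x0 = w x0 + q x0"
    "weighted_L1 (real CARD('n) + 2 * s) (\<lambda>y. if y \<in> N then \<phi> y else w y + q y)" "\<forall>y\<in>N. w y + q y \<le> \<phi> y"
  have q0: "q y = 0" if "y \<in> N" for y using q(2) *(4) that by force
  have eq: "(\<lambda>y. if y \<in> N then \<phi> y else w y) = (\<lambda>y. 1 * (if y \<in> N then \<phi> y else w y + q y) + (-1) * q y)"
    using q0 by auto
  have "\<exists>L. has_frac_laplacian s (\<lambda>y. if y \<in> N then \<phi> y else w y) x0 L \<and> L \<le> g x0"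
  proof (rule frac_subsolutionD[OF sub *(1-5)])
    show "weighted_L1 (real CARD('n) + 2 * s) (\<lambda>y. if y \<in> N then \<phi> y else w y)"
      unfolding eq by (rule weighted_L1_lincomb[OF *(7) q(1)[unfolded a]])
  qed (use * q0 in auto)
  then obtain L where L: "has_frac_laplacian s (\<lambda>y. if y \<in> N then \<phi> y else w y) x0 L" "L \<le> g x0" by blast
  let ?I = "(LINT y|lebesgue. q y / norm (x0 - y) powr a)"
  have "has_frac_laplacian s q x0 (- ?I)"
  proof (rule has_frac_laplacian_far(2)[OF a s _ q(1)])
    fix y assume "y \<in> ball x0 1"
    then have "norm y < 4" using *(1) norm_triangle_ineq[of x0 "y - x0"] by (simp add: dist_norm norm_minus_commute)
    then show "q y = 0" using q(2) by simp
  qed simp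
  from has_frac_laplacian_lincomb[OF L(1) this, of 1 1]
  have "has_frac_laplacian s (\<lambda>y. if y \<in> N then \<phi> y else w y + q y) x0 (L - ?I)"
    using q0 by (simp add: if_distrib[of "\<lambda>u. u + _"] cong: if_cong)
  then show "\<exists>L. has_frac_laplacian s (\<lambda>y. if y \<in> N then \<phi> y else w y + q y) x0 L \<and> L \<le> g x0 - ?I"
    using L(2) by (intro exI[of _ "L - ?I"]) simp
qed

lemma continuous_on_far_integral:
  fixes q :: "real^'n \<Rightarrow> real"
  assumes a: "a = real CARD('n) + 2 * s" and s: "0 < s"
    and q: "weighted_L1 a q" "\<And>y. y \<in> ball 0 4 \<Longrightarrow> q y = 0"
  shows "continuous_on (ball 0 1) (\<lambda>x. (LINT y|lebesgue. q y / norm (x - y) powr a))"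
proof -
  have a0: "0 < a" using a s by (auto intro: add_nonneg_pos)
  obtain C where C: "0 \<le> C"
    "\<And>x x' y :: real^'n. dist x 0 < 4 / 2 \<Longrightarrow> dist x' 0 < 4 / 2 \<Longrightarrow> 4 \<le> dist y 0 \<Longrightarrow>
        \<bar>1 / norm (x - y) powr a - 1 / norm (x' - y) powr a\<bar> \<le> C * norm (x - x') / (1 + norm y powr a)"
    using kernel_lipschitz[OF a0, of 4 "0::real^'n"] by (metis zero_less_numeral)
  let ?I = "\<lambda>x. (LINT y|lebesgue. q y / norm (x - y) powr a)"
  have int: "integrable lebesgue (\<lambda>y. q y / norm (x - y) powr a)" if x: "x \<in> ball 0 1" for x
  proof (rule has_frac_laplacian_far(1)[OF a s _ q(1)])
    fix y assume "y \<in> ball x 1"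
    then have "norm y < 4" using x norm_triangle_ineq[of x "y - x"] by (simp add: dist_norm norm_minus_commute)
    then show "q y = 0" using q(2) by simp
  qed simp
  let ?B = "(LINT y|lebesgue. \<bar>q y\<bar> / (1 + norm y powr a))"
  have "0 \<le> ?B" using weight_pos[of _ a] by (intro integral_nonneg_AE AE_I2) (simp add: less_imp_le)
  have "(C * ?B)-lipschitz_on (ball 0 1) ?I"
  proof (rule lipschitz_onI)
    fix x x' :: "real^'n" assume x: "x \<in> ball 0 1" "x' \<in> ball 0 1"
    have "\<bar>(LINT y|lebesgue. 1 / norm (x - y) powr a * q y)
        - (LINT y|lebesgue. 1 / norm (x' - y) powr a * q y)\<bar> \<le> C * norm (x - x') * ?B"
    proof (rule integral_diff_le_weighted[OF q(1)])
      fix y assume "q y \<noteq> 0"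
      then have "y \<notin> ball 0 4" using q(2) by blast
      then show "\<bar>1 / norm (x - y) powr a - 1 / norm (x' - y) powr a\<bar> \<le> C * norm (x - x') / (1 + norm y powr a)"
        using x by (intro C(2)) (auto simp: dist_norm)
    qed (use int x in simp_all)
    then show "dist (?I x) (?I x') \<le> C * ?B * dist x x'"
      by (simp add: dist_real_def dist_norm mult_ac)
  qed (use C(1) \<open>0 \<le> ?B\<close> in simp)
  then show ?thesis by (rule lipschitz_on_continuous_on)
qed

lemma frac_laplacian_viscosity_far:
  fixes w q :: "real^'n \<Rightarrow> real"
  assumes a: "a = real CARD('n) + 2 * s" and s: "0 < s"
    and w: "frac_laplacian_viscosity s (ball 0 1) w g"
    and q: "weighted_L1 a q" "\<And>y. y \<in> ball 0 4 \<Longrightarrow> q y = 0"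
  shows "frac_laplacian_viscosity s (ball 0 1) (\<lambda>x. w x + q x)
    (\<lambda>x. g x - (LINT y|lebesgue. q y / norm (x - y) powr a))"
proof -
  have q': "weighted_L1 a (\<lambda>y. - q y)" using weighted_L1_scale[OF q(1), of "-1"] by simp
  have "continuous_on (ball 0 1) (\<lambda>x. w x + q x) \<longleftrightarrow> continuous_on (ball 0 1) w"
    using q(2) by (intro continuous_on_cong) auto
  moreover have "weighted_L1 a (\<lambda>x. w x + q x)" if "weighted_L1 a w"
    using weighted_L1_lincomb[OF that q(1), of 1 1] by simp
  moreover have "frac_subsolution s (ball 0 1) (\<lambda>x. - (w x + q x))
     (\<lambda>x. - (g x - (LINT y|lebesgue. q y / norm (x - y) powr a)))"
    if "frac_subsolution s (ball 0 1) (\<lambda>x. - w x) (\<lambda>x. - g x)"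
    using frac_subsolution_far[OF a s that q'] q(2) by simp
  ultimately show ?thesis
    using w frac_subsolution_far[OF a s _ q] continuous_on_far_integral[OF a s q]
    unfolding frac_laplacian_viscosity_iff a[symmetric] by (auto intro!: continuous_intros)
qed

lemma frac_laplacian_viscosity_cong:
  assumes "frac_laplacian_viscosity s \<Omega> w g" "\<And>x. x \<in> \<Omega> \<Longrightarrow> g x = h x"
  shows "frac_laplacian_viscosity s \<Omega> w h"
proof -
  have "continuous_on \<Omega> g \<longleftrightarrow> continuous_on \<Omega> h" using assms(2) by (intro continuous_on_cong) auto
  then show ?thesis using assms unfolding frac_laplacian_viscosity_def by simp
qed

section \<open>Stability of viscosity solutions\<close>

lemma weighted_L1_bounded_support:
  fixes u :: "real^'n \<Rightarrow> real"
  assumes u: "u \<in> borel_measurable lebesgue" "\<And>y. \<bar>u y\<bar> \<le> M" "\<And>y. y \<notin> ball x0 r \<Longrightarrow> u y = 0"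
  shows "weighted_L1 a u"
proof -
  have "weighted_L1 a (indicat_real (ball x0 r))"
    unfolding weighted_L1_def
  proof (rule Bochner_Integration.integrable_bound[where f = "indicat_real (ball x0 r)"])
    show "integrable lebesgue (indicat_real (ball x0 r))"
      using lmeasurable_ball by (simp add: lmeasurable_iff_integrable)
    show "(\<lambda>y. indicat_real (ball x0 r) y / (1 + norm y powr a)) \<in> borel_measurable lebesgue"
      by (intro borel_measurable_divide weight_measurable borel_measurable_indicator) auto
    show "AE y in lebesgue. norm (indicat_real (ball x0 r) y / (1 + norm y powr a)) \<le> norm (indicat_real (ball x0 r) y)"
    proof (rule AE_I2)
      fix y :: "real^'n"
      have "1 / (1 + norm y powr a) \<le> 1" using weight_pos[of y a] by (subst pos_divide_le_eq) auto
      then show "norm (indicat_real (ball x0 r) y / (1 + norm y powr a)) \<le> norm (indicat_real (ball x0 r) y)"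
        using weight_pos[of y a] by (simp add: indicator_def)
    qed
  qed
  then show ?thesis
  proof (rule weighted_L1_bound[OF _ u(1)])
    show "\<bar>u y\<bar> \<le> M * \<bar>indicat_real (ball x0 r) y\<bar>" for y
      using u(2)[of y] u(3)[of y] by (cases "y \<in> ball x0 r") auto
  qed
qed

lemma continuous_on_indicator_measurable:
  fixes \<phi> :: "real^'n \<Rightarrow> real"
  assumes "continuous_on (cball x0 r) \<phi>"
  shows "(\<lambda>y. indicat_real (ball x0 r) y * \<phi> y) \<in> borel_measurable lebesgue"
proof (rule borel_measurable_lebesgue_borel)
  have "continuous_on (ball x0 r) \<phi>" using assms by (rule continuous_on_subset) auto
  then show "(\<lambda>y. indicat_real (ball x0 r) y * \<phi> y) \<in> borel_measurable borel"
    using borel_measurable_continuous_on_indicator[of "ball x0 r" \<phi>] by simp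
qed

text \<open>A test function cut off to a ball jumps across the sphere. Convergence of its second
  differences is therefore checked only where \<open>x0 + z\<close> and \<open>x0 - z\<close> miss
  the sphere, which excludes a null set.\<close>

lemma AE_sphere_avoid:
  fixes x0 :: "real^'n"
  shows "AE z in lebesgue. x0 + z \<notin> sphere x0 r \<and> x0 - z \<notin> sphere x0 r"
proof -
  have "negligible (sphere (0::real^'n) r)" by (rule negligible_sphere)
  then have "AE z in lebesgue. z \<notin> sphere (0::real^'n) r"
    unfolding negligible_iff_null_sets by (rule AE_not_in)
  then show ?thesis
    by (rule eventually_mono) (simp add: dist_norm)
qed

text \<open>The fractional Laplacian of the glued function is split into a second-difference integral of
  the part in the ball, which passes to the limit by dominated convergence, and the integral of the
  part outside, which passes to the limit by weak convergence.\<close>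

lemma has_frac_laplacian_glued:
  fixes \<Phi> W :: "real^'n \<Rightarrow> real"
  assumes a: "a = real CARD('n) + 2 * s" and s: "0 < s" "s < 1" and r: "0 < r"
    and x: "dist x x0 < r / 2"
    and \<Phi>: "\<Phi> \<in> borel_measurable lebesgue" "\<And>y. \<bar>\<Phi> y\<bar> \<le> M" "\<And>y. y \<notin> ball x0 r \<Longrightarrow> \<Phi> y = 0"
      "\<And>z. norm z < r / 2 \<Longrightarrow> \<bar>second_diff \<Phi> x z\<bar> \<le> M * norm z ^ 2"
    and W: "weighted_L1 a W" "\<And>y. y \<in> ball x0 r \<Longrightarrow> W y = 0"
  shows "has_frac_laplacian s (\<lambda>y. \<Phi> y + W y) x
    (1 / 2 * (LINT z|lebesgue. second_diff \<Phi> x z / norm z powr a)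
      - (LINT y|lebesgue. W y / norm (x - y) powr a))"
proof -
  have "has_frac_laplacian s \<Phi> x (1 / 2 * (LINT z|lebesgue. second_diff \<Phi> x z / norm z powr a))"
    using r \<Phi>(2,4) by (intro has_frac_laplacian_second_diff[OF a s, of "r / 2" \<Phi> M]
      weighted_L1_bounded_support[OF \<Phi>(1,2,3)]) auto
  moreover have "has_frac_laplacian s W x (- (LINT y|lebesgue. W y / norm (x - y) powr a))"
  proof (rule has_frac_laplacian_far(2)[OF a s(1) _ W(1)])
    show "0 < r / 2" using r by simp
    fix y assume "y \<in> ball x (r / 2)"
    then have "y \<in> ball x0 r" using x dist_triangle[of x0 y x] by (simp add: dist_commute)
    then show "W y = 0" by (rule W(2))
  qed
  ultimately show ?thesis
    using has_frac_laplacian_lincomb[of s \<Phi> x _ W _ 1 1] by force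
qed

lemma second_diff_integral_tendsto:
  fixes \<Phi> :: "nat \<Rightarrow> real^'n \<Rightarrow> real"
  assumes n: "real CARD('n) < a" "a < real CARD('n) + 2" and r: "0 < r"
    and meas: "\<And>m. \<Phi> m \<in> borel_measurable lebesgue" "\<Psi> \<in> borel_measurable lebesgue"
    and bdd: "\<And>m y. \<bar>\<Phi> m y\<bar> \<le> M"
    and sd: "\<And>m z. norm z < r \<Longrightarrow> \<bar>second_diff (\<Phi> m) (X m) z\<bar> \<le> M * norm z ^ 2"
    and lim: "AE z in lebesgue. (\<lambda>m. second_diff (\<Phi> m) (X m) z) \<longlonglongrightarrow> second_diff \<Psi> x z"
  shows "(\<lambda>m. (LINT z|lebesgue. second_diff (\<Phi> m) (X m) z / norm z powr a))
    \<longlonglongrightarrow> (LINT z|lebesgue. second_diff \<Psi> x z / norm z powr a)"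
proof (rule integral_dominated_convergence)
  have m: "(\<lambda>z. second_diff u x z / norm z powr a) \<in> borel_measurable lebesgue"
    if "u \<in> borel_measurable lebesgue" for u :: "real^'n \<Rightarrow> real" and x
    using borel_measurable_times[OF second_diff_measurable[OF that, of x] kernel_measurable[of 0 a]] by simp
  show "(\<lambda>z. second_diff \<Psi> x z / norm z powr a) \<in> borel_measurable lebesgue"
    "(\<lambda>z. second_diff (\<Phi> i) (X i) z / norm z powr a) \<in> borel_measurable lebesgue" for i
    by (intro m meas)+
  show "integrable lebesgue (second_diff_majorant a r M :: real^'n \<Rightarrow> real)"
    using n r by (rule integrable_second_diff_majorant)
  show "AE z in lebesgue. (\<lambda>m. second_diff (\<Phi> m) (X m) z / norm z powr a) \<longlonglongrightarrow> second_diff \<Psi> x z / norm z powr a"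
    using lim
  proof (rule eventually_mono)
    fix z assume "(\<lambda>m. second_diff (\<Phi> m) (X m) z) \<longlonglongrightarrow> second_diff \<Psi> x z"
    from tendsto_mult_right[OF this, of "inverse (norm z powr a)"]
    show "(\<lambda>m. second_diff (\<Phi> m) (X m) z / norm z powr a) \<longlonglongrightarrow> second_diff \<Psi> x z / norm z powr a"
      by (simp only: divide_inverse)
  qed
  show "AE z in lebesgue. norm (second_diff (\<Phi> i) (X i) z / norm z powr a) \<le> second_diff_majorant a r M z" for i
  proof (rule AE_I2)
    fix z :: "real^'n"
    have "norm (second_diff (\<Phi> i) (X i) z / norm z powr a) = \<bar>second_diff (\<Phi> i) (X i) z\<bar> / norm z powr a"
      by simp
    also have "\<dots> \<le> second_diff_majorant a r M z"
      by (rule second_diff_majorant[OF bdd sd])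
    finally show "norm (second_diff (\<Phi> i) (X i) z / norm z powr a) \<le> second_diff_majorant a r M z" .
  qed
qed

text \<open>Weak convergence handles the kernel frozen at \<open>x0\<close>. Moving the base point
  from \<open>x0\<close> to \<open>X m\<close> costs at most \<open>norm (X m - x0)\<close> times
  the uniform bound on the weighted norms.\<close>

lemma far_integral_tendsto:
  fixes w :: "nat \<Rightarrow> real^'n \<Rightarrow> real"
  assumes a: "0 < a" and r: "0 < r"
    and w: "\<And>m. weighted_L1 a (w m)" 
    and bound: "\<And>m. (LINT y|lebesgue. \<bar>w m y\<bar> / (1 + norm y powr a)) \<le> B"
    and weak: "\<And>\<psi>. L_infty \<psi> \<Longrightarrow>
       (\<lambda>m. (LINT y|lebesgue. w m y * \<psi> y / (1 + norm y powr a)))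
        \<longlonglongrightarrow> (LINT y|lebesgue. w' y * \<psi> y / (1 + norm y powr a))"
    and X: "X \<longlonglongrightarrow> x0" "\<And>m. dist (X m) x0 < r / 2"
  shows "(\<lambda>m. (LINT y|lebesgue. indicat_real (- ball x0 r) y * w m y / norm (X m - y) powr a))
    \<longlonglongrightarrow> (LINT y|lebesgue. indicat_real (- ball x0 r) y * w' y / norm (x0 - y) powr a)"
proof -
  obtain C where C: "0 \<le> C"
    "\<And>x x' y. dist x x0 < r / 2 \<Longrightarrow> dist x' x0 < r / 2 \<Longrightarrow> r \<le> dist y x0 \<Longrightarrow>
        \<bar>1 / norm (x - y) powr a - 1 / norm (x' - y) powr a\<bar> \<le> C * norm (x - x') / (1 + norm y powr a)"
    by (rule kernel_lipschitz[OF a r, of x0]) (rule that; blast)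
  obtain D where D: "0 < D" "\<And>y. r \<le> norm (x0 - y) \<Longrightarrow> 1 / norm (x0 - y) powr a \<le> D / (1 + norm y powr a)"
    by (rule kernel_bound[OF a norm_ge_zero r, of x0]) (rule that; blast)
  define \<psi> where "\<psi> y = indicat_real (- ball x0 r) y * (1 / norm (x0 - y) powr a) * (1 + norm y powr a)" for y
  have \<psi>: "L_infty \<psi>"
    unfolding L_infty_def
  proof (intro conjI exI[of _ D] AE_I2)
    show "\<psi> \<in> borel_measurable lebesgue"
      unfolding \<psi>_def[abs_def]
      by (intro borel_measurable_times borel_measurable_indicator kernel_measurable weight_measurable) auto
    fix y
    show "\<bar>\<psi> y\<bar> \<le> D"
    proof (cases "r \<le> norm (x0 - y)")
      case True
      have "1 / norm (x0 - y) powr a * (1 + norm y powr a) \<le> D / (1 + norm y powr a) * (1 + norm y powr a)"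
        using weight_pos[of y a] by (intro mult_right_mono D True) auto
      then show ?thesis using True weight_pos[of y a] by (simp add: \<psi>_def dist_norm abs_mult)
    qed (use D(1) in \<open>simp add: \<psi>_def dist_norm\<close>)
  qed
  have \<psi>_eq: "v y * \<psi> y / (1 + norm y powr a) = indicat_real (- ball x0 r) y * v y / norm (x0 - y) powr a" for v y
    using weight_pos[of y a] by (simp add: \<psi>_def)
  let ?J = "\<lambda>m x. (LINT y|lebesgue. indicat_real (- ball x0 r) y * w m y / norm (x - y) powr a)"
  have "(\<lambda>m. ?J m x0) \<longlonglongrightarrow> (LINT y|lebesgue. indicat_real (- ball x0 r) y * w' y / norm (x0 - y) powr a)"
    using weak[OF \<psi>] unfolding \<psi>_eq .
  moreover have "(\<lambda>m. ?J m (X m) - ?J m x0) \<longlonglongrightarrow> 0"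
  proof (rule Lim_null_comparison)
    have "(\<lambda>m. norm (X m - x0)) \<longlonglongrightarrow> 0"
      using X(1) tendsto_norm_zero_iff[of "\<lambda>m. X m - x0"] LIM_zero by blast
    then show "(\<lambda>m. C * norm (X m - x0) * B) \<longlonglongrightarrow> 0"
      by (intro tendsto_mult_left_zero tendsto_mult_right_zero)
    have "\<bar>?J m (X m) - ?J m x0\<bar> \<le> C * norm (X m - x0) * B" for m
    proof -
      have int: "integrable lebesgue (\<lambda>y. indicat_real (- ball x0 r) y * w m y / norm (x - y) powr a)"
        if "dist x x0 < r / 2" for x
      proof -
        have sub: "ball x (r / 2) \<subseteq> ball x0 r"
          using that dist_triangle[of x0 _ x] by (auto simp: dist_commute) (smt (verit) dist_commute dist_triangle field_sum_of_halves)
        have "weighted_L1 a (\<lambda>y. indicat_real (- ball x0 r) y * w m y)"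
          by (rule weighted_L1_indicator[OF w]) auto
        from integrable_kernel_outside[OF a this, of "r / 2" x] r
        have "integrable lebesgue (\<lambda>y. indicat_real (- ball x (r / 2)) y * (indicat_real (- ball x0 r) y * w m y / norm (x - y) powr a))"
          by (simp only: half_gt_zero)
        moreover have eq: "indicat_real (- ball x (r / 2)) y * (indicat_real (- ball x0 r) y * w m y / norm (x - y) powr a)
            = indicat_real (- ball x0 r) y * w m y / norm (x - y) powr a" for y
          using sub by (auto simp: indicator_def)
        ultimately show ?thesis by (simp only: eq)
      qed
      have x0: "dist x0 x0 < r / 2" using r by simp
      have "\<bar>(LINT y|lebesgue. indicat_real (- ball x0 r) y / norm (X m - y) powr a * w m y)
          - (LINT y|lebesgue. indicat_real (- ball x0 r) y / norm (x0 - y) powr a * w m y)\<bar>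
        \<le> C * norm (X m - x0) * (LINT y|lebesgue. \<bar>w m y\<bar> / (1 + norm y powr a))"
      proof (rule integral_diff_le_weighted[OF w])
        fix y
        show "\<bar>indicat_real (- ball x0 r) y / norm (X m - y) powr a - indicat_real (- ball x0 r) y / norm (x0 - y) powr a\<bar>
          \<le> C * norm (X m - x0) / (1 + norm y powr a)"
        proof (cases "y \<in> ball x0 r")
          case False
          then show ?thesis using C(2)[OF X(2) x0, of y m] by (simp add: dist_commute)
        qed (use C(1) weight_pos[of y a] in simp)
      qed (use int[OF X(2)] int[OF x0] in simp_all)
      then have "\<bar>?J m (X m) - ?J m x0\<bar>
        \<le> C * norm (X m - x0) * (LINT y|lebesgue. \<bar>w m y\<bar> / (1 + norm y powr a))" by simp
      also have "\<dots> \<le> C * norm (X m - x0) * B"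
        using C(1) by (intro mult_left_mono bound) auto
      finally show ?thesis .
    qed
    then show "\<forall>\<^sub>F m in sequentially. norm (?J m (X m) - ?J m x0) \<le> C * norm (X m - x0) * B" by simp
  qed
  ultimately show ?thesis using tendsto_add by fastforce
qed

text \<open>The rate is the supremum of the difference over \<open>K\<close>, finite by compactness.
  An explicit null sequence is wanted because the size of the perturbation in the stability proof is
  chosen from it.\<close>

lemma uniform_limit_rate:
  fixes f :: "nat \<Rightarrow> 'a::metric_space \<Rightarrow> real"
  assumes K: "compact K" "K \<noteq> {}" and f: "\<And>m. continuous_on K (f m)" and lim: "uniform_limit K f g sequentially"
  obtains \<delta> where "\<delta> \<longlonglongrightarrow> 0" "\<And>m x. x \<in> K \<Longrightarrow> \<bar>f m x - g x\<bar> \<le> \<delta> m"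
proof -
  have g: "continuous_on K g"
    by (rule uniform_limit_theorem[OF _ lim]) (use f in auto)
  define \<delta> where "\<delta> m = (SUP x\<in>K. \<bar>f m x - g x\<bar>)" for m
  have bdd: "bdd_above ((\<lambda>x. \<bar>f m x - g x\<bar>) ` K)" for m
    by (intro bounded_imp_bdd_above compact_imp_bounded compact_continuous_image continuous_intros f g K)
  have le: "\<bar>f m x - g x\<bar> \<le> \<delta> m" if "x \<in> K" for m x
    unfolding \<delta>_def by (rule cSUP_upper[OF that bdd])
  have pos: "0 \<le> \<delta> m" for m using K(2) le order_trans[OF abs_ge_zero] by blast
  have small: "\<forall>\<^sub>F m in sequentially. \<delta> m < e" if "0 < e" for e
  proof -
    have "\<forall>\<^sub>F m in sequentially. \<forall>x\<in>K. dist (f m x) (g x) < e / 2"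
      using lim that unfolding uniform_limit_iff by (meson half_gt_zero)
    then show ?thesis
    proof (rule eventually_mono)
      fix m assume *: "\<forall>x\<in>K. dist (f m x) (g x) < e / 2"
      have "\<delta> m \<le> e / 2"
        unfolding \<delta>_def using * by (intro cSUP_least K(2)) (auto simp: dist_real_def less_imp_le)
      then show "\<delta> m < e" using that by simp
    qed
  qed
  have "\<delta> \<longlonglongrightarrow> 0"
  proof (intro order_tendstoI small)
    fix e :: real assume "e < 0"
    then have "e < \<delta> m" for m using pos by (rule less_le_trans)
    then show "\<forall>\<^sub>F m in sequentially. e < \<delta> m" by simp
  qed
  then show thesis using le by (rule that)
qed

text \<open>Uniform convergence on closed balls makes the limit continuous, and then also allows the
  arguments to move along with the functions.\<close>

lemma locally_uniform_limit_tendsto: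
  assumes lim: "locally_uniform_limit \<Omega> F f" and \<Omega>: "open \<Omega>" and cont: "\<And>m. continuous_on \<Omega> (F m)"
    and x: "x \<in> \<Omega>" and X: "X \<longlonglongrightarrow> x"
  shows "(\<lambda>m. F m (X m)) \<longlonglongrightarrow> f x" and "continuous_on \<Omega> f"
proof -
  have c: "continuous_on (cball z r) f" "uniform_limit (cball z r) F f sequentially" if "cball z r \<subseteq> \<Omega>" for z r
  proof -
    show u: "uniform_limit (cball z r) F f sequentially"
      using lim that unfolding locally_uniform_limit_def by simp
    show "continuous_on (cball z r) f"
      by (rule uniform_limit_theorem[OF _ u]) (simp_all add: continuous_on_subset[OF cont that])
  qed
  have at: "isCont f z" if z: "z \<in> \<Omega>" for z
  proof -
    obtain r where r: "0 < r" "cball z r \<subseteq> \<Omega>" using bspec[OF open_contains_cball[THEN iffD1, OF \<Omega>] z] by (elim exE conjE)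
    have "continuous_on (ball z r) f" using c(1)[OF r(2)] by (rule continuous_on_subset) auto
    then show ?thesis using r(1) by (simp add: continuous_on_eq_continuous_at)
  qed
  then show "continuous_on \<Omega> f" by (intro continuous_at_imp_continuous_on) auto
  obtain r where r: "0 < r" "cball x r \<subseteq> \<Omega>" using bspec[OF open_contains_cball[THEN iffD1, OF \<Omega>] x] by (elim exE conjE)
  have X': "\<forall>\<^sub>F m in sequentially. dist (X m) x < r" using X r(1) by (rule tendstoD)
  have "\<forall>\<^sub>F m in sequentially. dist (F m (X m)) (f (X m)) < e" if e: "0 < e" for e
  proof -
    have "\<forall>\<^sub>F m in sequentially. \<forall>y\<in>cball x r. dist (F m y) (f y) < e"
      using c(2)[OF r(2)] e unfolding uniform_limit_iff by blast
    with X' show ?thesis by eventually_elim (simp add: dist_commute)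
  qed
  then have "(\<lambda>m. F m (X m) - f (X m)) \<longlonglongrightarrow> 0" by (simp add: tendsto_iff dist_real_def)
  moreover have "(\<lambda>m. f (X m)) \<longlonglongrightarrow> f x" using at[OF x] X by (rule isCont_tendsto_compose)
  ultimately have "(\<lambda>m. (F m (X m) - f (X m)) + f (X m)) \<longlonglongrightarrow> 0 + f x" by (rule tendsto_add)
  then show "(\<lambda>m. F m (X m)) \<longlonglongrightarrow> f x" by simp
qed

text \<open>A perturbed copy of the test function touches \<open>w m\<close> at a point near
  \<open>x0\<close>; the inequality there passes to the limit. Since the touching points move,
  \<open>g\<close> is assumed to converge along convergent sequences of arguments.\<close>

lemma frac_subsolution_stability:
  fixes w g :: "nat \<Rightarrow> real^'n \<Rightarrow> real" and w' g' :: "real^'n \<Rightarrow> real"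
  assumes a: "a = real CARD('n) + 2 * s" and s: "0 < s" "s < 1"
    and sub: "\<And>m. frac_subsolution s (ball 0 1) (w m) (g m)"
    and cont: "\<And>m. continuous_on (ball 0 1) (w m)"
    and w: "\<And>m. weighted_L1 a (w m)"
    and unif: "locally_uniform_limit (ball 0 1) w w'"
    and g: "\<And>X x. x \<in> ball 0 1 \<Longrightarrow> (\<And>m. X m \<in> ball 0 1) \<Longrightarrow> X \<longlonglongrightarrow> x \<Longrightarrow> (\<lambda>m. g m (X m)) \<longlonglongrightarrow> g' x"
    and bound: "\<And>m. (LINT y|lebesgue. \<bar>w m y\<bar> / (1 + norm y powr a)) \<le> B"
    and weak: "\<And>\<psi>. L_infty \<psi> \<Longrightarrow>
       (\<lambda>m. (LINT y|lebesgue. w m y * \<psi> y / (1 + norm y powr a)))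
        \<longlonglongrightarrow> (LINT y|lebesgue. w' y * \<psi> y / (1 + norm y powr a))"
    and w': "weighted_L1 a w'"
  shows "frac_subsolution s (ball 0 1) w' g'"
  unfolding frac_subsolution_def a[symmetric]
proof (intro ballI allI impI, elim conjE)
  have n: "real CARD('n) < a" "a < real CARD('n) + 2" using a s by auto
  then have a0: "0 < a" by (smt (verit) of_nat_0_le_iff)
  fix x0 N \<phi>
  let ?v = "\<lambda>y. if y \<in> N then \<phi> y else w' y"
  assume x0: "x0 \<in> ball 0 1" and N: "open N" "x0 \<in> N" "N \<subseteq> ball 0 1" and \<phi>: "C2_on N \<phi>" "\<phi> x0 = w' x0"
    and v: "weighted_L1 a ?v" and above: "\<forall>y\<in>N. w' y \<le> \<phi> y"
  \<comment> \<open>The approximating functions are glued only on \<open>ball x0 r\<close>, because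
    \<open>\<phi>\<close> may be unbounded on \<open>N\<close>. The difference between the two
    gluings is made up for at the very end.\<close>
  obtain r where r: "0 < r" "cball x0 r \<subseteq> N" using bspec[OF open_contains_cball[THEN iffD1, OF N(1)] N(2)] by (elim exE conjE)
  define K where "K = cball x0 r"
  have K: "compact K" "K \<noteq> {}" "K \<subseteq> N" "x0 \<in> K" "K \<subseteq> ball 0 1" using r N by (auto simp: K_def)
  have \<phi>c: "continuous_on N \<phi>" by (rule C2_on_continuous[OF \<phi>(1)])
  have wK: "continuous_on K (w m)" for m using cont K(5) by (rule continuous_on_subset)
  have unifK: "uniform_limit K w w' sequentially"
    using unif K unfolding locally_uniform_limit_def by blast
  obtain \<delta> where \<delta>: "\<delta> \<longlonglongrightarrow> 0" "\<And>m x. x \<in> K \<Longrightarrow> \<bar>w m x - w' x\<bar> \<le> \<delta> m"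
    by (rule uniform_limit_rate[OF K(1,2) wK unifK]) (rule that; blast)
  have \<delta>0: "0 \<le> \<delta> m" for m using order_trans[OF abs_ge_zero \<delta>(2)[OF K(4)]] .
  \<comment> \<open>The test functions are \<open>\<phi> y + \<eta> m * norm (y - x0) ^ 2 + c m\<close>. As \<open>\<eta> m\<close> dominates \<open>sqrt (\<delta> m)\<close>, the
    touching points \<open>Z m\<close> converge to \<open>x0\<close>, and as \<open>\<eta> m\<close> tends to \<open>0\<close>, the perturbation disappears in the
    same limit.\<close>
  define \<eta> where "\<eta> m = sqrt (\<delta> m) + 1 / real (Suc m)" for m
  have \<eta>0: "0 < \<eta> m" for m using \<delta>0[of m] by (auto simp: \<eta>_def intro!: add_nonneg_pos)
  have "(\<lambda>m. sqrt (\<delta> m) + 1 / real (Suc m)) \<longlonglongrightarrow> sqrt 0 + 0"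
    by (intro tendsto_add tendsto_real_sqrt \<delta>(1) LIMSEQ_Suc[OF lim_1_over_n])
  then have \<eta>: "\<eta> \<longlonglongrightarrow> 0" by (simp add: \<eta>_def[abs_def])
  let ?q = "\<lambda>y. (y - x0) \<bullet> (y - x0)"
  have "\<exists>x\<in>K. \<forall>y\<in>K. w m y - (\<phi> y + \<eta> m * ?q y) \<le> w m x - (\<phi> x + \<eta> m * ?q x)" for m
    by (intro continuous_attains_sup K continuous_intros wK continuous_on_subset[OF \<phi>c K(3)])
  then have "\<forall>m. \<exists>x. x \<in> K \<and> (\<forall>y\<in>K. w m y - (\<phi> y + \<eta> m * ?q y) \<le> w m x - (\<phi> x + \<eta> m * ?q x))"
    by blast
  from choice[OF this] obtain Z where
    "\<forall>m. Z m \<in> K \<and> (\<forall>y\<in>K. w m y - (\<phi> y + \<eta> m * ?q y) \<le> w m (Z m) - (\<phi> (Z m) + \<eta> m * ?q (Z m)))" ..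
  then have Z: "Z m \<in> K"
    "y \<in> K \<Longrightarrow> w m y - (\<phi> y + \<eta> m * ?q y) \<le> w m (Z m) - (\<phi> (Z m) + \<eta> m * ?q (Z m))" for m y
    by blast+
  \<comment> \<open>The maximum is compared with the value at \<open>x0\<close>, where
    \<open>\<phi> = w'\<close>; each side is within \<open>\<delta> m\<close> of its limit, whence
    \<open>2 * \<delta> m / \<eta> m \<le> 2 * sqrt (\<delta> m)\<close>. The summand
    \<open>1 / real (Suc m)\<close> keeps \<open>\<eta> m\<close> positive when
    \<open>\<delta> m = 0\<close>.\<close>
  have Zq: "?q (Z m) \<le> 2 * sqrt (\<delta> m)" for m
  proof -
    have "w m (Z m) - (\<phi> (Z m) + \<eta> m * ?q (Z m)) \<le> \<delta> m - \<eta> m * ?q (Z m)"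
      using \<delta>(2)[OF Z(1), of m m] above Z(1)[of m] K(3) by (force simp: abs_le_iff)
    moreover have "- \<delta> m \<le> w m x0 - (\<phi> x0 + \<eta> m * ?q x0)"
      using \<delta>(2)[OF K(4), of m] \<phi>(2) by (simp add: abs_le_iff)
    ultimately have "\<eta> m * ?q (Z m) \<le> 2 * \<delta> m" using Z(2)[OF K(4), of m] by linarith
    also have "2 * \<delta> m = 2 * sqrt (\<delta> m) * sqrt (\<delta> m)" using \<delta>0[of m] by simp
    also have "\<dots> \<le> 2 * sqrt (\<delta> m) * \<eta> m" using \<delta>0[of m] by (intro mult_left_mono) (auto simp: \<eta>_def)
    finally show ?thesis using \<eta>0[of m] by (simp add: mult.commute)
  qed
  have "(\<lambda>m. 2 * sqrt (\<delta> m)) \<longlonglongrightarrow> 2 * sqrt 0" by (intro tendsto_intros \<delta>(1))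
  then have \<delta>lim: "(\<lambda>m. 2 * sqrt (\<delta> m)) \<longlonglongrightarrow> 0" by simp
  have q0: "(\<lambda>m. ?q (Z m)) \<longlonglongrightarrow> 0"
    by (rule tendsto_sandwich[OF always_eventually always_eventually tendsto_const \<delta>lim])
       (use Zq in \<open>blast intro: inner_ge_zero\<close>)+
  then have "(\<lambda>m. sqrt (?q (Z m))) \<longlonglongrightarrow> sqrt 0" by (rule tendsto_real_sqrt)
  then have Zlim: "Z \<longlonglongrightarrow> x0"
    unfolding norm_eq_sqrt_inner[symmetric] by (simp add: tendsto_norm_zero_iff LIM_zero_iff)
  \<comment> \<open>\<open>X m = Z m\<close> for large \<open>m\<close>; the change makes the bounds below hold for all \<open>m\<close>.\<close>
  define X where "X m = (if dist (Z m) x0 < r / 2 then Z m else x0)" for m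
  have XZ: "\<forall>\<^sub>F m in sequentially. dist (Z m) x0 < r / 2" using Zlim r(1) by (intro tendstoD) auto
  have X: "dist (X m) x0 < r / 2" for m using r(1) by (simp add: X_def)
  have XK: "X m \<in> K" for m using X[of m] r(1) by (simp add: K_def dist_commute)
  have Xlim: "X \<longlonglongrightarrow> x0"
    by (rule Lim_transform_eventually[OF Zlim]) (use XZ in \<open>rule eventually_mono, simp add: X_def\<close>)
  have \<phi>lim: "(\<lambda>m. \<phi> (Y m)) \<longlonglongrightarrow> \<phi> y" if "Y \<longlonglongrightarrow> y" "y \<in> N" for Y y
  proof (rule isCont_tendsto_compose[OF _ that(1)])
    show "isCont \<phi> y" using \<phi>c that(2) by (simp add: continuous_on_eq_continuous_at[OF N(1)])
  qed
  \<comment> \<open>The vertical shift that makes the perturbed test function meet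
    \<open>w m\<close> at \<open>X m\<close>.\<close>
  define c where "c m = w m (X m) - (\<phi> (X m) + \<eta> m * ?q (X m))" for m
  have "(\<lambda>m. w m (X m)) \<longlonglongrightarrow> w' x0"
    by (rule locally_uniform_limit_tendsto(1)[OF unif open_ball cont x0 Xlim])
  then have "c \<longlonglongrightarrow> w' x0 - (\<phi> x0 + 0 * ?q x0)"
    unfolding c_def[abs_def] by (intro tendsto_intros \<phi>lim[OF Xlim N(2)] \<eta> Xlim)
  then have c: "c \<longlonglongrightarrow> 0" using \<phi>(2) by simp
  from convergent_imp_Bseq[OF convergentI[OF c]] obtain C where "\<forall>m. norm (c m) \<le> C"
    unfolding Bseq_def by blast
  then have C: "\<bar>c m\<bar> \<le> C" for m by simp
  from convergent_imp_Bseq[OF convergentI[OF \<eta>]] obtain E where "\<forall>m. norm (\<eta> m) \<le> E"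
    unfolding Bseq_def by blast
  then have E: "\<bar>\<eta> m\<bar> \<le> E" for m by simp
  have "bounded (\<phi> ` K)"
    by (intro compact_imp_bounded compact_continuous_image K continuous_on_subset[OF \<phi>c K(3)])
  then obtain A where "\<forall>v\<in>\<phi> ` K. norm v \<le> A" unfolding bounded_iff by blast
  then have A: "\<bar>\<phi> y\<bar> \<le> A" if "y \<in> K" for y using that by simp
  obtain M where M: "0 \<le> M"
    "\<And>x z. dist x x0 < r / 2 \<Longrightarrow> norm z < r / 2 \<Longrightarrow> \<bar>second_diff \<phi> x z\<bar> \<le> M * norm z ^ 2"
    by (rule C2_on_second_diff_bound[OF \<phi>(1) r(2,1)]) (rule that; blast)
  have E0: "0 \<le> E" and C0: "0 \<le> C" and A0: "0 \<le> A"
    using order_trans[OF abs_ge_zero E] order_trans[OF abs_ge_zero C] order_trans[OF abs_ge_zero A[OF K(4)]] by auto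
  \<comment> \<open>One constant for two bounds: \<open>A + E * r ^ 2 + C\<close> is the sup bound
    on the cut-off test functions, \<open>M + 2 * E\<close> the quadratic bound on their second
    differences.\<close>
  define T where "T = A + E * r ^ 2 + C + M + 2 * E"
  define \<Phi> where "\<Phi> e d y = indicat_real (ball x0 r) y * (\<phi> y + e * ?q y + d)" for e d y
  have \<Phi>meas: "\<Phi> e d \<in> borel_measurable lebesgue" for e d
    unfolding \<Phi>_def[abs_def]
    by (intro continuous_on_indicator_measurable continuous_intros continuous_on_subset[OF \<phi>c r(2)])
  have \<Phi>bdd: "\<bar>\<Phi> e d y\<bar> \<le> T" if "\<bar>e\<bar> \<le> E" "\<bar>d\<bar> \<le> C" for e d y
  proof (cases "y \<in> ball x0 r")
    case True
    have "?q y \<le> r ^ 2"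
      using True by (simp add: dot_square_norm dist_norm norm_minus_commute power_mono)
    then have "\<bar>e\<bar> * ?q y \<le> E * r ^ 2" using that(1) E0 by (intro mult_mono) auto
    then have "\<bar>e * ?q y\<bar> \<le> E * r ^ 2" by (simp add: abs_mult)
    moreover have "\<bar>\<phi> y\<bar> \<le> A" using True by (intro A) (simp add: K_def)
    ultimately have "\<bar>\<phi> y + e * ?q y + d\<bar> \<le> A + E * r ^ 2 + C" using that(2) by linarith
    then show ?thesis using True M(1) E0 by (simp add: \<Phi>_def T_def)
  qed (use M(1) E0 C0 A0 in \<open>simp add: \<Phi>_def T_def\<close>)
  have \<Phi>sd: "\<bar>second_diff (\<Phi> e d) x z\<bar> \<le> T * norm z ^ 2"
    if "\<bar>e\<bar> \<le> E" "dist x x0 < r / 2" "norm z < r / 2" for e d x z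
  proof -
    have "dist x x0 < r" "dist (x + z) x0 < r" "dist (x - z) x0 < r"
      using that(2,3) norm_triangle_ineq[of "x - x0" z] norm_triangle_ineq4[of "x - x0" z] r(1)
      by (simp_all add: dist_norm algebra_simps)
    then have "x \<in> ball x0 r" "x + z \<in> ball x0 r" "x - z \<in> ball x0 r"
      by (simp_all add: dist_commute)
    then have "second_diff (\<Phi> e d) x z = second_diff \<phi> x z - 2 * e * norm z ^ 2"
      by (simp add: second_diff_def \<Phi>_def power2_norm_eq_inner inner_diff inner_add inner_commute algebra_simps)
    also have "\<bar>\<dots>\<bar> \<le> \<bar>second_diff \<phi> x z\<bar> + 2 * \<bar>e\<bar> * norm z ^ 2"
      by (rule order_trans[OF abs_triangle_ineq4]) (simp add: abs_mult)
    also have "\<dots> \<le> M * norm z ^ 2 + 2 * E * norm z ^ 2"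
      using M(2)[OF that(2,3)] that(1) by (intro add_mono mult_right_mono) auto
    also have "\<dots> = (M + 2 * E) * norm z ^ 2" by (simp add: distrib_right)
    also have "\<dots> \<le> T * norm z ^ 2"
      using E0 C0 A0 by (intro mult_right_mono) (auto simp: T_def)
    finally show ?thesis .
  qed
  \<comment> \<open>Inside the ball the parameters \<open>\<eta> m\<close> and \<open>c m\<close>
    tend to zero, and outside the closed ball the functions eventually vanish; only the jump on the
    sphere has to be excluded.\<close>
  have \<Phi>lim: "(\<lambda>m. \<Phi> (\<eta> m) (c m) (Y m)) \<longlonglongrightarrow> \<Phi> 0 0 y" if Y: "Y \<longlonglongrightarrow> y" and y: "y \<notin> sphere x0 r" for Y y
  proof (cases "y \<in> ball x0 r")
    case True
    have "\<forall>\<^sub>F m in sequentially. Y m \<in> ball x0 r" using Y True by (intro topological_tendstoD) auto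
    then have "\<forall>\<^sub>F m in sequentially. \<phi> (Y m) + \<eta> m * ?q (Y m) + c m = \<Phi> (\<eta> m) (c m) (Y m)"
      by (rule eventually_mono) (simp add: \<Phi>_def)
    moreover have "(\<lambda>m. \<phi> (Y m) + \<eta> m * ?q (Y m) + c m) \<longlonglongrightarrow> \<phi> y + 0 * ?q y + 0"
      using True r(2) by (intro tendsto_intros \<phi>lim Y \<eta> c) auto
    ultimately have "(\<lambda>m. \<Phi> (\<eta> m) (c m) (Y m)) \<longlonglongrightarrow> \<phi> y + 0 * ?q y + 0"
      by (rule Lim_transform_eventually[rotated])
    then show ?thesis using True by (simp add: \<Phi>_def[of 0 0])
  next
    case False
    then have "y \<in> - cball x0 r" using y by (auto simp: not_less)
    then have "\<forall>\<^sub>F m in sequentially. Y m \<in> - cball x0 r" using Y by (intro topological_tendstoD) auto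
    then have ev: "\<forall>\<^sub>F m in sequentially. 0 = \<Phi> (\<eta> m) (c m) (Y m)"
      by (rule eventually_mono) (simp add: \<Phi>_def)
    have "\<Phi> 0 0 y = 0" using False by (simp add: \<Phi>_def)
    then show ?thesis using Lim_transform_eventually[OF tendsto_const ev] by simp
  qed
  let ?I = "\<lambda>e d x. (LINT z|lebesgue. second_diff (\<Phi> e d) x z / norm z powr a)"
  let ?J = "\<lambda>u x. (LINT y|lebesgue. indicat_real (- ball x0 r) y * u y / norm (x - y) powr a)"
  have I: "(\<lambda>m. ?I (\<eta> m) (c m) (X m)) \<longlonglongrightarrow> ?I 0 0 x0"
  proof (rule second_diff_integral_tendsto[OF n, of "r / 2" _ _ T])
    show "AE z in lebesgue. (\<lambda>m. second_diff (\<Phi> (\<eta> m) (c m)) (X m) z) \<longlonglongrightarrow> second_diff (\<Phi> 0 0) x0 z"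
      using AE_sphere_avoid[of x0 r]
    proof (rule eventually_mono)
      fix z assume z: "x0 + z \<notin> sphere x0 r \<and> x0 - z \<notin> sphere x0 r"
      show "(\<lambda>m. second_diff (\<Phi> (\<eta> m) (c m)) (X m) z) \<longlonglongrightarrow> second_diff (\<Phi> 0 0) x0 z"
        unfolding second_diff_def
        by (intro tendsto_diff tendsto_mult tendsto_const \<Phi>lim tendsto_add Xlim) (use z r(1) in auto)
    qed
  qed (use r(1) \<Phi>meas \<Phi>bdd[OF E C] \<Phi>sd[OF E X] in auto)
  have J: "(\<lambda>m. ?J (w m) (X m)) \<longlonglongrightarrow> ?J w' x0"
    using far_integral_tendsto[OF a0 r(1) w bound weak Xlim X] .
  have W: "weighted_L1 a (\<lambda>y. indicat_real (- ball x0 r) y * u y)" if "weighted_L1 a u" for u :: "real^'n \<Rightarrow> real"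
    by (rule weighted_L1_indicator[OF that]) auto
  have glued: "has_frac_laplacian s (\<lambda>y. \<Phi> e d y + indicat_real (- ball x0 r) y * u y) x (1 / 2 * ?I e d x - ?J u x)"
    if "\<bar>e\<bar> \<le> E" "\<bar>d\<bar> \<le> C" "dist x x0 < r / 2" "weighted_L1 a u" for e d x u
    by (rule has_frac_laplacian_glued[OF a s r(1) that(3) \<Phi>meas \<Phi>bdd[OF that(1,2)] _ \<Phi>sd[OF that(1,3)] W[OF that(4)]])
       (auto simp: \<Phi>_def)
  \<comment> \<open>Only for large \<open>m\<close> is \<open>X m\<close> the maximum point
    \<open>Z m\<close>, and only then does the test function lie above \<open>w m\<close> on the
    whole ball.\<close>
  have le: "\<forall>\<^sub>F m in sequentially. 1 / 2 * ?I (\<eta> m) (c m) (X m) - ?J (w m) (X m) \<le> g m (X m)"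
    using XZ
  proof (rule eventually_mono)
    fix m assume "dist (Z m) x0 < r / 2"
    then have XZm: "X m = Z m" by (simp add: X_def)
    let ?\<phi> = "\<lambda>y. \<phi> y + \<eta> m * ?q y + c m"
    let ?g = "\<lambda>y. if y \<in> ball x0 r then ?\<phi> y else w m y"
    have g_eq: "?g = (\<lambda>y. \<Phi> (\<eta> m) (c m) y + indicat_real (- ball x0 r) y * w m y)"
      by (auto simp: \<Phi>_def fun_eq_iff)
    have "weighted_L1 a (\<lambda>y. 1 * \<Phi> (\<eta> m) (c m) y + 1 * (indicat_real (- ball x0 r) y * w m y))"
      by (intro weighted_L1_lincomb W w weighted_L1_bounded_support[OF \<Phi>meas \<Phi>bdd[OF E C], of x0 r])
         (simp add: \<Phi>_def)
    then have gw: "weighted_L1 (real CARD('n) + 2 * s) ?g" unfolding g_eq a[symmetric] by simp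
    have "\<exists>L. has_frac_laplacian s ?g (X m) L \<and> L \<le> g m (X m)"
    proof (rule frac_subsolutionD[OF sub _ _ _ _ _ _ gw])
      show "X m \<in> ball 0 1" using XK K(5) by blast
      show "X m \<in> ball x0 r" using X[of m] r(1) by (simp add: dist_commute)
      show "ball x0 r \<subseteq> ball 0 1" using K(5) by (auto simp: K_def)
      show "C2_on (ball x0 r) ?\<phi>"
        by (intro C2_on_add_quadratic C2_on_subset[OF \<phi>(1)]) (use r(2) in auto)
      show "?\<phi> (X m) = w m (X m)" by (simp add: c_def)
      show "w m y \<le> ?\<phi> y" if "y \<in> ball x0 r" for y
        using Z(2)[of y m] that by (simp add: c_def XZm K_def)
    qed simp
    then obtain L where L: "has_frac_laplacian s ?g (X m) L" "L \<le> g m (X m)" by blast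
    have "L = 1 / 2 * ?I (\<eta> m) (c m) (X m) - ?J (w m) (X m)"
      using L(1) glued[OF E C X w] unfolding g_eq by (rule has_frac_laplacian_unique)
    then show "1 / 2 * ?I (\<eta> m) (c m) (X m) - ?J (w m) (X m) \<le> g m (X m)" using L(2) by simp
  qed
  have L: "1 / 2 * ?I 0 0 x0 - ?J w' x0 \<le> g' x0"
  proof (rule tendsto_le[OF _ _ _ le])
    show "(\<lambda>m. g m (X m)) \<longlonglongrightarrow> g' x0" using XK K(5) by (intro g x0 Xlim) blast
    show "(\<lambda>m. 1 / 2 * ?I (\<eta> m) (c m) (X m) - ?J (w m) (X m)) \<longlonglongrightarrow> 1 / 2 * ?I 0 0 x0 - ?J w' x0"
      by (intro tendsto_diff tendsto_mult tendsto_const I J)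
  qed simp
  have v_eq: "?v = (\<lambda>y. \<Phi> 0 0 y + indicat_real (- ball x0 r) y * ?v y)"
  proof (rule ext)
    fix y
    have "y \<in> N" if "y \<in> ball x0 r" using that r(2) by auto
    then show "?v y = \<Phi> 0 0 y + indicat_real (- ball x0 r) y * ?v y"
      by (cases "y \<in> ball x0 r") (simp_all add: \<Phi>_def)
  qed
  have "has_frac_laplacian s (\<lambda>y. \<Phi> 0 0 y + indicat_real (- ball x0 r) y * ?v y) x0 (1 / 2 * ?I 0 0 x0 - ?J ?v x0)"
    using E0 C0 r(1) by (intro glued v) auto
  then have "has_frac_laplacian s ?v x0 (1 / 2 * ?I 0 0 x0 - ?J ?v x0)"
    by (simp only: v_eq[symmetric])
  \<comment> \<open>Outside the ball, \<open>?v\<close> is \<open>\<phi>\<close> on the rest of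
    \<open>N\<close> and \<open>w'\<close> elsewhere, so it is at least \<open>w'\<close>. The far
    integral enters with a minus sign, hence gluing on all of \<open>N\<close> can only lower the
    fractional Laplacian.\<close>
  moreover have "?J w' x0 \<le> ?J ?v x0"
  proof (rule integral_mono)
    show "integrable lebesgue (\<lambda>y. indicat_real (- ball x0 r) y * w' y / norm (x0 - y) powr a)"
      using integrable_kernel_outside[OF a0 w' r(1), of x0] by simp
    show "integrable lebesgue (\<lambda>y. indicat_real (- ball x0 r) y * ?v y / norm (x0 - y) powr a)"
      using integrable_kernel_outside[OF a0 v r(1), of x0] by simp
    show "indicat_real (- ball x0 r) y * w' y / norm (x0 - y) powr a
        \<le> indicat_real (- ball x0 r) y * ?v y / norm (x0 - y) powr a" for y
      using above by (intro divide_right_mono mult_left_mono) auto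
  qed
  ultimately show "\<exists>L. has_frac_laplacian s ?v x0 L \<and> L \<le> g' x0"
    using L by (intro exI[of _ "1 / 2 * ?I 0 0 x0 - ?J ?v x0"]) simp
qed

lemma frac_laplacian_viscosity_stability:
  fixes w g :: "nat \<Rightarrow> real^'n \<Rightarrow> real" and w' g' :: "real^'n \<Rightarrow> real"
  assumes a: "a = real CARD('n) + 2 * s" and s: "0 < s" "s < 1"
    and visc: "\<And>m. frac_laplacian_viscosity s (ball 0 1) (w m) (g m)"
    and unif: "locally_uniform_limit (ball 0 1) w w'"
    and g: "\<And>X x. x \<in> ball 0 1 \<Longrightarrow> (\<And>m. X m \<in> ball 0 1) \<Longrightarrow> X \<longlonglongrightarrow> x \<Longrightarrow> (\<lambda>m. g m (X m)) \<longlonglongrightarrow> g' x"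
    and g': "continuous_on (ball 0 1) g'"
    and bound: "\<And>m. (LINT y|lebesgue. \<bar>w m y\<bar> / (1 + norm y powr a)) \<le> B"
    and weak: "\<And>\<psi>. L_infty \<psi> \<Longrightarrow>
       (\<lambda>m. (LINT y|lebesgue. w m y * \<psi> y / (1 + norm y powr a)))
        \<longlonglongrightarrow> (LINT y|lebesgue. w' y * \<psi> y / (1 + norm y powr a))"
    and w': "weighted_L1 a w'"
  shows "frac_laplacian_viscosity s (ball 0 1) w' g'"
proof -
  have V: "continuous_on (ball 0 1) (w m)" "weighted_L1 a (w m)" "frac_subsolution s (ball 0 1) (w m) (g m)"
    "frac_subsolution s (ball 0 1) (\<lambda>x. - w m x) (\<lambda>x. - g m x)" for m
    using visc[of m] unfolding frac_laplacian_viscosity_iff a by auto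
  have "continuous_on (ball 0 1) w'"
    by (rule locally_uniform_limit_tendsto(2)[OF unif open_ball V(1), of 0 "\<lambda>_. 0"]) auto
  moreover have "frac_subsolution s (ball 0 1) w' g'"
    by (rule frac_subsolution_stability[OF a s V(3) V(1) V(2) unif g bound weak w'])
  moreover have "frac_subsolution s (ball 0 1) (\<lambda>x. - w' x) (\<lambda>x. - g' x)"
  proof (rule frac_subsolution_stability[OF a s V(4)])
    show "weighted_L1 a (\<lambda>x. - w m x)" "weighted_L1 a (\<lambda>x. - w' x)" for m
      using weighted_L1_scale[OF V(2)[of m], of "-1"] weighted_L1_scale[OF w', of "-1"] by auto
    show "locally_uniform_limit (ball 0 1) (\<lambda>m x. - w m x) (\<lambda>x. - w' x)"
      using unif unfolding locally_uniform_limit_def by (auto intro!: uniform_limit_intros)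
    show "(\<lambda>m. - g m (X m)) \<longlonglongrightarrow> - g' x" if "x \<in> ball 0 1" "\<And>m. X m \<in> ball 0 1" "X \<longlonglongrightarrow> x" for X x
      using g[OF that] by (rule tendsto_minus)
    show "(\<lambda>m. (LINT y|lebesgue. - w m y * \<psi> y / (1 + norm y powr a)))
        \<longlonglongrightarrow> (LINT y|lebesgue. - w' y * \<psi> y / (1 + norm y powr a))" if "L_infty \<psi>" for \<psi>
      using tendsto_minus[OF weak[OF that]] by simp
  qed (use V(1) bound in \<open>auto intro: continuous_intros\<close>)
  ultimately show ?thesis
    unfolding frac_laplacian_viscosity_iff a[symmetric] using g' w' by blast
qed

section \<open>Taylor expansion of the kernel\<close>

text \<open>Nothing is asked of \<open>\<psi>\<close> for \<open>norm y < 4\<close>, hence the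
  indicator in the measurability clause. The Lipschitz clause has the same decay as the bound, so
  that integrals against \<open>\<psi>\<close> depend on \<open>x\<close> in a controlled
  way.\<close>

definition decaying_remainder :: "nat \<Rightarrow> (real^'n \<Rightarrow> real^'n \<Rightarrow> real) \<Rightarrow> bool" where
  "decaying_remainder k \<psi> \<longleftrightarrow>
     (\<forall>x\<in>ball 0 1. (\<lambda>y. indicat_real (- ball 0 4) y * \<psi> x y) \<in> borel_measurable borel) \<and>
     (\<exists>C. \<forall>x\<in>ball 0 1. \<forall>x'\<in>ball 0 1. \<forall>y. 4 \<le> norm y \<longrightarrow>
        \<bar>\<psi> x y\<bar> \<le> C / norm y ^ k \<and> \<bar>\<psi> x y - \<psi> x' y\<bar> \<le> C * norm (x - x') / norm y ^ k)"

lemma decaying_remainderI: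
  fixes \<psi> :: "real^'n \<Rightarrow> real^'n \<Rightarrow> real"
  assumes "\<And>x. x \<in> ball 0 1 \<Longrightarrow> (\<lambda>y. indicat_real (- ball 0 4) y * \<psi> x y) \<in> borel_measurable borel"
    and "\<And>x y. x \<in> ball 0 1 \<Longrightarrow> 4 \<le> norm y \<Longrightarrow> \<bar>\<psi> x y\<bar> \<le> C / norm y ^ k"
    and "\<And>x x' y. x \<in> ball 0 1 \<Longrightarrow> x' \<in> ball 0 1 \<Longrightarrow> 4 \<le> norm y \<Longrightarrow>
        \<bar>\<psi> x y - \<psi> x' y\<bar> \<le> D * norm (x - x') / norm y ^ k"
  shows "decaying_remainder k \<psi>"
proof -
  have "\<bar>\<psi> x y\<bar> \<le> max C D / norm y ^ k \<and> \<bar>\<psi> x y - \<psi> x' y\<bar> \<le> max C D * norm (x - x') / norm y ^ k"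
    if "x \<in> ball 0 1" "x' \<in> ball 0 1" "4 \<le> norm y" for x x' y
  proof
    show "\<bar>\<psi> x y\<bar> \<le> max C D / norm y ^ k"
      using assms(2)[OF that(1,3)] by (rule order_trans) (auto intro: divide_right_mono)
    show "\<bar>\<psi> x y - \<psi> x' y\<bar> \<le> max C D * norm (x - x') / norm y ^ k"
      using assms(3)[OF that] by (rule order_trans) (auto intro!: divide_right_mono mult_right_mono)
  qed
  then show ?thesis using assms(1) unfolding decaying_remainder_def by blast
qed

lemma decaying_remainderE:
  fixes \<psi> :: "real^'n \<Rightarrow> real^'n \<Rightarrow> real"
  assumes "decaying_remainder k \<psi>"
  obtains C where "0 \<le> C"
    "\<And>x y. x \<in> ball 0 1 \<Longrightarrow> 4 \<le> norm y \<Longrightarrow> \<bar>\<psi> x y\<bar> \<le> C / norm y ^ k"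
    "\<And>x x' y. x \<in> ball 0 1 \<Longrightarrow> x' \<in> ball 0 1 \<Longrightarrow> 4 \<le> norm y \<Longrightarrow>
        \<bar>\<psi> x y - \<psi> x' y\<bar> \<le> C * norm (x - x') / norm y ^ k"
proof -
  obtain C where C: "\<forall>x\<in>ball 0 1. \<forall>x'\<in>ball 0 1. \<forall>y. 4 \<le> norm y \<longrightarrow>
        \<bar>\<psi> x y\<bar> \<le> C / norm y ^ k \<and> \<bar>\<psi> x y - \<psi> x' y\<bar> \<le> C * norm (x - x') / norm y ^ k"
    using assms unfolding decaying_remainder_def by blast
  show thesis
  proof (rule that[of "max C 0"])
    fix x x' y :: "real^'n" assume *: "x \<in> ball 0 1" "4 \<le> norm y"
    have "\<bar>\<psi> x y\<bar> \<le> C / norm y ^ k" using C * by blast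
    then show "\<bar>\<psi> x y\<bar> \<le> max C 0 / norm y ^ k"
      by (rule order_trans) (auto intro: divide_right_mono)
    assume "x' \<in> ball 0 1"
    then have "\<bar>\<psi> x y - \<psi> x' y\<bar> \<le> C * norm (x - x') / norm y ^ k" using C * by blast
    then show "\<bar>\<psi> x y - \<psi> x' y\<bar> \<le> max C 0 * norm (x - x') / norm y ^ k"
      by (rule order_trans) (auto intro!: divide_right_mono mult_right_mono)
  qed simp
qed

lemma decaying_remainder_measurable:
  "decaying_remainder k \<psi> \<Longrightarrow> x \<in> ball 0 1 \<Longrightarrow>
    (\<lambda>y. indicat_real (- ball 0 4) y * \<psi> x y) \<in> borel_measurable borel"
  unfolding decaying_remainder_def by blast

text \<open>Kernels with a Taylor expansion of order \<open>k\<close> in \<open>x\<close>, graded by the decay in \<open>y\<close>: a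
  coefficient of degree \<open>d\<close> is \<open>O(\<bar>y\<bar>\<^sup>-\<^sup>d)\<close>, so that the terms of degree \<open>\<ge> k\<close> of a product can be
  absorbed into the remainder.\<close>

inductive expandable :: "nat \<Rightarrow> (real^'n \<Rightarrow> real^'n \<Rightarrow> real) \<Rightarrow> bool" for k where
  mono: "(\<Sum>i\<in>UNIV. \<alpha> i) < k \<Longrightarrow> c \<in> borel_measurable borel \<Longrightarrow>
     (\<And>y. 4 \<le> norm y \<Longrightarrow> \<bar>c y\<bar> \<le> C / norm y ^ (\<Sum>i\<in>UNIV. \<alpha> i)) \<Longrightarrow>
     expandable k (\<lambda>x y. monomial \<alpha> x * c y)"
| rem: "decaying_remainder k \<psi> \<Longrightarrow> expandable k \<psi>"
| add: "expandable k K \<Longrightarrow> expandable k L \<Longrightarrow> expandable k (\<lambda>x y. K x y + L x y)"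

lemma monomial_bounded:
  assumes "x \<in> ball 0 1"
  shows "\<bar>monomial \<alpha> x\<bar> \<le> 1"
proof -
  have "\<bar>x $ i\<bar> \<le> 1" for i using component_le_norm_cart[of x i] assms by simp
  then show ?thesis
    unfolding monomial_def abs_prod by (intro prod_le_1) (auto simp: power_abs power_le_one)
qed

lemma monomial_Suc: "monomial (\<alpha>(i := Suc (\<alpha> i))) x = x $ i * monomial \<alpha> x"
proof -
  have "(\<Prod>j\<in>UNIV - {i}. (x $ j) ^ (\<alpha>(i := Suc (\<alpha> i))) j) = (\<Prod>j\<in>UNIV - {i}. (x $ j) ^ \<alpha> j)"
    by (intro prod.cong) auto
  then show ?thesis
    unfolding monomial_def by (simp add: prod.remove[of UNIV i])
qed

lemma degree_Suc: "(\<Sum>j\<in>UNIV. (\<alpha>(i := Suc (\<alpha> i))) j) = Suc (\<Sum>j\<in>UNIV. \<alpha> j :: nat)"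
  for i :: "'n::finite"
proof -
  have "(\<Sum>j\<in>UNIV - {i}. (\<alpha>(i := Suc (\<alpha> i))) j) = (\<Sum>j\<in>UNIV - {i}. \<alpha> j)"
    by (intro sum.cong) auto
  then show ?thesis by (simp add: sum.remove[of UNIV i])
qed

lemma monomial_lipschitz:
  obtains D where "0 \<le> D"
    "\<And>x x'. x \<in> ball 0 1 \<Longrightarrow> x' \<in> ball 0 1 \<Longrightarrow>
       \<bar>monomial \<alpha> x - monomial \<alpha> x'\<bar> \<le> D * norm (x - x' :: real^'n)"
proof
  show "0 \<le> real (\<Sum>i\<in>UNIV. \<alpha> i)" by (rule of_nat_0_le_iff)
  fix x x' :: "real^'n" assume x: "x \<in> ball 0 1" "x' \<in> ball 0 1"
  have c: "\<bar>x $ i\<bar> \<le> 1" "\<bar>x' $ i\<bar> \<le> 1" for i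
    using component_le_norm_cart[of x i] component_le_norm_cart[of x' i] x by auto
  have "\<bar>monomial \<alpha> x - monomial \<alpha> x'\<bar> \<le> (\<Sum>i\<in>UNIV. \<bar>(x $ i) ^ \<alpha> i - (x' $ i) ^ \<alpha> i\<bar>)"
    using norm_prod_diff[of UNIV "\<lambda>i. (x $ i) ^ \<alpha> i" "\<lambda>i. (x' $ i) ^ \<alpha> i"] c
    by (simp add: monomial_def power_abs power_le_one)
  also have "\<dots> \<le> (\<Sum>i\<in>UNIV. real (\<alpha> i) * norm (x - x'))"
  proof (rule sum_mono)
    fix i
    have "\<bar>(x $ i) ^ \<alpha> i - (x' $ i) ^ \<alpha> i\<bar> \<le> real (\<alpha> i) * \<bar>x $ i - x' $ i\<bar>"
      using norm_power_diff[of "x $ i" "x' $ i" "\<alpha> i"] c by simp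
    also have "\<dots> \<le> real (\<alpha> i) * norm (x - x')"
      using component_le_norm_cart[of "x - x'" i] by (intro mult_left_mono) auto
    finally show "\<bar>(x $ i) ^ \<alpha> i - (x' $ i) ^ \<alpha> i\<bar> \<le> real (\<alpha> i) * norm (x - x')" .
  qed
  finally show "\<bar>monomial \<alpha> x - monomial \<alpha> x'\<bar> \<le> real (\<Sum>i\<in>UNIV. \<alpha> i) * norm (x - x')"
    by (simp add: sum_distrib_right)
qed

text \<open>Monomials are bounded and Lipschitz on the unit ball. This lets a Taylor term of degree
  \<open>k\<close> be counted as remainder when the order of an expansion drops from
  \<open>Suc k\<close> to \<open>k\<close>.\<close>

lemma decaying_remainder_monomial:
  fixes c :: "real^'n \<Rightarrow> real"
  assumes c: "c \<in> borel_measurable borel" "\<And>y. 4 \<le> norm y \<Longrightarrow> \<bar>c y\<bar> \<le> C / norm y ^ k"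
  shows "decaying_remainder k (\<lambda>x y. monomial \<alpha> x * c y)"
proof -
  obtain D where D: "0 \<le> D" "\<And>x x'. x \<in> ball 0 1 \<Longrightarrow> x' \<in> ball 0 1 \<Longrightarrow>
       \<bar>monomial \<alpha> x - monomial \<alpha> x'\<bar> \<le> D * norm (x - x' :: real^'n)"
    using monomial_lipschitz by blast
  show ?thesis
  proof (rule decaying_remainderI[where C = C and D = "D * C"])
    fix x x' y :: "real^'n" assume x: "x \<in> ball 0 1"
    show "(\<lambda>y. indicat_real (- ball 0 4) y * (monomial \<alpha> x * c y)) \<in> borel_measurable borel"
      using c(1) by (intro borel_measurable_times borel_measurable_indicator) auto
    assume y: "4 \<le> norm y"
    have "\<bar>monomial \<alpha> x * c y\<bar> \<le> 1 * (C / norm y ^ k)"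
      unfolding abs_mult using monomial_bounded[OF x] c(2)[OF y] by (intro mult_mono) auto
    then show "\<bar>monomial \<alpha> x * c y\<bar> \<le> C / norm y ^ k" by simp
    assume x': "x' \<in> ball 0 1"
    have "\<bar>(monomial \<alpha> x - monomial \<alpha> x') * c y\<bar> \<le> (D * norm (x - x')) * (C / norm y ^ k)"
      unfolding abs_mult using D x x' c(2)[OF y] by (intro mult_mono) auto
    then show "\<bar>monomial \<alpha> x * c y - monomial \<alpha> x' * c y\<bar> \<le> D * C * norm (x - x') / norm y ^ k"
      unfolding left_diff_distrib by (simp add: mult_ac)
  qed
qed

lemma power_decay:
  fixes t :: real
  assumes "4 \<le> t" "0 \<le> C"
  shows "C / t ^ Suc k \<le> C / t ^ k"
proof (rule divide_left_mono)
  show "t ^ k \<le> t ^ Suc k" using assms by (intro power_increasing) auto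
qed (use assms in auto)

lemma decaying_remainder_mono:
  fixes \<psi> :: "real^'n \<Rightarrow> real^'n \<Rightarrow> real"
  assumes "decaying_remainder (Suc k) \<psi>"
  shows "decaying_remainder k \<psi>"
proof -
  obtain C where C: "0 \<le> C"
    "\<And>x y. x \<in> ball 0 1 \<Longrightarrow> 4 \<le> norm y \<Longrightarrow> \<bar>\<psi> x y\<bar> \<le> C / norm y ^ Suc k"
    "\<And>x x' y. x \<in> ball 0 1 \<Longrightarrow> x' \<in> ball 0 1 \<Longrightarrow> 4 \<le> norm y \<Longrightarrow>
        \<bar>\<psi> x y - \<psi> x' y\<bar> \<le> C * norm (x - x') / norm y ^ Suc k"
    by (rule decaying_remainderE[OF assms]) (rule that; blast)
  show ?thesis
  proof (rule decaying_remainderI[OF decaying_remainder_measurable[OF assms]])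
    fix x x' y :: "real^'n" assume x: "x \<in> ball 0 1" and y: "4 \<le> norm y"
    show "\<bar>\<psi> x y\<bar> \<le> C / norm y ^ k"
      using C(2)[OF x y] power_decay[OF y C(1)] by (rule order_trans)
    assume x': "x' \<in> ball 0 1"
    show "\<bar>\<psi> x y - \<psi> x' y\<bar> \<le> C * norm (x - x') / norm y ^ k"
      using C(3)[OF x x' y] by (rule order_trans) (rule power_decay[OF y], use C(1) in simp)
  qed
qed

lemma expandable_mono: "expandable (Suc k) K \<Longrightarrow> expandable k K"
proof (induction rule: expandable.induct)
  case (mono \<alpha> c C)
  show ?case
  proof (cases "(\<Sum>i\<in>UNIV. \<alpha> i) < k")
    case True
    then show ?thesis using mono by (intro expandable.mono) auto
  next
    case False
    then have "(\<Sum>i\<in>UNIV. \<alpha> i) = k" using mono(1) by simp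
    then show ?thesis using mono by (intro expandable.rem decaying_remainder_monomial[where C = C]) auto
  qed
qed (auto intro: expandable.intros decaying_remainder_mono)

text \<open>Each new factor \<open>x $ i\<close> comes with a coefficient of decay
  \<open>1 / norm y\<close>, so monomial terms keep their grading. In the remainder the coordinate
  is merely bounded by one, and the extra decay is supplied by \<open>c\<close>.\<close>

lemma expandable_coord:
  fixes K :: "real^'n \<Rightarrow> real^'n \<Rightarrow> real"
  assumes K: "expandable k K" and c: "c \<in> borel_measurable borel" "\<And>y. 4 \<le> norm y \<Longrightarrow> \<bar>c y\<bar> \<le> B / norm y"
  shows "expandable (Suc k) (\<lambda>x y. x $ i * c y * K x y)"
  using K
proof (induction rule: expandable.induct)
  case (mono \<alpha> d C)
  have "expandable (Suc k) (\<lambda>x y. monomial (\<alpha>(i := Suc (\<alpha> i))) x * (c y * d y))"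
  proof (rule expandable.mono)
    show "(\<lambda>y. c y * d y) \<in> borel_measurable borel" using c(1) mono(2) by (rule borel_measurable_times)
    show "\<bar>c y * d y\<bar> \<le> (B * C) / norm y ^ (\<Sum>j\<in>UNIV. (\<alpha>(i := Suc (\<alpha> i))) j)" if "4 \<le> norm y" for y
    proof -
      have "\<bar>c y * d y\<bar> \<le> (B / norm y) * (C / norm y ^ (\<Sum>j\<in>UNIV. \<alpha> j))"
        unfolding abs_mult using c(2)[OF that] mono(3)[OF that] by (intro mult_mono) auto
      then show ?thesis unfolding degree_Suc by simp
    qed
  qed (use mono(1) in \<open>simp only: degree_Suc Suc_less_eq\<close>)
  then show ?case by (simp add: monomial_Suc mult_ac)
next
  case (rem \<psi>)
  obtain C where C: "0 \<le> C"
    "\<And>x y. x \<in> ball 0 1 \<Longrightarrow> 4 \<le> norm y \<Longrightarrow> \<bar>\<psi> x y\<bar> \<le> C / norm y ^ k"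
    "\<And>x x' y. x \<in> ball 0 1 \<Longrightarrow> x' \<in> ball 0 1 \<Longrightarrow> 4 \<le> norm y \<Longrightarrow>
        \<bar>\<psi> x y - \<psi> x' y\<bar> \<le> C * norm (x - x') / norm y ^ k"
    by (rule decaying_remainderE[OF rem]) (rule that; blast)
  have comp: "\<bar>x $ i\<bar> \<le> 1" if "x \<in> ball 0 1" for x :: "real^'n"
    using component_le_norm_cart[of x i] that by simp
  show ?case
  proof (rule expandable.rem, rule decaying_remainderI[where C = "B * C" and D = "2 * B * C"])
    fix x x' y :: "real^'n" assume x: "x \<in> ball 0 1"
    have "(\<lambda>y. x $ i * c y * (indicat_real (- ball 0 4) y * \<psi> x y)) \<in> borel_measurable borel"
      using c(1) by (intro borel_measurable_times decaying_remainder_measurable[OF rem x]) auto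
    then show "(\<lambda>y. indicat_real (- ball 0 4) y * (x $ i * c y * \<psi> x y)) \<in> borel_measurable borel"
      by (simp add: mult_ac)
    assume y: "4 \<le> norm y"
    have "\<bar>x $ i * c y * \<psi> x y\<bar> \<le> 1 * (B / norm y) * (C / norm y ^ k)"
      unfolding abs_mult using comp[OF x] c(2)[OF y] C(2)[OF x y] order_trans[OF abs_ge_zero c(2)[OF y]]
      by (intro mult_mono) auto
    then show "\<bar>x $ i * c y * \<psi> x y\<bar> \<le> B * C / norm y ^ Suc k" by simp
    assume x': "x' \<in> ball 0 1"
    have "x $ i * \<psi> x y - x' $ i * \<psi> x' y = (x - x') $ i * \<psi> x y + x' $ i * (\<psi> x y - \<psi> x' y)"
      by (simp add: algebra_simps)
    also have "\<bar>\<dots>\<bar> \<le> \<bar>(x - x') $ i\<bar> * \<bar>\<psi> x y\<bar> + \<bar>x' $ i\<bar> * \<bar>\<psi> x y - \<psi> x' y\<bar>"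
      by (rule order_trans[OF abs_triangle_ineq]) (simp add: abs_mult)
    also have "\<dots> \<le> norm (x - x') * (C / norm y ^ k) + 1 * (C * norm (x - x') / norm y ^ k)"
      using C(1) by (intro add_mono mult_mono component_le_norm_cart comp x' C(2,3) x y) auto
    also have "\<dots> = 2 * C * norm (x - x') / norm y ^ k" by simp
    finally have "\<bar>c y\<bar> * \<bar>x $ i * \<psi> x y - x' $ i * \<psi> x' y\<bar> \<le> (B / norm y) * (2 * C * norm (x - x') / norm y ^ k)"
      using c(2)[OF y] order_trans[OF abs_ge_zero c(2)[OF y]] by (intro mult_mono) auto
    then show "\<bar>x $ i * c y * \<psi> x y - x' $ i * c y * \<psi> x' y\<bar> \<le> 2 * B * C * norm (x - x') / norm y ^ Suc k"
      unfolding abs_mult[symmetric] by (simp add: algebra_simps)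
  qed
next
  case (add K L)
  from expandable.add[OF add.IH] show ?case by (simp add: distrib_left)
qed

lemma expandable_zero: "expandable k (\<lambda>x y. 0)"
  by (rule expandable.rem, rule decaying_remainderI[where C = 0 and D = 0]) auto

lemma expandable_sum:
  assumes "finite I" "\<And>i. i \<in> I \<Longrightarrow> expandable k (K i)"
  shows "expandable k (\<lambda>x y. \<Sum>i\<in>I. K i x y)"
  using assms by (induction I rule: finite_induct) (auto intro: expandable_zero expandable.add)

text \<open>The difference \<open>L - K\<close> is zero wherever a remainder is constrained, so it
  is itself a remainder, with constant zero.\<close>

lemma expandable_cong:
  fixes K L :: "real^'n \<Rightarrow> real^'n \<Rightarrow> real"
  assumes K: "expandable k K" and eq: "\<And>x y. x \<in> ball 0 1 \<Longrightarrow> 4 \<le> norm y \<Longrightarrow> K x y = L x y"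
  shows "expandable k L"
proof -
  have "decaying_remainder k (\<lambda>x y. L x y - K x y)"
  proof (rule decaying_remainderI[where C = 0 and D = 0])
    fix x :: "real^'n" assume "x \<in> ball 0 1"
    then have "indicat_real (- ball 0 4) y * (L x y - K x y) = 0" for y
      by (cases "4 \<le> norm y") (simp_all add: eq)
    then show "(\<lambda>y. indicat_real (- ball 0 4) y * (L x y - K x y)) \<in> borel_measurable borel"
      by (simp only:) simp
  qed (use eq in auto)
  from expandable.add[OF K expandable.rem[OF this]] show ?thesis by simp
qed

text \<open>The \<open>t\<close> with \<open>norm (x - y) ^ 2 = norm y ^ 2 * (1 + t)\<close>. The
  kernel is then \<open>norm y powr (- a)\<close> times a power series in \<open>t\<close>, and
  \<open>t\<close> is of order \<open>1 / norm y\<close>.\<close>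

definition kernel_variable :: "real^'n \<Rightarrow> real^'n \<Rightarrow> real" where
  "kernel_variable x y = (norm x ^ 2 - 2 * (x \<bullet> y)) / norm y ^ 2"

lemma norm_diff_kernel_variable:
  assumes "y \<noteq> 0"
  shows "norm (x - y) ^ 2 = norm y ^ 2 * (1 + kernel_variable x y)"
proof -
  have "norm (x - y) ^ 2 = norm y ^ 2 + (norm x ^ 2 - 2 * (x \<bullet> y))"
    by (simp add: power2_norm_eq_inner inner_diff inner_commute)
  then show ?thesis using assms by (simp add: kernel_variable_def distrib_left)
qed

text \<open>The numerator is at most \<open>1 + 2 * norm y\<close>, and
  \<open>(1 + 2 * norm y) / norm y ^ 2\<close> decreases to the right of 4, where it equals 9/16.
  Being below one, this puts the variable inside the disc of convergence.\<close>

lemma kernel_variable_bound: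
  assumes x: "x \<in> ball 0 1" and y: "4 \<le> norm y"
  shows "\<bar>kernel_variable x y\<bar> \<le> 9 / 16"
proof -
  have "\<bar>norm x ^ 2 - 2 * (x \<bullet> y)\<bar> \<le> norm x ^ 2 + 2 * \<bar>x \<bullet> y\<bar>"
    using abs_triangle_ineq4[of "norm x ^ 2" "2 * (x \<bullet> y)"] by (simp add: abs_mult)
  also have "\<dots> \<le> 1 + 2 * norm y"
    using x Cauchy_Schwarz_ineq2[of x y] mult_right_mono[of "norm x" 1 "norm y"]
    by (intro add_mono) (auto simp: power_le_one)
  also have "\<dots> \<le> 9 / 16 * norm y ^ 2"
  proof -
    \<comment> \<open>The product is \<open>9 * norm y ^ 2 - 32 * norm y - 16\<close>, sixteen times
      the difference of the two sides.\<close>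
    have "0 \<le> (norm y - 4) * (9 * norm y + 4)" using y by simp
    then show ?thesis by (simp add: algebra_simps power2_eq_square)
  qed
  finally have "\<bar>norm x ^ 2 - 2 * (x \<bullet> y)\<bar> / norm y ^ 2 \<le> 9 / 16"
    using y by (subst pos_divide_le_eq) auto
  then show ?thesis by (simp add: kernel_variable_def)
qed

lemma kernel_variable_lipschitz:
  assumes x: "x \<in> ball 0 1" "x' \<in> ball 0 1" and y: "4 \<le> norm y"
  shows "\<bar>kernel_variable x y - kernel_variable x' y\<bar> \<le> norm (x - x')"
proof -
  have "norm x ^ 2 - norm x' ^ 2 = (x - x') \<bullet> (x + x')"
    by (simp add: power2_norm_eq_inner inner_diff inner_add inner_commute)
  then have "kernel_variable x y - kernel_variable x' y = ((x - x') \<bullet> (x + x' - 2 *\<^sub>R y)) / norm y ^ 2"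
    by (simp add: kernel_variable_def diff_divide_distrib[symmetric] inner_diff inner_add algebra_simps)
  also have "\<bar>\<dots>\<bar> \<le> (norm (x - x') * norm (x + x' - 2 *\<^sub>R y)) / norm y ^ 2"
    using Cauchy_Schwarz_ineq2[of "x - x'" "x + x' - 2 *\<^sub>R y"] by (simp add: divide_right_mono)
  also have "\<dots> \<le> (norm (x - x') * norm y ^ 2) / norm y ^ 2"
  proof (intro divide_right_mono mult_left_mono)
    have "norm (x + x' - 2 *\<^sub>R y) \<le> norm x + norm x' + 2 * norm y"
      using norm_triangle_ineq4[of "x + x'" "2 *\<^sub>R y"] norm_triangle_ineq[of x x'] by simp
    also have "\<dots> \<le> 4 * norm y" using x y by simp
    also have "\<dots> \<le> norm y ^ 2" using mult_right_mono[OF y norm_ge_zero[of y]] by (simp add: power2_eq_square)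
    finally show "norm (x + x' - 2 *\<^sub>R y) \<le> norm y ^ 2" .
  qed auto
  also have "\<dots> = norm (x - x')" using y by auto
  finally show ?thesis .
qed

text \<open>Coordinatewise, the linear part of the variable gains exactly one order. The quadratic
  part consists of two factors \<open>x $ i / norm y\<close> and gains two, one of which is given
  up.\<close>

lemma expandable_kernel_variable:
  fixes K :: "real^'n \<Rightarrow> real^'n \<Rightarrow> real"
  assumes K: "expandable k K"
  shows "expandable (Suc k) (\<lambda>x y. kernel_variable x y * K x y)"
proof -
  have m: "(\<lambda>y::real^'n. 1 / norm y) \<in> borel_measurable borel" by measurable
  have m': "(\<lambda>y::real^'n. - 2 * y $ i / norm y ^ 2) \<in> borel_measurable borel" for i
    by (intro borel_measurable_divide borel_measurable_times borel_measurable_power borel_measurable_norm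
        borel_measurable_continuous_onI continuous_intros)
  have 1: "expandable (Suc k) (\<lambda>x y. x $ i * (1 / norm y) * (x $ i * (1 / norm y) * K x y))" for i
    by (intro expandable_mono[OF expandable_coord[OF expandable_coord[OF K m] m]]) (auto intro: order_refl)
  have 2: "expandable (Suc k) (\<lambda>x y. x $ i * (- 2 * y $ i / norm y ^ 2) * K x y)" for i
  proof (rule expandable_coord[OF K m', where B = 2])
    fix y :: "real^'n" assume "4 \<le> norm y"
    then have "0 < norm y" by linarith
    then show "\<bar>- 2 * y $ i / norm y ^ 2\<bar> \<le> 2 / norm y"
      using component_le_norm_cart[of y i] by (simp add: abs_mult field_simps power2_eq_square)
  qed
  have "expandable (Suc k) (\<lambda>x y. \<Sum>i\<in>UNIV. x $ i * (1 / norm y) * (x $ i * (1 / norm y) * K x y)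
      + x $ i * (- 2 * y $ i / norm y ^ 2) * K x y)"
    by (intro expandable_sum expandable.add 1 2) simp
  then show ?thesis
  proof (rule expandable_cong)
    fix x y :: "real^'n"
    have "norm x ^ 2 - 2 * (x \<bullet> y) = (\<Sum>i\<in>UNIV. x $ i * x $ i - 2 * (x $ i * y $ i))"
      unfolding power2_norm_eq_inner by (simp add: inner_vec_def sum_subtractf sum_distrib_left)
    then have "kernel_variable x y * K x y
        = (\<Sum>i\<in>UNIV. (x $ i * x $ i - 2 * (x $ i * y $ i)) / norm y ^ 2 * K x y)"
      by (simp only: kernel_variable_def sum_divide_distrib sum_distrib_right)
    also have "\<dots> = (\<Sum>i\<in>UNIV. x $ i * (1 / norm y) * (x $ i * (1 / norm y) * K x y)
      + x $ i * (- 2 * y $ i / norm y ^ 2) * K x y)"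
      by (rule sum.cong[OF refl]) (simp add: power2_eq_square diff_divide_distrib algebra_simps)
    finally show "(\<Sum>i\<in>UNIV. x $ i * (1 / norm y) * (x $ i * (1 / norm y) * K x y)
      + x $ i * (- 2 * y $ i / norm y ^ 2) * K x y) = kernel_variable x y * K x y" ..
  qed
qed

text \<open>The differentiated series is continuous inside the disc of convergence, hence bounded on
  the compact interval, and the mean value inequality applies.\<close>

lemma powser_lipschitz:
  fixes h :: "real \<Rightarrow> real"
  assumes h: "\<And>t. \<bar>t\<bar> < 1 \<Longrightarrow> (\<lambda>j. b j * t ^ j) sums h t" and r: "0 < r" "r < 1"
  obtains D where "0 \<le> D" "\<And>t t'. \<bar>t\<bar> \<le> r \<Longrightarrow> \<bar>t'\<bar> \<le> r \<Longrightarrow> \<bar>h t - h t'\<bar> \<le> D * \<bar>t - t'\<bar>"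
proof -
  define h' where "h' t = (\<Sum>j. diffs b j * t ^ j)" for t
  have sm: "summable (\<lambda>j. b j * t ^ j)" if "\<bar>t\<bar> < 1" for t using h[OF that] by (rule sums_summable)
  have h_eq: "h t = (\<Sum>j. b j * t ^ j)" if "\<bar>t\<bar> < 1" for t using h[OF that] by (rule sums_unique)
  \<comment> \<open>A point strictly between \<open>r\<close> and 1: convergence of the
    differentiated series at \<open>q\<close> makes its sum continuous on the whole closed interval
    of radius \<open>r\<close>.\<close>
  define q where "q = (r + 1) / 2"
  have q: "r < q" "q < 1" "0 < q" using r by (auto simp: q_def)
  have sd: "summable (\<lambda>j. diffs b j * q ^ j)"
    by (rule termdiff_converges[where K = 1]) (use q sm in auto)
  have der: "(h has_field_derivative h' t) (at t within {-r..r})" if "t \<in> {-r..r}" for t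
  proof -
    have t: "\<bar>t\<bar> < q" using that q by auto
    have "((\<lambda>t. \<Sum>j. b j * t ^ j) has_field_derivative h' t) (at t)"
      unfolding h'_def by (rule termdiffs_strong[where K = q]) (use sm[of q] q t in auto)
    then have "((\<lambda>t. \<Sum>j. b j * t ^ j) has_field_derivative h' t) (at t within {-r..r})"
      by (rule has_field_derivative_at_within)
    then show ?thesis
      by (rule has_field_derivative_transform_within[where d = 1]) (use that r h_eq in auto)
  qed
  have "continuous_on {-r..r} h'"
  proof (intro continuous_at_imp_continuous_on ballI)
    fix t assume "t \<in> {-r..r}"
    then have "\<bar>t\<bar> < q" using q by auto
    then show "isCont h' t"
      unfolding h'_def[abs_def] by (intro isCont_powser[OF sd]) (use q in auto)
  qed
  then have "bounded (h' ` {-r..r})"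
    by (intro compact_imp_bounded compact_continuous_image) auto
  then obtain D where "\<forall>v\<in>h' ` {-r..r}. norm v \<le> D" unfolding bounded_iff by blast
  then have D: "norm (h' t) \<le> D" if "t \<in> {-r..r}" for t using that by blast
  show thesis
  proof (rule that[of D])
    show "0 \<le> D" using order_trans[OF norm_ge_zero D[of 0]] r by simp
    fix t t' :: real assume "\<bar>t\<bar> \<le> r" "\<bar>t'\<bar> \<le> r"
    then have "norm (h t - h t') \<le> D * norm (t - t')"
      by (intro field_differentiable_bound[of "{-r..r}" h h'] der D) auto
    then show "\<bar>h t - h t'\<bar> \<le> D * \<bar>t - t'\<bar>" by simp
  qed
qed

lemma kernel_variable_measurable:
  "(\<lambda>y. kernel_variable x y) \<in> borel_measurable borel"
  unfolding kernel_variable_def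
  by (intro borel_measurable_divide borel_measurable_diff borel_measurable_times borel_measurable_inner
      borel_measurable_power borel_measurable_norm measurable_ident measurable_const) simp_all

text \<open>Writing \<open>h t = h 0 + t * h\<^sub>1 t\<close>, the variable \<open>t\<close> gains one order of decay, so the order of the
  expansion of \<open>h\<close> exceeds that of \<open>h\<^sub>1\<close> by one.\<close>

lemma expandable_powser:
  fixes h :: "real \<Rightarrow> real"
  assumes "\<And>t. \<bar>t\<bar> < 1 \<Longrightarrow> (\<lambda>j. b j * t ^ j) sums h t"
  shows "expandable k (\<lambda>(x::real^'n) y. h (kernel_variable x y))"
  using assms
proof (induction k arbitrary: b h)
  case 0
  obtain D where D: "0 \<le> D" "\<And>t t'. \<bar>t\<bar> \<le> 9/16 \<Longrightarrow> \<bar>t'\<bar> \<le> 9/16 \<Longrightarrow> \<bar>h t - h t'\<bar> \<le> D * \<bar>t - t'\<bar>"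
    by (rule powser_lipschitz[where b = b and h = h and r = "9/16"]) (use 0 in auto)
  show ?case
  proof (rule expandable.rem, rule decaying_remainderI[where C = "D + \<bar>h 0\<bar>" and D = D])
    fix x x' y :: "real^'n" assume x: "x \<in> ball 0 1"
    show "(\<lambda>y. indicat_real (- ball 0 4) y * h (kernel_variable x y)) \<in> borel_measurable borel"
    \<comment> \<open>Nothing is known of \<open>h\<close> beyond the series on the open unit
      interval, so measurability is obtained from the partial sums, which converge wherever the
      indicator is nonzero.\<close>
    proof (rule borel_measurable_LIMSEQ_real)
      fix y :: "real^'n"
      show "(\<lambda>n. indicat_real (- ball 0 4) y * (\<Sum>j<n. b j * kernel_variable x y ^ j))
          \<longlonglongrightarrow> indicat_real (- ball 0 4) y * h (kernel_variable x y)"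
      proof (cases "4 \<le> norm y")
        case True
        then have "\<bar>kernel_variable x y\<bar> < 1" using kernel_variable_bound[OF x True] by simp
        from 0[OF this] show ?thesis unfolding sums_def by (intro tendsto_mult_left)
      qed simp
      show "(\<lambda>y. indicat_real (- ball 0 4) y * (\<Sum>j<n. b j * kernel_variable x y ^ j)) \<in> borel_measurable borel" for n
        by (intro borel_measurable_times borel_measurable_indicator borel_measurable_sum
            borel_measurable_power kernel_variable_measurable) auto
    qed
    assume y: "4 \<le> norm y"
    note t = kernel_variable_bound[OF x y]
    have "\<bar>h (kernel_variable x y)\<bar> \<le> \<bar>h (kernel_variable x y) - h 0\<bar> + \<bar>h 0\<bar>" by simp
    also have "\<bar>h (kernel_variable x y) - h 0\<bar> \<le> D * \<bar>kernel_variable x y - 0\<bar>" using t by (intro D) auto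
    also have "\<dots> \<le> D * 1" using t D(1) by (intro mult_left_mono) auto
    finally show "\<bar>h (kernel_variable x y)\<bar> \<le> (D + \<bar>h 0\<bar>) / norm y ^ 0" by simp
    assume x': "x' \<in> ball 0 1"
    have "\<bar>h (kernel_variable x y) - h (kernel_variable x' y)\<bar> \<le> D * \<bar>kernel_variable x y - kernel_variable x' y\<bar>"
      using t kernel_variable_bound[OF x' y] by (rule D)
    also have "\<dots> \<le> D * norm (x - x')"
      using D(1) kernel_variable_lipschitz[OF x x' y] by (rule mult_left_mono[rotated])
    finally show "\<bar>h (kernel_variable x y) - h (kernel_variable x' y)\<bar> \<le> D * norm (x - x') / norm y ^ 0" by simp
  qed
next
  case (Suc k)
  define h1 where "h1 t = (\<Sum>j. b (Suc j) * t ^ j)" for t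
  have sm: "summable (\<lambda>j. b (Suc j) * t ^ j)" if "\<bar>t\<bar> < 1" for t
    using sums_summable[OF Suc.prems[OF that]] by (subst (asm) summable_powser_split_head[symmetric])
  have "expandable k (\<lambda>(x::real^'n) y. h1 (kernel_variable x y))"
    by (rule Suc.IH[where b = "\<lambda>j. b (Suc j)"]) (use sm in \<open>simp add: h1_def summable_sums\<close>)
  note 1 = expandable_kernel_variable[OF this]
  have 2: "expandable (Suc k) (\<lambda>(x::real^'n) y. monomial (\<lambda>_. 0) x * b 0)"
    by (rule expandable.mono[where C = "\<bar>b 0\<bar>"]) auto
  show ?case
  proof (rule expandable_cong[OF expandable.add[OF 2 1]])
    fix x y :: "real^'n" assume xy: "x \<in> ball 0 1" "4 \<le> norm y"
    let ?t = "kernel_variable x y"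
    have t: "\<bar>?t\<bar> < 1" using kernel_variable_bound[OF xy] by simp
    have "h ?t = (\<Sum>j. b j * ?t ^ j)" using Suc.prems[OF t] by (rule sums_unique)
    also have "\<dots> = b 0 + (\<Sum>j. b (Suc j) * ?t ^ j) * ?t"
      using sums_summable[OF Suc.prems[OF t]] by (rule powser_split_head)
    finally show "monomial (\<lambda>_. 0) x * b 0 + ?t * h1 ?t = h ?t"
      by (simp add: h1_def monomial_def mult.commute)
  qed
qed

section \<open>Integrals against expandable kernels\<close>

lemma integrable_bounded_mult:
  fixes q g :: "real^'n \<Rightarrow> real"
  assumes q: "integrable lebesgue q" "\<And>y. y \<in> ball 0 4 \<Longrightarrow> q y = 0"
    and g: "(\<lambda>y. indicat_real (- ball 0 4) y * g y) \<in> borel_measurable lebesgue"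
      "\<And>y. 4 \<le> norm y \<Longrightarrow> \<bar>g y\<bar> \<le> C"
  shows "integrable lebesgue (\<lambda>y. g y * q y)"
proof (rule Bochner_Integration.integrable_bound[where f = "\<lambda>y. C * q y"])
  show "integrable lebesgue (\<lambda>y. C * q y)" using q(1) by (rule integrable_mult_right)
  have eq: "g y * q y = indicat_real (- ball 0 4) y * g y * q y" for y
    using q(2)[of y] by (auto simp: indicator_def)
  show "(\<lambda>y. g y * q y) \<in> borel_measurable lebesgue"
    using borel_measurable_times[OF g(1) borel_measurable_integrable[OF q(1)]] by (simp only: eq[symmetric])
  have "\<bar>g y * q y\<bar> \<le> \<bar>C * q y\<bar>" for y
  proof (cases "4 \<le> norm y")
    case True
    then show ?thesis using g(2)[OF True] by (simp add: abs_mult mult_right_mono)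
  qed (use q(2)[of y] in simp)
  then show "AE y in lebesgue. norm (g y * q y) \<le> norm (C * q y)" by simp
qed

lemma power_decay_le:
  fixes t :: real
  assumes "4 \<le> t" "0 \<le> C"
  shows "C / t ^ k \<le> C"
proof -
  have "1 \<le> t ^ k" using assms by (intro one_le_power) auto
  then show ?thesis using assms by (simp add: divide_le_eq mult_le_cancel_left1)
qed

text \<open>The order of quantifiers matters: one \<open>\<psi>\<close> serves every
  \<open>q\<close>, and only the polynomial depends on \<open>q\<close>. This is what makes
  remainders at different radii and for different functions comparable.\<close>

definition integral_expansion ::
  "nat \<Rightarrow> (real^'n \<Rightarrow> real^'n \<Rightarrow> real) \<Rightarrow> (real^'n \<Rightarrow> real^'n \<Rightarrow> real) \<Rightarrow> bool" where
  "integral_expansion k K \<psi> \<longleftrightarrow> (\<forall>q. integrable lebesgue q \<and> (\<forall>y\<in>ball 0 4. q y = 0) \<longrightarrow>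
      (\<exists>P. polynomial_degree_less k P \<and> (\<forall>x\<in>ball 0 1.
         integrable lebesgue (\<lambda>y. K x y * q y) \<and> integrable lebesgue (\<lambda>y. \<psi> x y * q y) \<and>
         (LINT y|lebesgue. K x y * q y) = P x + (LINT y|lebesgue. \<psi> x y * q y))))"

lemma expandable_integral:
  fixes K :: "real^'n \<Rightarrow> real^'n \<Rightarrow> real"
  assumes "expandable k K"
  shows "\<exists>\<psi>. decaying_remainder k \<psi> \<and> integral_expansion k K \<psi>"
  using assms
proof (induction rule: expandable.induct)
  case (mono \<alpha> c C)
  show ?case
    unfolding integral_expansion_def
  proof (intro exI[of _ "\<lambda>x y. 0"] conjI allI impI)
    show "decaying_remainder k (\<lambda>x y :: real^'n. 0)" by (rule decaying_remainderI[where C = 0 and D = 0]) auto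
    fix q :: "real^'n \<Rightarrow> real" assume q: "integrable lebesgue q \<and> (\<forall>y\<in>ball 0 4. q y = 0)"
    \<comment> \<open>The sign of \<open>C\<close> is read off from the decay hypothesis at a vector
      of norm 4.\<close>
    have C: "0 \<le> C"
    proof -
      let ?y = "4 *\<^sub>R axis undefined 1 :: real^'n"
      have "norm ?y = 4" by simp
      then have "0 \<le> C / norm ?y ^ (\<Sum>i\<in>UNIV. \<alpha> i)"
        by (intro order_trans[OF abs_ge_zero mono(3)]) simp
      moreover have "0 < norm ?y ^ (\<Sum>i\<in>UNIV. \<alpha> i)" using \<open>norm ?y = 4\<close> by simp
      ultimately show ?thesis by (metis divide_neg_pos not_le)
    qed
    have cq: "integrable lebesgue (\<lambda>y. c y * q y)"
    proof (rule integrable_bounded_mult[where C = C])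
      show "(\<lambda>y. indicat_real (- ball 0 4) y * c y) \<in> borel_measurable lebesgue"
        by (intro borel_measurable_lebesgue_borel borel_measurable_times borel_measurable_indicator mono(2)) auto
      show "\<bar>c y\<bar> \<le> C" if "4 \<le> norm y" for y
        using mono(3)[OF that] power_decay_le[OF that C] by (rule order_trans)
    qed (use q in auto)
    show "\<exists>P. polynomial_degree_less k P \<and> (\<forall>x\<in>ball 0 1.
         integrable lebesgue (\<lambda>y. monomial \<alpha> x * c y * q y) \<and> integrable lebesgue (\<lambda>y. 0 * q y) \<and>
         (LINT y|lebesgue. monomial \<alpha> x * c y * q y) = P x + (LINT y|lebesgue. 0 * q y))"
    proof (intro exI[of _ "\<lambda>x. (LINT y|lebesgue. c y * q y) * monomial \<alpha> x"] conjI ballI)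
      show "polynomial_degree_less k (\<lambda>x. (LINT y|lebesgue. c y * q y) * monomial \<alpha> x)"
        by (rule polynomial_degree_less_monomial[OF mono(1)])
      fix x :: "real^'n"
      show "integrable lebesgue (\<lambda>y. monomial \<alpha> x * c y * q y)"
        unfolding mult.assoc using cq by (rule integrable_mult_right)
      have "(LINT y|lebesgue. monomial \<alpha> x * c y * q y) = monomial \<alpha> x * (LINT y|lebesgue. c y * q y)"
        unfolding mult.assoc by (rule integral_mult_right_zero)
      then show "(LINT y|lebesgue. monomial \<alpha> x * c y * q y)
          = (LINT y|lebesgue. c y * q y) * monomial \<alpha> x + (LINT y|lebesgue. 0 * q y)"
        by (simp add: mult.commute)
    qed simp
  qed
next
  case (rem \<psi>)
  obtain C where C: "0 \<le> C" "\<And>x y. x \<in> ball 0 1 \<Longrightarrow> 4 \<le> norm y \<Longrightarrow> \<bar>\<psi> x y\<bar> \<le> C / norm y ^ k"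
    by (rule decaying_remainderE[OF rem]) (rule that; blast)
  have int: "integrable lebesgue (\<lambda>y. \<psi> x y * q y)"
    if "integrable lebesgue q \<and> (\<forall>y\<in>ball 0 4. q y = 0)" "x \<in> ball 0 1" for q x
  proof (rule integrable_bounded_mult[where C = C])
    show "(\<lambda>y. indicat_real (- ball 0 4) y * \<psi> x y) \<in> borel_measurable lebesgue"
      by (intro borel_measurable_lebesgue_borel decaying_remainder_measurable[OF rem that(2)])
    show "\<bar>\<psi> x y\<bar> \<le> C" if "4 \<le> norm y" for y
      using C(2)[OF \<open>x \<in> ball 0 1\<close> that] power_decay_le[OF that C(1)] by (rule order_trans)
  qed (use that in auto)
  show ?case
    unfolding integral_expansion_def
    by (intro exI[of _ \<psi>] conjI allI impI rem exI[of _ "\<lambda>x. 0"] polynomial_degree_less_zero ballI)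
       (simp_all add: int)
next
  case (add K L)
  obtain \<psi> where K: "decaying_remainder k \<psi>" "integral_expansion k K \<psi>"
    using add.IH(1) by (elim exE conjE)
  obtain \<xi> where L: "decaying_remainder k \<xi>" "integral_expansion k L \<xi>"
    using add.IH(2) by (elim exE conjE)
  show ?case
    unfolding integral_expansion_def
  proof (intro exI[of _ "\<lambda>x y. \<psi> x y + \<xi> x y"] conjI allI impI)
    obtain C where C: "0 \<le> C"
      "\<And>x y. x \<in> ball 0 1 \<Longrightarrow> 4 \<le> norm y \<Longrightarrow> \<bar>\<psi> x y\<bar> \<le> C / norm y ^ k"
      "\<And>x x' y. x \<in> ball 0 1 \<Longrightarrow> x' \<in> ball 0 1 \<Longrightarrow> 4 \<le> norm y \<Longrightarrow>
        \<bar>\<psi> x y - \<psi> x' y\<bar> \<le> C * norm (x - x') / norm y ^ k"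
      by (rule decaying_remainderE[OF K(1)]) (rule that; blast)
    obtain D where D: "0 \<le> D"
      "\<And>x y. x \<in> ball 0 1 \<Longrightarrow> 4 \<le> norm y \<Longrightarrow> \<bar>\<xi> x y\<bar> \<le> D / norm y ^ k"
      "\<And>x x' y. x \<in> ball 0 1 \<Longrightarrow> x' \<in> ball 0 1 \<Longrightarrow> 4 \<le> norm y \<Longrightarrow>
        \<bar>\<xi> x y - \<xi> x' y\<bar> \<le> D * norm (x - x') / norm y ^ k"
      by (rule decaying_remainderE[OF L(1)]) (rule that; blast)
    show "decaying_remainder k (\<lambda>x y. \<psi> x y + \<xi> x y)"
    proof (rule decaying_remainderI[where C = "C + D" and D = "C + D"])
      fix x x' y :: "real^'n" assume x: "x \<in> ball 0 1"
      show "(\<lambda>y. indicat_real (- ball 0 4) y * (\<psi> x y + \<xi> x y)) \<in> borel_measurable borel"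
        unfolding distrib_left
        by (intro borel_measurable_add decaying_remainder_measurable[OF K(1) x] decaying_remainder_measurable[OF L(1) x])
      assume y: "4 \<le> norm y"
      show "\<bar>\<psi> x y + \<xi> x y\<bar> \<le> (C + D) / norm y ^ k"
        unfolding add_divide_distrib using C(2)[OF x y] D(2)[OF x y]
        by (intro order_trans[OF abs_triangle_ineq] add_mono)
      assume x': "x' \<in> ball 0 1"
      have "\<bar>(\<psi> x y - \<psi> x' y) + (\<xi> x y - \<xi> x' y)\<bar> \<le> C * norm (x - x') / norm y ^ k + D * norm (x - x') / norm y ^ k"
        using C(3)[OF x x' y] D(3)[OF x x' y]
        by (intro order_trans[OF abs_triangle_ineq] add_mono)
      then show "\<bar>\<psi> x y + \<xi> x y - (\<psi> x' y + \<xi> x' y)\<bar> \<le> (C + D) * norm (x - x') / norm y ^ k"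
        by (simp add: distrib_right add_divide_distrib algebra_simps)
    qed
    fix q :: "real^'n \<Rightarrow> real" assume q: "integrable lebesgue q \<and> (\<forall>y\<in>ball 0 4. q y = 0)"
    obtain P where P: "polynomial_degree_less k P" "\<forall>x\<in>ball 0 1.
         integrable lebesgue (\<lambda>y. K x y * q y) \<and> integrable lebesgue (\<lambda>y. \<psi> x y * q y) \<and>
         (LINT y|lebesgue. K x y * q y) = P x + (LINT y|lebesgue. \<psi> x y * q y)"
      using K(2) q unfolding integral_expansion_def by blast
    obtain Q where Q: "polynomial_degree_less k Q" "\<forall>x\<in>ball 0 1.
         integrable lebesgue (\<lambda>y. L x y * q y) \<and> integrable lebesgue (\<lambda>y. \<xi> x y * q y) \<and>
         (LINT y|lebesgue. L x y * q y) = Q x + (LINT y|lebesgue. \<xi> x y * q y)"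
      using L(2) q unfolding integral_expansion_def by blast
    show "\<exists>P. polynomial_degree_less k P \<and> (\<forall>x\<in>ball 0 1.
         integrable lebesgue (\<lambda>y. (K x y + L x y) * q y) \<and> integrable lebesgue (\<lambda>y. (\<psi> x y + \<xi> x y) * q y) \<and>
         (LINT y|lebesgue. (K x y + L x y) * q y) = P x + (LINT y|lebesgue. (\<psi> x y + \<xi> x y) * q y))"
    proof (intro exI[of _ "\<lambda>x. 1 * P x + 1 * Q x"] conjI ballI polynomial_degree_less_lincomb P(1) Q(1))
      fix x :: "real^'n" assume x: "x \<in> ball 0 1"
      note P' = P(2)[rule_format, OF x] and Q' = Q(2)[rule_format, OF x]
      show "integrable lebesgue (\<lambda>y. (K x y + L x y) * q y)" "integrable lebesgue (\<lambda>y. (\<psi> x y + \<xi> x y) * q y)"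
        unfolding distrib_right using P' Q' by (auto intro: Bochner_Integration.integrable_add)
      show "(LINT y|lebesgue. (K x y + L x y) * q y)
         = 1 * P x + 1 * Q x + (LINT y|lebesgue. (\<psi> x y + \<xi> x y) * q y)"
        unfolding distrib_right using P' Q' by (simp add: Bochner_Integration.integral_add)
    qed
  qed
qed

text \<open>\<open>\<kappa>\<close> is the kernel minus its Taylor polynomial in \<open>x\<close>
  for \<open>norm y \<ge> 4\<close>, extended by zero. Its decay matches the weight with exponent
  \<open>a + real k\<close>, so it can be integrated against functions whose tails are too large for
  the kernel itself.\<close>

definition kernel_remainder :: "real \<Rightarrow> nat \<Rightarrow> (real^'n \<Rightarrow> real^'n \<Rightarrow> real) \<Rightarrow> real \<Rightarrow> bool" where
  "kernel_remainder a k \<kappa> C \<longleftrightarrow> 0 \<le> C \<and>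
    (\<forall>x\<in>ball 0 1. \<kappa> x \<in> borel_measurable lebesgue) \<and>
    (\<forall>x\<in>ball 0 1. \<forall>y. \<bar>\<kappa> x y\<bar> \<le> C / (1 + norm y powr (a + real k))) \<and>
    (\<forall>x\<in>ball 0 1. \<forall>x'\<in>ball 0 1. \<forall>y. \<bar>\<kappa> x y - \<kappa> x' y\<bar> \<le> C * norm (x - x') / (1 + norm y powr (a + real k))) \<and>
    (\<forall>x\<in>ball 0 1. \<forall>y\<in>ball 0 4. \<kappa> x y = 0) \<and>
    (\<forall>q. integrable lebesgue q \<and> (\<forall>y\<in>ball 0 4. q y = 0) \<longrightarrow>
      (\<exists>P. polynomial_degree_less k P \<and> (\<forall>x\<in>ball 0 1.
         (LINT y|lebesgue. q y / norm (x - y) powr a) = P x + (LINT y|lebesgue. \<kappa> x y * q y))))"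

lemma kernel_remainder_exists:
  fixes a :: real
  assumes a: "0 < a"
  shows "\<exists>(\<kappa> :: real^'n \<Rightarrow> real^'n \<Rightarrow> real) C. kernel_remainder a k \<kappa> C"
proof -
  let ?h = "\<lambda>t::real. (1 + t) powr (- a / 2)"
  have "expandable k (\<lambda>(x::real^'n) y. ?h (kernel_variable x y))"
    by (rule expandable_powser[where b = "\<lambda>j. (- a / 2) gchoose j"]) (rule gen_binomial_real)
  from expandable_integral[OF this] obtain \<psi> :: "real^'n \<Rightarrow> real^'n \<Rightarrow> real"
    where \<psi>: "decaying_remainder k \<psi>" and rep: "integral_expansion k (\<lambda>x y. ?h (kernel_variable x y)) \<psi>"
    by (elim exE conjE)
  obtain C where C: "0 \<le> C"
    "\<And>x y. x \<in> ball 0 1 \<Longrightarrow> 4 \<le> norm y \<Longrightarrow> \<bar>\<psi> x y\<bar> \<le> C / norm y ^ k"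
    "\<And>x x' y. x \<in> ball 0 1 \<Longrightarrow> x' \<in> ball 0 1 \<Longrightarrow> 4 \<le> norm y \<Longrightarrow>
        \<bar>\<psi> x y - \<psi> x' y\<bar> \<le> C * norm (x - x') / norm y ^ k"
    by (rule decaying_remainderE[OF \<psi>]) (rule that; blast)
  define \<kappa> where "\<kappa> x y = indicat_real (- ball 0 4) y * \<psi> x y / norm y powr a" for x y
  \<comment> \<open>The factor 2 comes from \<open>1 / p \<le> 2 / (1 + p)\<close> for
    \<open>p \<ge> 1\<close>, which turns a pure power of \<open>norm y\<close> into the
    weight.\<close>
  have weight: "B / norm y ^ k / norm y powr a \<le> (2 * B) / (1 + norm y powr (a + real k))"
    if "4 \<le> norm y" "0 \<le> B" for y :: "real^'n" and B :: real
  proof -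
    have y: "0 < norm y" using that by linarith
    have eq: "norm y ^ k * norm y powr a = norm y powr (a + real k)"
      using y by (simp add: powr_add powr_realpow)
    have "1 \<le> norm y powr (a + real k)" using that a by (intro ge_one_powr_ge_zero) auto
    moreover have "1 / p \<le> 2 / (1 + p)" if "1 \<le> p" for p :: real
      using that by (auto simp: divide_simps)
    ultimately have "1 / norm y powr (a + real k) \<le> 2 / (1 + norm y powr (a + real k))"
      by blast
    from mult_left_mono[OF this that(2)] show ?thesis
      by (simp add: eq divide_divide_eq_left mult.commute)
  qed
  show ?thesis
    unfolding kernel_remainder_def
  proof (intro exI[of _ \<kappa>] exI[of _ "2 * C"] conjI ballI allI impI)
    show "0 \<le> 2 * C" using C(1) by simp
    fix x :: "real^'n" assume x: "x \<in> ball 0 1"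
    have "(\<lambda>y. indicat_real (- ball 0 4) y * \<psi> x y * (1 / norm (0 - y) powr a)) \<in> borel_measurable lebesgue"
      by (intro borel_measurable_times[OF borel_measurable_lebesgue_borel kernel_measurable]
          decaying_remainder_measurable[OF \<psi> x])
    then show "\<kappa> x \<in> borel_measurable lebesgue" by (simp add: \<kappa>_def[abs_def])
    fix y
    show "\<bar>\<kappa> x y\<bar> \<le> 2 * C / (1 + norm y powr (a + real k))"
    proof (cases "4 \<le> norm y")
      case True
      have "\<bar>\<kappa> x y\<bar> = \<bar>\<psi> x y\<bar> / norm y powr a" using True by (simp add: \<kappa>_def)
      also have "\<dots> \<le> C / norm y ^ k / norm y powr a" using C(2)[OF x True] by (intro divide_right_mono) auto
      also have "\<dots> \<le> 2 * C / (1 + norm y powr (a + real k))" by (rule weight[OF True C(1)])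
      finally show ?thesis .
    qed (use C(1) weight_pos[of y "a + real k"] in \<open>simp add: \<kappa>_def\<close>)
    show "\<kappa> x y = 0" if "y \<in> ball 0 4" using that by (simp add: \<kappa>_def)
  next
    fix x x' y :: "real^'n" assume x: "x \<in> ball 0 1" "x' \<in> ball 0 1"
    show "\<bar>\<kappa> x y - \<kappa> x' y\<bar> \<le> 2 * C * norm (x - x') / (1 + norm y powr (a + real k))"
    proof (cases "4 \<le> norm y")
      case True
      have "\<bar>\<kappa> x y - \<kappa> x' y\<bar> = \<bar>\<psi> x y - \<psi> x' y\<bar> / norm y powr a"
        using True by (simp add: \<kappa>_def diff_divide_distrib[symmetric])
      also have "\<dots> \<le> C * norm (x - x') / norm y ^ k / norm y powr a"
        using C(3)[OF x True] by (intro divide_right_mono) auto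
      also have "\<dots> \<le> 2 * (C * norm (x - x')) / (1 + norm y powr (a + real k))"
        using C(1) by (intro weight[OF True]) auto
      finally show ?thesis by (simp only: mult.assoc)
    qed (use C(1) weight_pos[of y "a + real k"] in \<open>simp add: \<kappa>_def\<close>)
  next
    fix q :: "real^'n \<Rightarrow> real" assume q: "integrable lebesgue q \<and> (\<forall>y\<in>ball 0 4. q y = 0)"
    \<comment> \<open>The factor \<open>norm y powr (- a)\<close> of the kernel is moved into the
      integrand, since only the power series in \<open>kernel_variable\<close> has been
      expanded.\<close>
    define q' where "q' y = 1 / norm (0 - y) powr a * q y" for y
    have q': "integrable lebesgue q'"
      unfolding q'_def[abs_def]
    proof (rule integrable_bounded_mult[where C = 1])
      show "(\<lambda>y::real^'n. indicat_real (- ball 0 4) y * (1 / norm (0 - y) powr a)) \<in> borel_measurable lebesgue"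
        by (intro borel_measurable_times borel_measurable_indicator kernel_measurable) auto
      fix y :: "real^'n" assume "4 \<le> norm y"
      then have "1 \<le> norm y powr a" using a by (intro ge_one_powr_ge_zero) auto
      then have "inverse (norm y powr a) \<le> 1" by (rule inverse_le_1_iff[THEN iffD2, OF disjI2])
      then show "\<bar>1 / norm (0 - y) powr a\<bar> \<le> 1" by (simp add: divide_inverse)
    qed (use q in auto)
    have q'0: "\<forall>y\<in>ball 0 4. q' y = 0" using q by (simp add: q'_def)
    obtain P where P: "polynomial_degree_less k P" "\<forall>x\<in>ball 0 1.
         (LINT y|lebesgue. ?h (kernel_variable x y) * q' y) = P x + (LINT y|lebesgue. \<psi> x y * q' y)"
      using rep q' q'0 unfolding integral_expansion_def by blast
    show "\<exists>P. polynomial_degree_less k P \<and> (\<forall>x\<in>ball 0 1.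
         (LINT y|lebesgue. q y / norm (x - y) powr a) = P x + (LINT y|lebesgue. \<kappa> x y * q y))"
    proof (intro exI[of _ P] conjI ballI P(1))
      fix x :: "real^'n" assume x: "x \<in> ball 0 1"
      have "q y / norm (x - y) powr a = ?h (kernel_variable x y) * q' y" for y
      proof (cases "4 \<le> norm y")
        case True
        let ?t = "kernel_variable x y"
        have y: "y \<noteq> 0" "0 < norm y" using True by auto
        have t: "0 < 1 + ?t" using kernel_variable_bound[OF x True] by (simp add: abs_le_iff)
        have "norm (x - y) powr a = (norm (x - y) powr 2) powr (a / 2)" unfolding powr_powr by simp
        also have "norm (x - y) powr 2 = norm y powr 2 * (1 + ?t)"
          using norm_diff_kernel_variable[OF y(1), of x] by simp
        also have "(norm y powr 2 * (1 + ?t)) powr (a / 2) = norm y powr a * (1 + ?t) powr (a / 2)"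
          unfolding powr_mult powr_powr by simp
        finally have e: "norm (x - y) powr a = norm y powr a * (1 + ?t) powr (a / 2)" .
        have m: "?h ?t = inverse ((1 + ?t) powr (a / 2))"
          unfolding minus_divide_left[symmetric] by (rule powr_minus)
        have "p / (A * B) = inverse B * (1 / A * p)" for A B p :: real
          by (simp add: divide_inverse mult_ac)
        then show ?thesis unfolding q'_def e m by simp
      qed (use q in \<open>simp add: q'_def\<close>)
      moreover have "\<kappa> x y * q y = \<psi> x y * q' y" for y
        using q by (cases "4 \<le> norm y") (simp_all add: \<kappa>_def q'_def)
      ultimately show "(LINT y|lebesgue. q y / norm (x - y) powr a) = P x + (LINT y|lebesgue. \<kappa> x y * q y)"
        using P(2) x by simp
    qed
  qed
qed

section \<open>Reduction to a fixed truncation radius\<close>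

lemma kernel_remainder_integral:
  assumes K: "kernel_remainder a k \<kappa> C" and q: "integrable lebesgue q" "\<And>y. y \<in> ball 0 4 \<Longrightarrow> q y = 0"
  shows "\<exists>P. polynomial_degree_less k P \<and> (\<forall>x\<in>ball 0 1.
     (LINT y|lebesgue. q y / norm (x - y) powr a) = P x + (LINT y|lebesgue. \<kappa> x y * q y))"
proof -
  have "\<forall>q. integrable lebesgue q \<and> (\<forall>y\<in>ball 0 4. q y = 0) \<longrightarrow>
      (\<exists>P. polynomial_degree_less k P \<and> (\<forall>x\<in>ball 0 1.
         (LINT y|lebesgue. q y / norm (x - y) powr a) = P x + (LINT y|lebesgue. \<kappa> x y * q y)))"
    using K unfolding kernel_remainder_def by (elim conjE)
  from spec[OF this, of q] show ?thesis using q by (elim mp) simp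
qed

lemma kernel_remainder_integrable:
  fixes u :: "real^'n \<Rightarrow> real"
  assumes K: "kernel_remainder a k \<kappa> C" and u: "weighted_L1 (a + real k) u" and x: "x \<in> ball 0 1"
  shows "integrable lebesgue (\<lambda>y. \<kappa> x y * u y)"
proof -
  have K': "0 \<le> C" "\<kappa> x \<in> borel_measurable lebesgue" "\<And>y. \<bar>\<kappa> x y\<bar> \<le> C / (1 + norm y powr (a + real k))"
    using K x unfolding kernel_remainder_def by blast+
  have "integrable lebesgue (\<lambda>y. C * (\<bar>u y\<bar> / (1 + norm y powr (a + real k))))"
    by (intro integrable_mult_right weighted_L1_abs_integrable u)
  then show ?thesis
  proof (rule Bochner_Integration.integrable_bound)
    show "(\<lambda>y. \<kappa> x y * u y) \<in> borel_measurable lebesgue"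
      by (intro borel_measurable_times K' weighted_L1_measurable[OF u])
    have "\<bar>\<kappa> x y\<bar> * \<bar>u y\<bar> \<le> (C / (1 + norm y powr (a + real k))) * \<bar>u y\<bar>" for y
      by (intro mult_right_mono K') simp
    then show "AE y in lebesgue. norm (\<kappa> x y * u y) \<le> norm (C * (\<bar>u y\<bar> / (1 + norm y powr (a + real k))))"
      using K'(1) weight_pos[of _ "a + real k"] by (intro AE_I2) (simp add: abs_mult abs_of_pos)
  qed
qed

text \<open>The constant depends on \<open>u\<close> only through its weighted norm, so a bounded
  sequence gives equi-Lipschitz integrals.\<close>

lemma kernel_remainder_lipschitz:
  fixes u :: "real^'n \<Rightarrow> real"
  assumes K: "kernel_remainder a k \<kappa> C" and u: "weighted_L1 (a + real k) u"
    and x: "x \<in> ball 0 1" "x' \<in> ball 0 1"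
  shows "\<bar>(LINT y|lebesgue. \<kappa> x y * u y) - (LINT y|lebesgue. \<kappa> x' y * u y)\<bar>
    \<le> C * norm (x - x') * (LINT y|lebesgue. \<bar>u y\<bar> / (1 + norm y powr (a + real k)))"
  by (rule integral_diff_le_weighted[OF u])
     (use K x kernel_remainder_integrable[OF K u] in \<open>auto simp: kernel_remainder_def\<close>)

lemma kernel_remainder_continuous:
  fixes u :: "real^'n \<Rightarrow> real"
  assumes K: "kernel_remainder a k \<kappa> C" and u: "weighted_L1 (a + real k) u"
  shows "continuous_on (ball 0 1) (\<lambda>x. (LINT y|lebesgue. \<kappa> x y * u y))"
proof -
  let ?B = "(LINT y|lebesgue. \<bar>u y\<bar> / (1 + norm y powr (a + real k)))"
  have "0 \<le> C" using K unfolding kernel_remainder_def by blast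
  moreover have "0 \<le> ?B"
    using weight_pos[of _ "a + real k"] by (intro integral_nonneg_AE AE_I2) (simp add: less_imp_le)
  ultimately have "(C * ?B)-lipschitz_on (ball 0 1) (\<lambda>x. (LINT y|lebesgue. \<kappa> x y * u y))"
    using kernel_remainder_lipschitz[OF K u] by (intro lipschitz_onI) (auto simp: dist_real_def dist_norm mult_ac)
  then show ?thesis by (rule lipschitz_on_continuous_on)
qed

lemma kernel_remainder_truncation_tendsto:
  fixes u :: "real^'n \<Rightarrow> real"
  assumes K: "kernel_remainder a k \<kappa> C" and u: "weighted_L1 (a + real k) u" and x: "x \<in> ball 0 1"
  shows "((\<lambda>R. (LINT y|lebesgue. \<kappa> x y * (indicat_real (ball 0 R) y * u y)))
    \<longlongrightarrow> (LINT y|lebesgue. \<kappa> x y * u y)) at_top"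
proof (rule integral_dominated_convergence_at_top)
  note int = kernel_remainder_integrable[OF K u x]
  show m: "(\<lambda>y. \<kappa> x y * u y) \<in> borel_measurable lebesgue" using int by (rule borel_measurable_integrable)
  show "integrable lebesgue (\<lambda>y. \<bar>\<kappa> x y * u y\<bar>)" using int by (rule integrable_abs)
  have "(\<lambda>y. indicat_real (ball 0 R) y * (\<kappa> x y * u y)) \<in> borel_measurable lebesgue" for R
    by (intro borel_measurable_times borel_measurable_indicator m) auto
  then show "(\<lambda>y. \<kappa> x y * (indicat_real (ball 0 R) y * u y)) \<in> borel_measurable lebesgue" for R
    by (simp only: mult.left_commute)
  show "AE y in lebesgue. ((\<lambda>R. \<kappa> x y * (indicat_real (ball 0 R) y * u y)) \<longlongrightarrow> \<kappa> x y * u y) at_top"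
  proof (rule AE_I2)
    fix y :: "real^'n"
    have "\<forall>\<^sub>F R in at_top. norm y < R" by (rule eventually_gt_at_top)
    then have "\<forall>\<^sub>F R in at_top. \<kappa> x y * u y = \<kappa> x y * (indicat_real (ball 0 R) y * u y)"
      by (rule eventually_mono) simp
    then show "((\<lambda>R. \<kappa> x y * (indicat_real (ball 0 R) y * u y)) \<longlongrightarrow> \<kappa> x y * u y) at_top"
      by (rule Lim_transform_eventually[OF tendsto_const])
  qed
  show "\<forall>\<^sub>F R in at_top. AE y in lebesgue. norm (\<kappa> x y * (indicat_real (ball 0 R) y * u y)) \<le> \<bar>\<kappa> x y * u y\<bar>"
    by (intro always_eventually allI AE_I2) (auto simp: indicator_def)
qed

lemma integrable_truncation:
  fixes u :: "real^'n \<Rightarrow> real"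
  assumes b: "0 \<le> b" and u: "weighted_L1 b u"
  shows "integrable lebesgue (\<lambda>y. indicat_real (ball 0 R) y * u y)"
proof (rule Bochner_Integration.integrable_bound)
  show "integrable lebesgue (\<lambda>y. (1 + R powr b) * (\<bar>u y\<bar> / (1 + norm y powr b)))"
    by (intro integrable_mult_right weighted_L1_abs_integrable u)
  show "(\<lambda>y. indicat_real (ball 0 R) y * u y) \<in> borel_measurable lebesgue"
    by (intro borel_measurable_times borel_measurable_indicator weighted_L1_measurable[OF u]) auto
  have "\<bar>u y\<bar> \<le> (1 + R powr b) * (\<bar>u y\<bar> / (1 + norm y powr b))" if "norm y < R" for y
  proof -
    have "norm y powr b \<le> R powr b" using that b by (intro powr_mono2) auto
    then have "(1 + norm y powr b) * (\<bar>u y\<bar> / (1 + norm y powr b)) \<le> (1 + R powr b) * (\<bar>u y\<bar> / (1 + norm y powr b))"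
      using weight_pos[of y b] by (intro mult_right_mono) auto
    then show ?thesis using weight_pos[of y b] by simp
  qed
  then show "AE y in lebesgue. norm (indicat_real (ball 0 R) y * u y) \<le> norm ((1 + R powr b) * (\<bar>u y\<bar> / (1 + norm y powr b)))"
    using weight_pos[of _ b] weight_pos[of "R::real" b]
    by (intro AE_I2) (auto simp: indicator_def abs_mult abs_of_pos add_nonneg_nonneg)
qed

lemma integrable_imp_weighted_L1:
  fixes u :: "real^'n \<Rightarrow> real"
  assumes u: "integrable lebesgue u"
  shows "weighted_L1 b u"
  unfolding weighted_L1_def
proof (rule Bochner_Integration.integrable_bound[OF u])
  show "(\<lambda>y. u y / (1 + norm y powr b)) \<in> borel_measurable lebesgue"
    by (intro borel_measurable_divide borel_measurable_integrable[OF u] weight_measurable)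
  have "\<bar>u y\<bar> / (1 + norm y powr b) \<le> \<bar>u y\<bar>" for y
    using weight_pos[of y b] mult_left_mono[of 1 "1 + norm y powr b" "\<bar>u y\<bar>"]
    by (subst pos_divide_le_eq) auto
  then show "AE y in lebesgue. norm (u y / (1 + norm y powr b)) \<le> norm (u y)"
    using weight_pos[of _ b] by (simp add: abs_of_pos)
qed

text \<open>The two truncations differ by an integrable \<open>q\<close> that vanishes on
  \<open>ball 0 4\<close>. Adding \<open>q\<close> changes the right-hand side by its kernel
  integral, which is a polynomial plus the difference of the two \<open>\<kappa>\<close>
  integrals.\<close>

lemma truncation_radius_change:
  fixes u :: "real^'n \<Rightarrow> real"
  assumes a: "a = real CARD('n) + 2 * s" and s: "0 < s"
    and K: "kernel_remainder a k \<kappa> C" and u: "weighted_L1 (a + real k) u"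
    and R: "4 \<le> R" "4 \<le> S"
    and visc: "frac_laplacian_viscosity s (ball 0 1) (\<lambda>y. indicat_real (ball 0 R) y * u y) g"
  shows "\<exists>P. polynomial_degree_less k P \<and>
    frac_laplacian_viscosity s (ball 0 1) (\<lambda>y. indicat_real (ball 0 S) y * u y)
      (\<lambda>x. g x + (LINT y|lebesgue. \<kappa> x y * (indicat_real (ball 0 R) y * u y))
         - (LINT y|lebesgue. \<kappa> x y * (indicat_real (ball 0 S) y * u y)) - P x)"
proof -
  have a0: "0 \<le> a + real k" using a s by simp
  note int = integrable_truncation[OF a0 u]
  define q where "q y = indicat_real (ball 0 S) y * u y - indicat_real (ball 0 R) y * u y" for y
  have q: "integrable lebesgue q" unfolding q_def[abs_def] by (intro Bochner_Integration.integrable_diff int)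
  have q0: "q y = 0" if "y \<in> ball 0 4" for y using that R by (simp add: q_def)
  have "\<exists>P. polynomial_degree_less k P \<and> (\<forall>x\<in>ball 0 1.
     (LINT y|lebesgue. q y / norm (x - y) powr a) = P x + (LINT y|lebesgue. \<kappa> x y * q y))"
    by (rule kernel_remainder_integral[OF K q]) (rule q0)
  then obtain P where P: "polynomial_degree_less k P"
    "\<forall>x\<in>ball 0 1. (LINT y|lebesgue. q y / norm (x - y) powr a) = P x + (LINT y|lebesgue. \<kappa> x y * q y)"
    by (elim exE conjE)
  have "frac_laplacian_viscosity s (ball 0 1) (\<lambda>y. indicat_real (ball 0 R) y * u y + q y)
      (\<lambda>x. g x - (LINT y|lebesgue. q y / norm (x - y) powr a))"
    by (rule frac_laplacian_viscosity_far[OF a s visc integrable_imp_weighted_L1[OF q]]) (rule q0)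
  then have "frac_laplacian_viscosity s (ball 0 1) (\<lambda>y. indicat_real (ball 0 S) y * u y)
      (\<lambda>x. g x - (LINT y|lebesgue. q y / norm (x - y) powr a))"
    by (simp add: q_def)
  then have "frac_laplacian_viscosity s (ball 0 1) (\<lambda>y. indicat_real (ball 0 S) y * u y)
      (\<lambda>x. g x + (LINT y|lebesgue. \<kappa> x y * (indicat_real (ball 0 R) y * u y))
         - (LINT y|lebesgue. \<kappa> x y * (indicat_real (ball 0 S) y * u y)) - P x)"
  proof (rule frac_laplacian_viscosity_cong)
    fix x :: "real^'n" assume x: "x \<in> ball 0 1"
    have i: "integrable lebesgue (\<lambda>y. \<kappa> x y * (indicat_real (ball 0 T) y * u y))" for T
      by (intro kernel_remainder_integrable[OF K _ x] integrable_imp_weighted_L1 int)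
    have "(LINT y|lebesgue. \<kappa> x y * q y) = (LINT y|lebesgue. \<kappa> x y * (indicat_real (ball 0 S) y * u y))
        - (LINT y|lebesgue. \<kappa> x y * (indicat_real (ball 0 R) y * u y))"
      unfolding q_def right_diff_distrib by (rule Bochner_Integration.integral_diff[OF i i])
    then show "g x - (LINT y|lebesgue. q y / norm (x - y) powr a)
      = g x + (LINT y|lebesgue. \<kappa> x y * (indicat_real (ball 0 R) y * u y))
         - (LINT y|lebesgue. \<kappa> x y * (indicat_real (ball 0 S) y * u y)) - P x"
      using bspec[OF P(2) x] by simp
  qed
  then show ?thesis using P(1) by (intro exI[of _ P] conjI)
qed

text \<open>The supports of \<open>\<kappa> x\<close> and of the truncation are disjoint, so at
  radius 4 the correction term disappears.\<close>

lemma kernel_remainder_truncation_4: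
  assumes "kernel_remainder a k \<kappa> C" "x \<in> ball 0 1"
  shows "\<kappa> x y * (indicat_real (ball 0 4) y * u y) = 0"
  using assms unfolding kernel_remainder_def by (cases "y \<in> ball 0 4") auto

text \<open>Going from radius 4 to \<open>R\<close> subtracts the part of the \<kappa> integral
  inside \<open>ball 0 R\<close>. What is left besides \<open>f\<close> is the tail of a convergent
  integral, which vanishes in the limit.\<close>

lemma frac_laplacian_mod_polyI:
  fixes u :: "real^'n \<Rightarrow> real"
  assumes a: "a = real CARD('n) + 2 * s" and s: "0 < s"
    and K: "kernel_remainder a k \<kappa> C" and u: "weighted_L1 (a + real k) u" "continuous_on (ball 0 1) u"
    and P: "polynomial_degree_less k P"
    and visc: "frac_laplacian_viscosity s (ball 0 1) (\<lambda>y. indicat_real (ball 0 4) y * u y)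
       (\<lambda>x. f x + (LINT y|lebesgue. \<kappa> x y * u y) + P x)"
  shows "frac_laplacian_mod_poly s k u f"
proof -
  let ?H = "\<lambda>x. (LINT y|lebesgue. \<kappa> x y * u y)"
  let ?HR = "\<lambda>R x. (LINT y|lebesgue. \<kappa> x y * (indicat_real (ball 0 R) y * u y))"
  define F where "F R x = f x + ?H x - ?HR R x" for R x
  have "\<exists>Q. 4 \<le> R \<longrightarrow> polynomial_degree_less k Q \<and>
     frac_laplacian_viscosity s (ball 0 1) (\<lambda>x. indicat_real (ball 0 R) x * u x) (\<lambda>x. F R x + Q x)" for R
  proof (cases "4 \<le> R")
    case True
    obtain Q where Q: "polynomial_degree_less k Q"
      "frac_laplacian_viscosity s (ball 0 1) (\<lambda>y. indicat_real (ball 0 R) y * u y)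
       (\<lambda>x. f x + ?H x + P x + ?HR 4 x - ?HR R x - Q x)"
      using truncation_radius_change[OF a s K u(1) order_refl True visc] by blast
    have "frac_laplacian_viscosity s (ball 0 1) (\<lambda>x. indicat_real (ball 0 R) x * u x) (\<lambda>x. F R x + (1 * P x + (-1) * Q x))"
      by (rule frac_laplacian_viscosity_cong[OF Q(2)])
         (simp add: F_def kernel_remainder_truncation_4[OF K])
    then show ?thesis using polynomial_degree_less_lincomb[OF P Q(1), of 1 "-1"] by blast
  qed simp
  then have "\<forall>R. \<exists>Q. 4 \<le> R \<longrightarrow> polynomial_degree_less k Q \<and>
     frac_laplacian_viscosity s (ball 0 1) (\<lambda>x. indicat_real (ball 0 R) x * u x) (\<lambda>x. F R x + Q x)" by blast
  from choice[OF this] obtain Q where Q: "\<forall>R. 4 \<le> R \<longrightarrow> polynomial_degree_less k (Q R) \<and>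
     frac_laplacian_viscosity s (ball 0 1) (\<lambda>x. indicat_real (ball 0 R) x * u x) (\<lambda>x. F R x + Q R x)" ..
  show ?thesis
    unfolding frac_laplacian_mod_poly_def a[symmetric]
  proof (rule conjI[OF u(2)], rule conjI[OF u(1)], rule exI[of _ Q], rule exI[of _ F], intro conjI ballI)
    show "\<forall>\<^sub>F R in at_top. polynomial_degree_less k (Q R) \<and>
        frac_laplacian_viscosity s (ball 0 1) (\<lambda>x. indicat_real (ball 0 R) x * u x) (\<lambda>x. F R x + Q R x)"
      using eventually_ge_at_top[of "4::real"] by (rule eventually_mono) (use Q in blast)
    fix x :: "real^'n" assume x: "x \<in> ball 0 1"
    have "((\<lambda>R. f x + ?H x - ?HR R x) \<longlongrightarrow> f x + ?H x - ?H x) at_top"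
      by (intro tendsto_diff tendsto_const kernel_remainder_truncation_tendsto[OF K u(1) x])
    then show "((\<lambda>R. F R x) \<longlongrightarrow> f x) at_top" by (simp add: F_def)
  qed
qed

section \<open>Touching points and limits of right-hand sides\<close>

lemma C2_on_const: "C2_on N (\<lambda>y. c)"
  unfolding C2_on_def
  by (intro exI[of _ "\<lambda>x. 0"] conjI ballI) (auto intro!: derivative_eq_intros)

text \<open>\<open>L\<close> is the value at \<open>x0\<close> of the fractional Laplacian of \<open>w\<close> glued with a steep paraboloid that
  touches \<open>w\<close> from above at \<open>x0\<close>; it does not depend on \<open>g\<close>.\<close>

lemma touching_above_dense:
  fixes w :: "real^'n \<Rightarrow> real"
  assumes a: "a = real CARD('n) + 2 * s" and w: "continuous_on (ball 0 1) w" "weighted_L1 a w"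
    and x1: "x1 \<in> ball 0 1" and \<rho>: "0 < \<rho>"
  shows "\<exists>x0\<in>ball x1 \<rho> \<inter> ball 0 1. \<exists>L. \<forall>g. frac_subsolution s (ball 0 1) w g \<longrightarrow> L \<le> g x0"
proof -
  obtain r0 where r0: "0 < r0" "cball x1 r0 \<subseteq> ball 0 1"
    using bspec[OF open_contains_cball[THEN iffD1, OF open_ball] x1] by (elim exE conjE)
  define r where "r = min r0 \<rho>"
  have r: "0 < r" "cball x1 r \<subseteq> ball 0 1" "r \<le> \<rho>" using r0 \<rho> by (auto simp: r_def)
  let ?K = "cball x1 r" and ?q = "\<lambda>y. (y - x1) \<bullet> (y - x1)"
  have wK: "continuous_on ?K w" using w(1) r(2) by (rule continuous_on_subset)
  have "bounded (w ` ?K)" by (intro compact_imp_bounded compact_continuous_image wK compact_cball)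
  then obtain A where "\<forall>v\<in>w ` ?K. norm v \<le> A" unfolding bounded_iff by blast
  then have A: "\<bar>w y\<bar> \<le> A" if "y \<in> ?K" for y using that by simp
  \<comment> \<open>On the boundary sphere the paraboloid rises by \<open>2 * A + 1\<close>, more
    than the largest possible oscillation \<open>2 * A\<close> of \<open>w\<close>, which forces the
    maximum into the open ball.\<close>
  define E where "E = (2 * A + 1) / r ^ 2"
  have "\<exists>x\<in>?K. \<forall>y\<in>?K. w y - E * ?q y \<le> w x - E * ?q x"
    using r(1) by (intro continuous_attains_sup continuous_intros wK compact_cball) auto
  then obtain x0 where x0: "x0 \<in> ?K" "\<And>y. y \<in> ?K \<Longrightarrow> w y - E * ?q y \<le> w x0 - E * ?q x0" by blast
  have "dist x1 x0 < r"
  proof (rule ccontr)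
    assume "\<not> dist x1 x0 < r"
    then have "norm (x0 - x1) = r" using x0(1) by (simp add: dist_norm norm_minus_commute)
    then have "E * ?q x0 = 2 * A + 1" using r(1) by (simp add: E_def dot_square_norm)
    moreover have "w x1 \<le> w x0 - E * ?q x0" using x0(2)[of x1] r(1) by simp
    ultimately show False using A[of x1] A[OF x0(1)] r(1) by (simp add: abs_le_iff)
  qed
  then have x0b: "x0 \<in> ball x1 r" by simp
  let ?\<phi> = "\<lambda>y. 0 + E * ?q y + (w x0 - E * ?q x0)"
  let ?v = "\<lambda>y. if y \<in> ball x1 r then ?\<phi> y else w y"
  have "bounded (?\<phi> ` ?K)" by (intro compact_imp_bounded compact_continuous_image continuous_intros compact_cball)
  then obtain B where "\<forall>v\<in>?\<phi> ` ?K. norm v \<le> B" unfolding bounded_iff by blast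
  then have B: "\<bar>?\<phi> y\<bar> \<le> B" if "y \<in> ?K" for y using that by simp
  have B0: "0 \<le> B" using order_trans[OF abs_ge_zero B[OF x0(1)]] .
  have v_eq: "?v = (\<lambda>y. 1 * (indicat_real (ball x1 r) y * ?\<phi> y) + 1 * (indicat_real (- ball x1 r) y * w y))"
    by (auto simp: fun_eq_iff indicator_def)
  have "weighted_L1 a (\<lambda>y. indicat_real (ball x1 r) y * ?\<phi> y)"
  proof (rule weighted_L1_bounded_support)
    show "(\<lambda>y. indicat_real (ball x1 r) y * ?\<phi> y) \<in> borel_measurable lebesgue"
      by (intro continuous_on_indicator_measurable continuous_intros)
    show "\<bar>indicat_real (ball x1 r) y * ?\<phi> y\<bar> \<le> B" for y
    proof (cases "y \<in> ball x1 r")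
      case True
      then have "y \<in> ?K" by simp
      from B[OF this] True show ?thesis by simp
    qed (use B0 in simp)
    show "y \<notin> ball x1 r \<Longrightarrow> indicat_real (ball x1 r) y * ?\<phi> y = 0" for y by simp
  qed
  moreover have "weighted_L1 a (\<lambda>y. indicat_real (- ball x1 r) y * w y)"
    by (rule weighted_L1_indicator[OF w(2)]) auto
  ultimately have vw: "weighted_L1 (real CARD('n) + 2 * s) ?v"
    unfolding v_eq a[symmetric] by (rule weighted_L1_lincomb)
  have ex: "\<exists>L. has_frac_laplacian s ?v x0 L \<and> L \<le> g x0" if g: "frac_subsolution s (ball 0 1) w g" for g
  proof (rule frac_subsolutionD[OF g _ _ _ _ _ _ vw])
    show "x0 \<in> ball 0 1" using x0(1) r(2) by blast
    show "ball x1 r \<subseteq> ball 0 1" using r(2) by auto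
    show "C2_on (ball x1 r) ?\<phi>" by (intro C2_on_add_quadratic C2_on_const)
    show "w y \<le> ?\<phi> y" if "y \<in> ball x1 r" for y using x0(2)[of y] that by simp
  qed (use x0b in auto)
  have "\<exists>L. \<forall>g. frac_subsolution s (ball 0 1) w g \<longrightarrow> L \<le> g x0"
  \<comment> \<open>Whether \<open>L\<close> exists depends on \<open>?v\<close> alone. If it does
    not, no \<open>g\<close> at all satisfies the subsolution condition and any number serves as the
    bound.\<close>
  proof (cases "\<exists>L. has_frac_laplacian s ?v x0 L")
    case True
    then obtain L where L: "has_frac_laplacian s ?v x0 L" by blast
    show ?thesis
    proof (intro exI[of _ L] allI impI)
      fix g assume "frac_subsolution s (ball 0 1) w g"
      then obtain L' where L': "has_frac_laplacian s ?v x0 L'" "L' \<le> g x0" using ex by blast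
      have "L = L'" using L L'(1) by (rule has_frac_laplacian_unique)
      then show "L \<le> g x0" using L'(2) by simp
    qed
  next
    case False
    then show ?thesis using ex by blast
  qed
  moreover have "x0 \<in> ball 0 1" using x0(1) r(2) by blast
  moreover have "x0 \<in> ball x1 \<rho>" using x0b r(3) by auto
  ultimately show ?thesis by blast
qed

text \<open>At a touching point one number \<open>L\<close> bounds all \<open>G j\<close> from
  below, and division by \<open>M j\<close> sends it to zero. Such points are dense and
  \<open>Q\<close> is continuous, so the sign holds everywhere.\<close>

lemma frac_subsolution_rescaled_limit_nonneg:
  fixes w :: "real^'n \<Rightarrow> real"
  assumes a: "a = real CARD('n) + 2 * s" and w: "continuous_on (ball 0 1) w" "weighted_L1 a w"
    and sub: "\<And>j::nat. frac_subsolution s (ball 0 1) w (G j)"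
    and M: "\<And>j. 0 < M j" "(\<lambda>j. 1 / M j) \<longlonglongrightarrow> 0"
    and lim: "\<And>x. x \<in> ball 0 1 \<Longrightarrow> (\<lambda>j. G j x / M j) \<longlonglongrightarrow> Q x"
    and Q: "continuous_on (ball 0 1) Q" and x1: "x1 \<in> ball 0 1"
  shows "0 \<le> Q x1"
proof (rule ccontr)
  assume neg: "\<not> 0 \<le> Q x1"
  then have "\<exists>\<rho>>0. \<forall>x\<in>ball 0 1. dist x x1 < \<rho> \<longrightarrow> dist (Q x) (Q x1) < - Q x1"
    using Q x1 unfolding continuous_on_iff by (meson neg_0_less_iff_less not_le)
  then obtain \<rho> where \<rho>: "0 < \<rho>" "\<And>x. x \<in> ball 0 1 \<Longrightarrow> dist x x1 < \<rho> \<Longrightarrow> dist (Q x) (Q x1) < - Q x1" by blast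
  obtain x0 L where x0: "x0 \<in> ball x1 \<rho> \<inter> ball 0 1"
    and L: "\<And>g. frac_subsolution s (ball 0 1) w g \<Longrightarrow> L \<le> g x0"
    using touching_above_dense[OF a w x1 \<rho>(1)] by blast
  have "0 \<le> Q x0"
  proof (rule LIMSEQ_le)
    show "(\<lambda>j. G j x0 / M j) \<longlonglongrightarrow> Q x0" using x0 by (intro lim) auto
    have "(\<lambda>j. L * (1 / M j)) \<longlonglongrightarrow> L * 0" by (intro tendsto_intros M(2))
    then show "(\<lambda>j. L * (1 / M j)) \<longlonglongrightarrow> 0" by simp
    have "L * (1 / M j) \<le> G j x0 / M j" for j
      using divide_right_mono[OF L[OF sub] less_imp_le[OF M(1)], of j j] by simp
    then show "\<exists>N. \<forall>n\<ge>N. L * (1 / M n) \<le> G n x0 / M n" by blast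
  qed
  moreover have "dist (Q x0) (Q x1) < - Q x1" using x0 by (intro \<rho>(2)) (auto simp: dist_commute)
  ultimately show False by (simp add: dist_real_def)
qed

text \<open>The function \<open>w\<close> is fixed, so a test function yields the same glued
  function and the same value \<open>L\<close> for all \<open>j\<close>; no touching point
  moves.\<close>

lemma frac_subsolution_pointwise_limit:
  fixes w :: "real^'n \<Rightarrow> real"
  assumes sub: "\<And>j::nat. frac_subsolution s \<Omega> w (G j)"
    and lim: "\<And>x. x \<in> \<Omega> \<Longrightarrow> (\<lambda>j. G j x) \<longlonglongrightarrow> g x"
  shows "frac_subsolution s \<Omega> w g"
  unfolding frac_subsolution_def
proof (intro ballI allI impI, elim conjE)
  fix x0 N \<phi>
  let ?v = "\<lambda>y. if y \<in> N then \<phi> y else w y"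
  assume *: "x0 \<in> \<Omega>" "open N" "x0 \<in> N" "N \<subseteq> \<Omega>" "C2_on N \<phi>" "\<phi> x0 = w x0"
    "weighted_L1 (real CARD('n) + 2 * s) ?v" "\<forall>y\<in>N. w y \<le> \<phi> y"
  have ex: "\<exists>L. has_frac_laplacian s ?v x0 L \<and> L \<le> G j x0" for j
    using frac_subsolutionD[OF sub *(1-7)] *(8) by blast
  then obtain L where L: "has_frac_laplacian s ?v x0 L" by blast
  have "L \<le> G j x0" for j using ex[of j] has_frac_laplacian_unique[OF L] by blast
  then have "L \<le> g x0" using lim[OF *(1)] by (intro LIMSEQ_le_const) auto
  then show "\<exists>L. has_frac_laplacian s ?v x0 L \<and> L \<le> g x0" using L by blast
qed

lemma polynomials_normalized_subsequence:
  fixes P :: "nat \<Rightarrow> real^'n \<Rightarrow> real"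
  assumes P: "\<And>m. polynomial_degree_less k (P m)"
  shows "\<exists>(r :: nat \<Rightarrow> nat) M \<theta> Q. strict_mono r \<and> (\<forall>m. 1 \<le> M m) \<and> (\<lambda>m. 1 / M m) \<longlonglongrightarrow> \<theta> \<and>
    polynomial_degree_less k Q \<and>
    (\<forall>X. \<forall>x\<in>S. X \<longlonglongrightarrow> x \<and> (\<forall>m. X m \<in> S) \<longrightarrow> (\<lambda>m. P (r m) (X m) / M m) \<longlonglongrightarrow> Q x) \<and>
    (\<theta> = 0 \<longrightarrow> (\<exists>x\<in>S. Q x \<noteq> 0))"
proof -
  obtain Y and l :: "real^'n \<Rightarrow> real^'n \<Rightarrow> real"
    where H: "finite Y \<and> Y \<subseteq> S \<and> (\<forall>x\<in>Y. polynomial_degree_less k (l x)) \<and>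
           (\<forall>P. polynomial_degree_less k P \<longrightarrow> (\<forall>y\<in>S. P y = (\<Sum>x\<in>Y. P x * l x y)))"
    using polynomial_interpolation[of S k] by (elim exE)
  then have Y: "finite Y" "Y \<subseteq> S" "\<And>x. x \<in> Y \<Longrightarrow> polynomial_degree_less k (l x)"
    by simp_all
  define N where "N m = 1 + (\<Sum>x\<in>Y. \<bar>P m x\<bar>)" for m
  have N1: "1 \<le> N m" for m by (simp add: N_def sum_nonneg)
  \<comment> \<open>The normalising factor and the values at the nodes form one finite family, with
    \<open>None\<close> for the former, so that a single extraction makes all of them
    converge.\<close>
  define h where "h m i = (case i of None \<Rightarrow> 1 / N m | Some x \<Rightarrow> P m x / N m)" for m i
  have "\<bar>h m i\<bar> \<le> 1" if "i \<in> insert None (Some ` Y)" for m i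
  proof (cases i)
    case None
    then show ?thesis using N1[of m] by (simp add: h_def)
  next
    case (Some x)
    then have "\<bar>P m x\<bar> \<le> (\<Sum>x\<in>Y. \<bar>P m x\<bar>)" using that Y(1) by (intro member_le_sum) auto
    then have "\<bar>P m x\<bar> \<le> N m" by (simp add: N_def)
    then show ?thesis using N1[of m] Some by (simp add: h_def)
  qed
  then have "\<exists>(r :: nat \<Rightarrow> nat) L. strict_mono r \<and> (\<forall>i\<in>insert None (Some ` Y). (\<lambda>m. h (r m) i) \<longlonglongrightarrow> L i)"
    using Y(1) by (intro bounded_family_convergent_subsequence[where B = 1]) auto
  then obtain r :: "nat \<Rightarrow> nat" and L where r: "strict_mono r"
    and L: "\<And>i. i \<in> insert None (Some ` Y) \<Longrightarrow> (\<lambda>m. h (r m) i) \<longlonglongrightarrow> L i" by blast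
  have \<theta>: "(\<lambda>m. 1 / N (r m)) \<longlonglongrightarrow> L None" using L[of None] by (simp add: h_def)
  have p: "(\<lambda>m. P (r m) x / N (r m)) \<longlonglongrightarrow> L (Some x)" if "x \<in> Y" for x
    using L[of "Some x"] that by (simp add: h_def)
  define Q where "Q y = (\<Sum>x\<in>Y. L (Some x) * l x y)" for y
  have Q: "polynomial_degree_less k Q" unfolding Q_def[abs_def] by (intro polynomial_degree_less_sum Y(3))
  have lim: "(\<lambda>m. P (r m) (X m) / N (r m)) \<longlonglongrightarrow> Q x" if "x \<in> S" "X \<longlonglongrightarrow> x" "\<And>m. X m \<in> S" for X x
  proof -
    have "(\<lambda>m. \<Sum>y\<in>Y. (P (r m) y / N (r m)) * l y (X m)) \<longlonglongrightarrow> Q x"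
      unfolding Q_def
    proof (intro tendsto_sum tendsto_mult p)
      fix y assume "y \<in> Y"
      then have "continuous_on UNIV (l y)" by (intro continuous_on_polynomial_degree_less[OF Y(3)])
      then show "(\<lambda>m. l y (X m)) \<longlonglongrightarrow> l y x"
        using that(2) by (intro isCont_tendsto_compose[of x "l y"]) (auto simp: continuous_on_eq_continuous_at)
    qed
    moreover have "P (r m) (X m) / N (r m) = (\<Sum>y\<in>Y. (P (r m) y / N (r m)) * l y (X m))" for m
    proof -
      have "P (r m) (X m) = (\<Sum>y\<in>Y. P (r m) y * l y (X m))" using H P that(3) by blast
      then show ?thesis by (simp only: sum_divide_distrib times_divide_eq_left)
    qed
    ultimately show ?thesis by simp
  qed
  \<comment> \<open>For every \<open>m\<close> the number \<open>1 / N m\<close> and the absolute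
    normalised values at the nodes add up to one, so their limits cannot all be zero.\<close>
  have "\<exists>x\<in>S. Q x \<noteq> 0" if "L None = 0"
  proof (rule ccontr)
    assume "\<not> (\<exists>x\<in>S. Q x \<noteq> 0)"
    then have Q0: "Q x = 0" if "x \<in> Y" for x using that Y(2) by blast
    have "(\<lambda>m. P (r m) x / N (r m)) \<longlonglongrightarrow> 0" if "x \<in> Y" for x
      using lim[of x "\<lambda>_. x"] that Y(2) Q0[OF that] by auto
    then have "(\<lambda>m. 1 / N (r m) + (\<Sum>x\<in>Y. \<bar>P (r m) x / N (r m)\<bar>)) \<longlonglongrightarrow> L None + (\<Sum>x\<in>Y. \<bar>0\<bar>)"
      by (intro tendsto_add \<theta> tendsto_sum tendsto_rabs) auto
    moreover have "1 / N (r m) + (\<Sum>x\<in>Y. \<bar>P (r m) x / N (r m)\<bar>) = 1" for m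
    proof -
      have "1 / N (r m) + (\<Sum>x\<in>Y. \<bar>P (r m) x / N (r m)\<bar>) = (1 + (\<Sum>x\<in>Y. \<bar>P (r m) x\<bar>)) / N (r m)"
        using N1[of "r m"] by (simp add: add_divide_distrib sum_divide_distrib)
      then show ?thesis using N1[of "r m"] unfolding N_def[symmetric] by simp
    qed
    ultimately have "(\<lambda>m. 1::real) \<longlonglongrightarrow> 0" using that by simp
    then show False by (simp add: LIMSEQ_const_iff)
  qed
  then show ?thesis
    using r N1 \<theta> Q lim by (intro exI[of _ r] exI[of _ "\<lambda>m. N (r m)"] exI[of _ "L None"] exI[of _ Q]) blast
qed

text \<open>Transported to radius 4, all the equations concern the same function; their right-hand
  sides are a pointwise convergent part plus polynomials that are a priori unbounded. The rescaling
  argument shows that along a subsequence these polynomials converge.\<close>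

lemma frac_laplacian_mod_polyD:
  fixes u :: "real^'n \<Rightarrow> real"
  assumes a: "a = real CARD('n) + 2 * s" and s: "0 < s"
    and K: "kernel_remainder a k \<kappa> C"
    and mod: "frac_laplacian_mod_poly s k u f" and f: "continuous_on (ball 0 1) f"
  shows "\<exists>P. polynomial_degree_less k P \<and>
    frac_laplacian_viscosity s (ball 0 1) (\<lambda>y. indicat_real (ball 0 4) y * u y)
      (\<lambda>x. f x + (LINT y|lebesgue. \<kappa> x y * u y) + P x)"
proof -
  let ?H = "\<lambda>x. (LINT y|lebesgue. \<kappa> x y * u y)"
  let ?HR = "\<lambda>R x. (LINT y|lebesgue. \<kappa> x y * (indicat_real (ball 0 R) y * u y))"
  let ?w = "\<lambda>y. indicat_real (ball 0 4) y * u y"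
  have u: "continuous_on (ball 0 1) u" "weighted_L1 (a + real k) u"
    using mod unfolding frac_laplacian_mod_poly_def a[symmetric] by auto
  obtain P F where ev: "\<forall>\<^sub>F R in at_top. polynomial_degree_less k (P R) \<and>
      frac_laplacian_viscosity s (ball 0 1) (\<lambda>x. indicat_real (ball 0 R) x * u x) (\<lambda>x. F R x + P R x)"
    and Flim: "\<forall>x\<in>ball 0 1. ((\<lambda>R. F R x) \<longlongrightarrow> f x) at_top"
    using mod unfolding frac_laplacian_mod_poly_def by (elim conjE exE)
  obtain R0 where R0: "\<forall>R\<ge>R0. polynomial_degree_less k (P R) \<and>
      frac_laplacian_viscosity s (ball 0 1) (\<lambda>x. indicat_real (ball 0 R) x * u x) (\<lambda>x. F R x + P R x)"
    using ev unfolding eventually_at_top_linorder by (elim exE)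
  define \<rho> where "\<rho> j = max R0 4 + real j" for j :: nat
  have \<rho>: "R0 \<le> \<rho> j" "4 \<le> \<rho> j" for j by (auto simp: \<rho>_def)
  have \<rho>lim: "filterlim \<rho> at_top sequentially"
    unfolding \<rho>_def[abs_def] by (intro filterlim_tendsto_add_at_top[OF tendsto_const filterlim_real_sequentially])
  have "\<exists>P'. polynomial_degree_less k P' \<and> frac_laplacian_viscosity s (ball 0 1) ?w
      (\<lambda>x. F (\<rho> j) x + P (\<rho> j) x + ?HR (\<rho> j) x - ?HR 4 x - P' x)" for j
    by (rule truncation_radius_change[OF a s K u(2) \<rho>(2) order_refl]) (use R0 \<rho>(1) in blast)
  then have "\<forall>j. \<exists>P'. polynomial_degree_less k P' \<and> frac_laplacian_viscosity s (ball 0 1) ?w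
      (\<lambda>x. F (\<rho> j) x + P (\<rho> j) x + ?HR (\<rho> j) x - ?HR 4 x - P' x)" ..
  from choice[OF this] obtain P' where P': "\<forall>j. polynomial_degree_less k (P' j) \<and> frac_laplacian_viscosity s (ball 0 1) ?w
      (\<lambda>x. F (\<rho> j) x + P (\<rho> j) x + ?HR (\<rho> j) x - ?HR 4 x - P' j x)" ..
  \<comment> \<open>All polynomial parts are collected in \<open>p\<close>, about whose size nothing
    is known yet; \<open>B\<close> is the part that converges pointwise.\<close>
  define p where "p j x = 1 * P (\<rho> j) x + (-1) * P' j x" for j x
  define B where "B j x = F (\<rho> j) x + ?HR (\<rho> j) x" for j x
  have p: "polynomial_degree_less k (p j)" for j
    unfolding p_def[abs_def] using R0 \<rho>(1) P' by (intro polynomial_degree_less_lincomb) auto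
  have visc: "frac_laplacian_viscosity s (ball 0 1) ?w (\<lambda>x. B j x + p j x)" for j
    by (rule frac_laplacian_viscosity_cong[OF P'[rule_format, of j, THEN conjunct2]])
       (simp add: B_def p_def kernel_remainder_truncation_4[OF K])
  have sub: "frac_subsolution s (ball 0 1) ?w (\<lambda>x. B j x + p j x)"
    "frac_subsolution s (ball 0 1) (\<lambda>x. - ?w x) (\<lambda>x. - (B j x + p j x))" for j
    using visc[of j] unfolding frac_laplacian_viscosity_iff by blast+
  have w: "continuous_on (ball 0 1) ?w" "weighted_L1 a ?w"
    using visc[of 0] unfolding frac_laplacian_viscosity_iff a by blast+
  have w_neg: "continuous_on (ball 0 1) (\<lambda>x. - ?w x)" "weighted_L1 a (\<lambda>x. - ?w x)"
    using continuous_on_minus[OF w(1)] weighted_L1_scale[OF w(2), of "-1"] by simp_all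
  have Blim: "(\<lambda>j. B j x) \<longlonglongrightarrow> f x + ?H x" if "x \<in> ball 0 1" for x
    unfolding B_def
    by (intro tendsto_add filterlim_compose[OF bspec[OF Flim that] \<rho>lim]
        filterlim_compose[OF kernel_remainder_truncation_tendsto[OF K u(2) that] \<rho>lim])
  obtain r :: "nat \<Rightarrow> nat" and M \<theta> Q where r: "strict_mono r" and M: "\<forall>m. 1 \<le> M m" "(\<lambda>m. 1 / M m) \<longlonglongrightarrow> \<theta>"
    and Q: "polynomial_degree_less k Q"
    and lim: "\<forall>X. \<forall>x\<in>ball 0 1. X \<longlonglongrightarrow> x \<and> (\<forall>m. X m \<in> ball 0 1) \<longrightarrow> (\<lambda>m. p (r m) (X m) / M m) \<longlonglongrightarrow> Q x"
    and \<theta>0: "\<theta> = 0 \<longrightarrow> (\<exists>x\<in>ball 0 1. Q x \<noteq> 0)"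
    using polynomials_normalized_subsequence[where P = p and S = "ball 0 1", OF p] by (elim exE conjE)
  have M0: "0 < M m" for m using spec[OF M(1), of m] by linarith
  have Qc: "continuous_on S Q" for S by (rule continuous_on_polynomial_degree_less[OF Q])
  define G where "G j x = B (r j) x + p (r j) x" for j x
  have Glim: "(\<lambda>j. G j x / M j) \<longlonglongrightarrow> (f x + ?H x) * \<theta> + Q x" if x: "x \<in> ball 0 1" for x
  proof -
    have "(\<lambda>j. B (r j) x * (1 / M j) + p (r j) x / M j) \<longlonglongrightarrow> (f x + ?H x) * \<theta> + Q x"
    proof (intro tendsto_add tendsto_mult M(2))
      show "(\<lambda>j. B (r j) x) \<longlonglongrightarrow> f x + ?H x"
        using LIMSEQ_subseq_LIMSEQ[OF Blim[OF x] r] by (simp add: o_def)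
      show "(\<lambda>j. p (r j) x / M j) \<longlonglongrightarrow> Q x"
        using bspec[OF spec[OF lim, of "\<lambda>_. x"] x] x by simp
    qed
    then show ?thesis by (simp add: G_def add_divide_distrib)
  qed
  \<comment> \<open>For \<theta> = 0 the sign statement, applied to both halves of the viscosity
    condition, gives Q = 0 on the ball, which the normalisation excludes.\<close>
  have "\<theta> \<noteq> 0"
  proof
    assume \<theta>: "\<theta> = 0"
    obtain x where x: "x \<in> ball 0 1" "Q x \<noteq> 0" using \<theta>0 \<theta> by blast
    have "0 \<le> Q x"
      by (rule frac_subsolution_rescaled_limit_nonneg[OF a w _ M0 M(2)[unfolded \<theta>] _ Qc x(1), where G = G])
         (use sub(1) Glim \<theta> in \<open>auto simp: G_def[abs_def]\<close>)
    moreover have "0 \<le> - Q x"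
    proof (rule frac_subsolution_rescaled_limit_nonneg[OF a w_neg _ M0 M(2)[unfolded \<theta>] _ _ x(1), where G = "\<lambda>j x. - G j x"])
      show "frac_subsolution s (ball 0 1) (\<lambda>x. - ?w x) (\<lambda>x. - G j x)" for j
        unfolding G_def by (rule sub(2))
      show "(\<lambda>j. - G j x / M j) \<longlonglongrightarrow> - Q x" if "x \<in> ball 0 1" for x
        using tendsto_minus[OF Glim[OF that]] \<theta> by simp
      show "continuous_on (ball 0 1) (\<lambda>x. - Q x)" by (intro continuous_intros Qc)
    qed
    ultimately show False using x(2) by simp
  qed
  moreover have "0 \<le> \<theta>"
    using M(2) by (rule LIMSEQ_le_const) (use M0 in \<open>auto intro: less_imp_le\<close>)
  ultimately have \<theta>: "0 < \<theta>" by simp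
  \<comment> \<open>Dividing by the limit of \<open>1 / M j\<close> undoes the
    normalisation.\<close>
  have Glim': "(\<lambda>j. G j x) \<longlonglongrightarrow> f x + ?H x + (1 / \<theta>) * Q x" if x: "x \<in> ball 0 1" for x
  proof -
    have "(\<lambda>j. (G j x / M j) / (1 / M j)) \<longlonglongrightarrow> ((f x + ?H x) * \<theta> + Q x) / \<theta>"
      using \<theta> by (intro tendsto_divide Glim x M(2)) auto
    moreover have "(G j x / M j) / (1 / M j) = G j x" for j using M0[of j] by simp
    moreover have "((f x + ?H x) * \<theta> + Q x) / \<theta> = f x + ?H x + (1 / \<theta>) * Q x"
      using \<theta> by (simp add: add_divide_distrib)
    ultimately show ?thesis by simp
  qed
  have "frac_subsolution s (ball 0 1) ?w (\<lambda>x. f x + ?H x + (1 / \<theta>) * Q x)"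
    by (rule frac_subsolution_pointwise_limit[where G = G]) (use sub(1) Glim' in \<open>auto simp: G_def[abs_def]\<close>)
  moreover have "frac_subsolution s (ball 0 1) (\<lambda>x. - ?w x) (\<lambda>x. - (f x + ?H x + (1 / \<theta>) * Q x))"
  proof (rule frac_subsolution_pointwise_limit[where G = "\<lambda>j x. - G j x"])
    show "frac_subsolution s (ball 0 1) (\<lambda>x. - ?w x) (\<lambda>x. - G j x)" for j
      unfolding G_def by (rule sub(2))
    show "(\<lambda>j. - G j x) \<longlonglongrightarrow> - (f x + ?H x + (1 / \<theta>) * Q x)" if "x \<in> ball 0 1" for x
      by (rule tendsto_minus[OF Glim'[OF that]])
  qed
  moreover have "continuous_on (ball 0 1) (\<lambda>x. f x + ?H x + (1 / \<theta>) * Q x)"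
    by (intro continuous_on_add continuous_on_mult continuous_on_const f Qc kernel_remainder_continuous[OF K u(2)])
  ultimately have "frac_laplacian_viscosity s (ball 0 1) ?w (\<lambda>x. f x + ?H x + (1 / \<theta>) * Q x)"
    unfolding frac_laplacian_viscosity_iff a[symmetric] using w by blast
  moreover have "polynomial_degree_less k (\<lambda>x. (1 / \<theta>) * Q x)"
    using polynomial_degree_less_lincomb[OF Q Q, of "1 / \<theta>" 0] by simp
  ultimately show ?thesis by (intro exI[of _ "\<lambda>x. (1 / \<theta>) * Q x"] conjI)
qed

section \<open>Limits of sequences of solutions\<close>

text \<open>The zero function is its own test function. Its value is found without computing an
  integral: it is 0 times itself, and values are unique.\<close>

lemma frac_subsolution_zero:
  fixes g :: "real^'n \<Rightarrow> real"
  assumes sub: "frac_subsolution s (ball 0 1) (\<lambda>x. 0) g" and x: "x \<in> ball 0 1"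
  shows "0 \<le> g x"
proof -
  have "\<exists>L. has_frac_laplacian s (\<lambda>y. if y \<in> ball 0 1 then 0 else 0) x L \<and> L \<le> g x"
    by (rule frac_subsolutionD[OF sub x _ x _ C2_on_const]) (simp_all add: weighted_L1_def)
  then obtain L where L: "has_frac_laplacian s (\<lambda>y. 0) x L" "L \<le> g x" by auto
  have "has_frac_laplacian s (\<lambda>y. 0) x 0" using has_frac_laplacian_scale[OF L(1), of 0] by simp
  then have "L = 0" using has_frac_laplacian_unique[OF L(1)] by simp
  then show ?thesis using L(2) by simp
qed

text \<open>The factor that exchanges the weight of exponent \<open>a + real k\<close> for that of
  exponent \<open>a\<close> on \<open>ball 0 4\<close>. Being bounded, it can be absorbed into weak
  test functions.\<close>

definition weight_quotient :: "real \<Rightarrow> nat \<Rightarrow> real^'n \<Rightarrow> real" where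
  "weight_quotient a k y = indicat_real (ball 0 4) y * ((1 + norm y powr (a + real k)) / (1 + norm y powr a))"

lemma weight_quotient:
  fixes y :: "real^'n"
  assumes a: "0 < a"
  shows "0 \<le> weight_quotient a k y" "weight_quotient a k y \<le> 1 + 4 powr (a + real k)"
    "indicat_real (ball 0 4) y * v / (1 + norm y powr a) = v * weight_quotient a k y / (1 + norm y powr (a + real k))"
proof -
  show "0 \<le> weight_quotient a k y"
    using weight_pos[of y a] weight_pos[of y "a + real k"] by (simp add: weight_quotient_def)
  show "weight_quotient a k y \<le> 1 + 4 powr (a + real k)"
  proof (cases "y \<in> ball 0 4")
    case True
    have "norm y powr (a + real k) \<le> 4 powr (a + real k)"
      using True a by (intro powr_mono2) auto
    moreover have "(1 + norm y powr (a + real k)) / (1 + norm y powr a) \<le> (1 + norm y powr (a + real k)) / 1"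
      using weight_pos[of y a] weight_pos[of y "a + real k"] by (intro divide_left_mono) auto
    ultimately show ?thesis using True by (simp add: weight_quotient_def)
  qed (simp add: weight_quotient_def add_nonneg_nonneg)
  show "indicat_real (ball 0 4) y * v / (1 + norm y powr a) = v * weight_quotient a k y / (1 + norm y powr (a + real k))"
    using weight_pos[of y "a + real k"] by (simp add: weight_quotient_def)
qed

lemma weight_quotient_measurable:
  "weight_quotient a k \<in> borel_measurable (lebesgue :: (real^'n) measure)"
  unfolding weight_quotient_def[abs_def]
  by (intro borel_measurable_times borel_measurable_divide borel_measurable_indicator weight_measurable) auto

lemma L_infty_mult_bounded:
  assumes \<psi>: "L_infty \<psi>" and g: "g \<in> borel_measurable lebesgue" "\<And>y. \<bar>g y\<bar> \<le> B"
  shows "L_infty (\<lambda>y. g y * \<psi> y)"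
proof -
  obtain C where C: "\<psi> \<in> borel_measurable lebesgue" "AE y in lebesgue. \<bar>\<psi> y\<bar> \<le> C"
    using \<psi> unfolding L_infty_def by blast
  have B: "0 \<le> B" using order_trans[OF abs_ge_zero g(2)] .
  have "AE y in lebesgue. \<bar>g y * \<psi> y\<bar> \<le> B * C"
    using C(2) by (rule eventually_mono) (use g(2) B in \<open>auto simp: abs_mult intro!: mult_mono\<close>)
  then show ?thesis unfolding L_infty_def using borel_measurable_times[OF g(1) C(1)] by blast
qed

lemma L_infty_bounded:
  assumes "g \<in> borel_measurable lebesgue" "\<And>y. \<bar>g y\<bar> \<le> B"
  shows "L_infty g"
  unfolding L_infty_def using assms by blast

theorem theorem1p6:
  fixes s :: real and k :: nat
    and U F :: "nat \<Rightarrow> real^'n \<Rightarrow> real" and u f :: "real^'n \<Rightarrow> real"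
  assumes "0 < s" and "s < 1"
    and "\<And>m. continuous_on (ball 0 1) (U m)"
    and "\<And>m. continuous_on (ball 0 1) (F m)"
    and "\<And>m. frac_laplacian_mod_poly s k (U m) (F m)"
    and "integrable lebesgue u"
    and "(\<lambda>m. set_lebesgue_integral lebesgue (ball 0 1) (\<lambda>x. \<bar>U m x - u x\<bar>)) \<longlonglongrightarrow> 0"
    and "locally_uniform_limit (ball 0 1) U u"
    and "locally_uniform_limit (ball 0 1) F f"
    and "bdd_above (range (\<lambda>m.
           integral\<^sup>L lebesgue (\<lambda>y. \<bar>U m y\<bar> / (1 + norm y powr (real CARD('n) + 2 * s + real k)))))"
    and "\<And>\<phi>. L_infty \<phi> \<Longrightarrow>
           (\<lambda>m. integral\<^sup>L lebesgue
             (\<lambda>y. U m y * \<phi> y / (1 + norm y powr (real CARD('n) + 2 * s + real k))))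
           \<longlonglongrightarrow> integral\<^sup>L lebesgue
             (\<lambda>y. u y * \<phi> y / (1 + norm y powr (real CARD('n) + 2 * s + real k)))"
  shows "frac_laplacian_mod_poly s k u f"
proof -
  define a where "a = real CARD('n) + 2 * s"
  note s = assms(1,2) and U = assms(3) and F = assms(4) and mod = assms(5)
  note a = a_def and unif = assms(8,9)
  note weak = assms(11)[folded a_def]
  let ?W = "\<lambda>y::real^'n. 1 + norm y powr (a + real k)"
  have a0: "0 < a" using s by (auto simp: a_def intro: add_nonneg_pos)
  have uw: "weighted_L1 b u" for b by (rule integrable_imp_weighted_L1[OF assms(6)])
  have Uw: "weighted_L1 (a + real k) (U m)" for m
    using mod[of m] unfolding frac_laplacian_mod_poly_def a_def by blast
  obtain B where B: "(LINT y|lebesgue. \<bar>U m y\<bar> / ?W y) \<le> B" for m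
    using assms(10) unfolding bdd_above_def a_def by blast
  have uc: "continuous_on (ball 0 1) u" and fc: "continuous_on (ball 0 1) f"
    using locally_uniform_limit_tendsto(2)[OF unif(1) open_ball U, of 0 "\<lambda>_. 0"]
      locally_uniform_limit_tendsto(2)[OF unif(2) open_ball F, of 0 "\<lambda>_. 0"] by simp_all
  obtain \<kappa> :: "real^'n \<Rightarrow> real^'n \<Rightarrow> real" and C where K: "kernel_remainder a k \<kappa> C"
    using kernel_remainder_exists[OF a0, of k] by (elim exE)
  let ?H = "\<lambda>v x. (LINT y|lebesgue. \<kappa> x y * v y)"
  have C0: "0 \<le> C" using K unfolding kernel_remainder_def by blast
  \<comment> \<open>The product of \<open>\<kappa> x\<close> and the weight is bounded by
    \<open>C\<close>, so it is an admissible weak test function.\<close>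
  have Hlim: "(\<lambda>m. ?H (U m) x) \<longlonglongrightarrow> ?H u x" if x: "x \<in> ball 0 1" for x
  proof -
    have "L_infty (\<lambda>y. \<kappa> x y * ?W y)"
    proof (rule L_infty_bounded[where B = C])
      show "(\<lambda>y. \<kappa> x y * ?W y) \<in> borel_measurable lebesgue"
        using K x unfolding kernel_remainder_def by (intro borel_measurable_times weight_measurable) blast
      fix y
      have "\<bar>\<kappa> x y\<bar> \<le> C / ?W y" using K x unfolding kernel_remainder_def by blast
      then show "\<bar>\<kappa> x y * ?W y\<bar> \<le> C"
        using weight_pos[of y "a + real k"] by (simp add: abs_mult pos_le_divide_eq)
    qed
    moreover have "v y * (\<kappa> x y * ?W y) / ?W y = \<kappa> x y * v y" for v y
      using weight_pos[of y "a + real k"] by simp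
    ultimately show ?thesis using weak[of "\<lambda>y. \<kappa> x y * ?W y"] by (simp only:)
  qed
  have "\<forall>m. \<exists>P. polynomial_degree_less k P \<and>
    frac_laplacian_viscosity s (ball 0 1) (\<lambda>y. indicat_real (ball 0 4) y * U m y) (\<lambda>x. F m x + ?H (U m) x + P x)"
    using frac_laplacian_mod_polyD[OF a s(1) K mod F] by (intro allI)
  from choice[OF this] obtain P where P: "\<forall>m. polynomial_degree_less k (P m) \<and>
    frac_laplacian_viscosity s (ball 0 1) (\<lambda>y. indicat_real (ball 0 4) y * U m y) (\<lambda>x. F m x + ?H (U m) x + P m x)" ..
  obtain r :: "nat \<Rightarrow> nat" and M \<theta> Q where r: "strict_mono r" and M: "\<forall>m. 1 \<le> M m" "(\<lambda>m. 1 / M m) \<longlonglongrightarrow> \<theta>"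
    and Q: "polynomial_degree_less k Q"
    and lim: "\<forall>X. \<forall>x\<in>ball 0 1. X \<longlonglongrightarrow> x \<and> (\<forall>m. X m \<in> ball 0 1) \<longrightarrow> (\<lambda>m. P (r m) (X m) / M m) \<longlonglongrightarrow> Q x"
    and \<theta>0: "\<theta> = 0 \<longrightarrow> (\<exists>x\<in>ball 0 1. Q x \<noteq> 0)"
    using polynomials_normalized_subsequence[where P = P and S = "ball 0 1", OF P[rule_format, THEN conjunct1]] by (elim exE conjE)
  have M0: "0 < 1 / M m" "1 / M m \<le> 1" for m using spec[OF M(1), of m] by auto
  note rlim = filterlim_subseq[OF r]
  let ?w = "\<lambda>m y. (1 / M m) * (indicat_real (ball 0 4) y * U (r m) y)"
  let ?w' = "\<lambda>y. \<theta> * (indicat_real (ball 0 4) y * u y)"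
  let ?g = "\<lambda>m x. (1 / M m) * (F (r m) x + ?H (U (r m)) x + P (r m) x)"
  let ?g' = "\<lambda>x. \<theta> * (f x + ?H u x) + Q x"
  have visc: "frac_laplacian_viscosity s (ball 0 1) (?w m) (?g m)" for m
    using P M0(1) by (intro frac_laplacian_viscosity_scale) auto
  have "frac_laplacian_viscosity s (ball 0 1) ?w' ?g'"
  proof (rule frac_laplacian_viscosity_stability[OF a s visc, where B = "(1 + 4 powr (a + real k)) * B"])
    show "locally_uniform_limit (ball 0 1) ?w ?w'"
      unfolding locally_uniform_limit_def
    proof (intro allI impI, elim conjE)
      fix S :: "(real^'n) set" assume S: "compact S" "S \<subseteq> ball 0 1"
      have US: "uniform_limit S (\<lambda>m. U (r m)) u sequentially"
        using filterlim_compose[OF unif(1)[unfolded locally_uniform_limit_def, rule_format, OF conjI[OF S]] rlim] .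
      have MS: "uniform_limit S (\<lambda>m x. 1 / M m) (\<lambda>x. \<theta>) sequentially"
        using M(2) by (auto simp: uniform_limit_iff tendsto_iff elim: eventually_mono)
      have "bounded (u ` S)"
        by (intro compact_imp_bounded compact_continuous_image S continuous_on_subset[OF uc])
      then have "uniform_limit S (\<lambda>m x. (1 / M m) * U (r m) x) (\<lambda>x. \<theta> * u x) sequentially"
        by (intro uniform_lim_mult MS US) (auto simp: image_constant_conv)
      then show "uniform_limit S ?w ?w' sequentially"
        by (rule uniform_limit_cong'[THEN iffD1, rotated 2]) (use S(2) in \<open>auto simp: indicator_def\<close>)
    qed
    show "(\<lambda>m. ?g m (X m)) \<longlonglongrightarrow> ?g' x" if x: "x \<in> ball 0 1" "\<And>m. X m \<in> ball 0 1" "X \<longlonglongrightarrow> x" for X x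
    proof -
      have "locally_uniform_limit (ball 0 1) (\<lambda>m. F (r m)) f"
        unfolding locally_uniform_limit_def
        using filterlim_compose[OF unif(2)[unfolded locally_uniform_limit_def, rule_format] rlim] by blast
      from locally_uniform_limit_tendsto(1)[OF this open_ball F x(1,3)]
      have Fl: "(\<lambda>m. F (r m) (X m)) \<longlonglongrightarrow> f x" .
      have Hl: "(\<lambda>m. ?H (U (r m)) (X m)) \<longlonglongrightarrow> ?H u x"
      proof -
        \<comment> \<open>Weak convergence acts only at the fixed point \<open>x\<close>; the moving
          argument is handled by the Lipschitz bound, uniform in \<open>m\<close> because of
          \<open>B\<close>.\<close>
        have "(\<lambda>m. ?H (U (r m)) (X m) - ?H (U (r m)) x) \<longlonglongrightarrow> 0"
        proof (rule Lim_null_comparison)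
          have "(\<lambda>m. norm (X m - x)) \<longlonglongrightarrow> 0"
            using x(3) by (simp add: tendsto_norm_zero_iff LIM_zero_iff)
          then have "(\<lambda>m. C * norm (X m - x) * B) \<longlonglongrightarrow> C * 0 * B" by (intro tendsto_mult tendsto_const)
          then show "(\<lambda>m. C * norm (X m - x) * B) \<longlonglongrightarrow> 0" by simp
          have "norm (?H (U (r m)) (X m) - ?H (U (r m)) x) \<le> C * norm (X m - x) * B" for m
          proof -
            have "norm (?H (U (r m)) (X m) - ?H (U (r m)) x)
                \<le> C * norm (X m - x) * (LINT y|lebesgue. \<bar>U (r m) y\<bar> / ?W y)"
              using kernel_remainder_lipschitz[OF K Uw x(2) x(1)] by simp
            also have "\<dots> \<le> C * norm (X m - x) * B"
              using C0 by (intro mult_left_mono B) auto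
            finally show ?thesis .
          qed
          then show "\<forall>\<^sub>F m in sequentially. norm (?H (U (r m)) (X m) - ?H (U (r m)) x) \<le> C * norm (X m - x) * B"
            by simp
        qed
        from tendsto_add[OF this filterlim_compose[OF Hlim[OF x(1)] rlim]] show ?thesis by simp
      qed
      have "(\<lambda>m. P (r m) (X m) / M m) \<longlonglongrightarrow> Q x"
        using bspec[OF spec[OF lim, of X] x(1)] x(2,3) by blast
      then have "(\<lambda>m. (1 / M m) * (F (r m) (X m) + ?H (U (r m)) (X m)) + P (r m) (X m) / M m) \<longlonglongrightarrow> ?g' x"
        by (intro tendsto_add tendsto_mult M(2) Fl Hl)
      then show ?thesis by (simp add: add_divide_distrib)
    qed
    show "continuous_on (ball 0 1) ?g'"
      by (intro continuous_on_add continuous_on_mult continuous_on_const fc kernel_remainder_continuous[OF K uw]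
          continuous_on_polynomial_degree_less[OF Q])
    show "(LINT y|lebesgue. \<bar>?w m y\<bar> / (1 + norm y powr a)) \<le> (1 + 4 powr (a + real k)) * B" for m
    proof -
      have "(LINT y|lebesgue. \<bar>?w m y\<bar> / (1 + norm y powr a))
          \<le> (LINT y|lebesgue. (1 + 4 powr (a + real k)) * (\<bar>U (r m) y\<bar> / ?W y))"
      proof (rule integral_mono_AE')
        show "integrable lebesgue (\<lambda>y. (1 + 4 powr (a + real k)) * (\<bar>U (r m) y\<bar> / ?W y))"
          by (intro integrable_mult_right weighted_L1_abs_integrable Uw)
        have "\<bar>?w m y\<bar> / (1 + norm y powr a) \<le> (1 + 4 powr (a + real k)) * (\<bar>U (r m) y\<bar> / ?W y)" for y
        proof -
          have "\<bar>?w m y\<bar> \<le> indicat_real (ball 0 4) y * \<bar>U (r m) y\<bar>"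
            using mult_right_mono[OF M0(2), of "indicat_real (ball 0 4) y * \<bar>U (r m) y\<bar>" m] M0(1)[of m]
            by (simp add: abs_mult)
          then have "\<bar>?w m y\<bar> / (1 + norm y powr a) \<le> indicat_real (ball 0 4) y * \<bar>U (r m) y\<bar> / (1 + norm y powr a)"
            using weight_pos[of y a] by (intro divide_right_mono) auto
          also have "\<dots> = weight_quotient a k y * (\<bar>U (r m) y\<bar> / ?W y)"
            unfolding weight_quotient(3)[OF a0, of y _ k] by simp
          also have "\<dots> \<le> (1 + 4 powr (a + real k)) * (\<bar>U (r m) y\<bar> / ?W y)"
            using weight_pos[of y "a + real k"] by (intro mult_right_mono weight_quotient a0) auto
          finally show ?thesis .
        qed
        then show "AE y in lebesgue. \<bar>?w m y\<bar> / (1 + norm y powr a) \<le> (1 + 4 powr (a + real k)) * (\<bar>U (r m) y\<bar> / ?W y)"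
          by simp
        show "AE y in lebesgue. 0 \<le> (1 + 4 powr (a + real k)) * (\<bar>U (r m) y\<bar> / ?W y)"
          using weight_pos[of _ "a + real k"] by (intro AE_I2 mult_nonneg_nonneg divide_nonneg_pos) (auto intro: add_nonneg_nonneg)
      qed
      also have "\<dots> = (1 + 4 powr (a + real k)) * (LINT y|lebesgue. \<bar>U (r m) y\<bar> / ?W y)"
        by (rule integral_mult_right_zero)
      also have "\<dots> \<le> (1 + 4 powr (a + real k)) * B"
        by (intro mult_left_mono B) (simp add: add_nonneg_nonneg)
      finally show ?thesis .
    qed
    show "(\<lambda>m. (LINT y|lebesgue. ?w m y * \<psi> y / (1 + norm y powr a)))
        \<longlonglongrightarrow> (LINT y|lebesgue. ?w' y * \<psi> y / (1 + norm y powr a))" if \<psi>: "L_infty \<psi>" for \<psi>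
    proof -
      have eq: "c * (indicat_real (ball 0 4) y * v y) * \<psi> y / (1 + norm y powr a)
          = c * (v y * (weight_quotient a k y * \<psi> y) / ?W y)" for c v y
      proof -
        have "c * (indicat_real (ball 0 4) y * v y) * \<psi> y / (1 + norm y powr a)
            = c * (indicat_real (ball 0 4) y * (v y * \<psi> y) / (1 + norm y powr a))" by simp
        then show ?thesis
          unfolding weight_quotient(3)[OF a0, of y _ k] by (simp add: mult_ac)
      qed
      \<comment> \<open>The truncation and the change of weight are both moved onto the test
        function, which turns the assumed weak convergence into the one that stability asks
        for.\<close>
      have "L_infty (\<lambda>y. weight_quotient a k y * \<psi> y)"
        by (intro L_infty_mult_bounded[OF \<psi> weight_quotient_measurable, where B = "1 + 4 powr (a + real k)"])
          (simp add: weight_quotient(1,2)[OF a0])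
      from filterlim_compose[OF weak[OF this] rlim]
      have "(\<lambda>m. (1 / M m) * (LINT y|lebesgue. U (r m) y * (weight_quotient a k y * \<psi> y) / ?W y))
        \<longlonglongrightarrow> \<theta> * (LINT y|lebesgue. u y * (weight_quotient a k y * \<psi> y) / ?W y)"
        by (intro tendsto_mult M(2))
      then show ?thesis unfolding eq integral_mult_right_zero .
    qed
    show "weighted_L1 a ?w'"
      by (intro weighted_L1_scale integrable_imp_weighted_L1 integrable_truncation[OF _ uw[of a]]) (use a0 in simp)
  qed
  moreover have "0 \<le> \<theta>"
    using M(2) by (rule LIMSEQ_le_const) (use M0(1) in \<open>auto intro: less_imp_le\<close>)
  \<comment> \<open>Here the limit function itself degenerates to zero, so its equation can be
    tested directly at every point of the ball, with both signs.\<close>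
  moreover have "\<theta> \<noteq> 0"
  proof
    assume \<theta>: "\<theta> = 0"
    obtain x where x: "x \<in> ball 0 1" "Q x \<noteq> 0" using \<theta>0 \<theta> by blast
    have "frac_subsolution s (ball 0 1) (\<lambda>x. 0) Q" "frac_subsolution s (ball 0 1) (\<lambda>x. 0) (\<lambda>x. - Q x)"
      using calculation(1) unfolding frac_laplacian_viscosity_iff \<theta> by simp_all
    from this[THEN frac_subsolution_zero, OF x(1)] show False using x(2) by simp
  qed
  ultimately have \<theta>: "0 < \<theta>" and visc': "frac_laplacian_viscosity s (ball 0 1) ?w' ?g'" by auto
  have "frac_laplacian_viscosity s (ball 0 1) (\<lambda>y. indicat_real (ball 0 4) y * u y)
      (\<lambda>x. f x + ?H u x + (1 / \<theta>) * Q x)"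
    using frac_laplacian_viscosity_scale[OF visc', of "1 / \<theta>"] \<theta> by (simp add: distrib_left)
  moreover have "polynomial_degree_less k (\<lambda>x. (1 / \<theta>) * Q x)"
    using polynomial_degree_less_lincomb[OF Q Q, of "1 / \<theta>" 0] by simp
  ultimately show ?thesis by (intro frac_laplacian_mod_polyI[OF a s(1) K uw uc])
qed

end
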